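(* Let $(M,\omega)$ be a compact connected quantizable Kähler manifold with very ample quantum line bundle $(L,h)$. Let $i:M\to\mathbb{P}^N(\mathbb{C})$ be the coherent state embedding and $H$ the hyperplane bundle on $\mathbb{P}^N(\mathbb{C})$. For every section $t$ of $H$ denote by $i^*(t)$ its pullback to $M$, a section of $L\cong i^*H$. Assume $t\not\equiv0$ is a global holomorphic section of $H$ and let $V_t=\{z\in\mathbb{P}^N(\mathbb{C})\mid t(z)\ne0\}$. Then for all $x,y\in M$ with $i(x),i(y)\in V_t$ $$\langle e_x,e_y\rangle_{i^*(t)}=\frac{\mathrm{vol}(\mathbb{P}^N(\mathbb{C}))}{N+1}\,\langle e_{i(x)},e_{i(y)}\rangle_t.$$
   Context: Quantum line bundle: a holomorphic line bundle $\pi:L\to M$ over the Kähler manifold $(M,\omega)$ with hermitian metric $h$ whose Chern connection has curvature $-\mathrm{i}\,\omega$; locally $\omega=-\mathrm{i}\,\partial\bar\partial\log\hat h$. $M$ is quantizable if such a bundle exists. $L$ very ample means that a basis of global holomorphic sections of $L$ defines a holomorphic embedding of $M$ into projective space. All hermitian metrics and scalar products are conjugate linear in the first argument. Scalar product on the space $\Gamma_{hol}(M,L)$ of global holomorphic sections: $\langle\varphi,\psi\rangle=\int_M h(\varphi,\psi)\,\Omega$, where $\Omega=\frac{1}{n!}\omega^n$, $n=\dim_{\mathbb{C}}M$, is the (positive) Liouville volume form; $\mathrm{vol}(M)=\int_M\Omega$. Coherent vectors: let $L_0$ be the total space of $L$ minus the zero section. For $q\in L_0$ define a linear form $\hat q$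 on $\Gamma_{hol}(M,L)$ by $s(\pi(q))=\hat q(s)\,q$. The coherent vector $e_q\in\Gamma_{hol}(M,L)$ is the unique section with $\langle e_q,s\rangle=\hat q(s)$ for all $s$. For a holomorphic section $s\not\equiv0$ and points $x,y$ with $s(x)\ne0\neq s(y)$ set $\langle e_x,e_y\rangle_s:=\langle e_{s(x)},e_{s(y)}\rangle$. Coherent state embedding: fix an orthonormal basis $s_0,\dots,s_N$ of $\Gamma_{hol}(M,L)$; then $i(x)=(s_0(x):\cdots:s_N(x))$. Projective space: $\mathbb{P}^N(\mathbb{C})$ carries the Fubini-Study form $\omega_{FS}=\mathrm{i}\,\partial\bar\partial\log(1+\|w\|^2)$ (affine coordinates $w_j=z_j/z_0$), with quantum line bundle the hyperplane bundle $H$ (dual of the tautological bundle) whose metric in the affine chart $z_0\ne0$, in the frame $t_0$, is $1/(1+\|w\|^2)$. Global sections of $H$ are the linear forms in the coordinates; $t_j$ denotes the section corresponding to $Z_j$. The scalar product, volume and coherent vectors for $(\mathbb{P}^N(\mathbb{C}),\omega_{FS},H)$ are defined by the same recipe as for $(M,\omega,L)$. The isomorphism $i^*H\cong L$ is the one under which $i^*(t_j)=s_j$ for $j=0,\dots,N$. *)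

theory Defs
  imports "HOL-Analysis.Analysis"
begin

section \<open>Calculus on open subsets of complex coordinate space\<close>

text \<open>Points of $\mathbb{C}^n$ are functions on \<open>{..<n}\<close>, extensional (\<open>undefined\<close>) outside;
  for a point \<open>z\<close> and an index \<open>j < n\<close>, \<open>z(j := u)\<close> is again such a point.\<close>

definition Cn :: "nat \<Rightarrow> (nat \<Rightarrow> complex) topology" where
  "Cn n = product_topology (\<lambda>_. euclidean) {..<n}"

definition lebesgue_Cn :: "nat \<Rightarrow> (nat \<Rightarrow> complex) measure" where
  "lebesgue_Cn n = (\<Pi>\<^sub>M i\<in>{..<n}. (lborel :: complex measure))"

definition holomorphic_Cn :: "nat \<Rightarrow> (nat \<Rightarrow> complex) set \<Rightarrow> ((nat \<Rightarrow> complex) \<Rightarrow> complex) \<Rightarrow> bool" where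
  "holomorphic_Cn n D f \<longleftrightarrow>
     continuous_map (subtopology (Cn n) D) euclidean f \<and>
     (\<forall>z\<in>D. \<forall>j<n. (\<lambda>u. f (z(j := u))) field_differentiable (at (z j)))"

text \<open>Real partial derivative in the \<open>j\<close>-th variable: with respect to $x_j$ for \<open>d = 1\<close>
  and with respect to $y_j$ for \<open>d = \<i>\<close>, where $z_j = x_j + \mathrm{i} y_j$.\<close>

definition real_partial :: "nat \<Rightarrow> complex \<Rightarrow> ((nat \<Rightarrow> complex) \<Rightarrow> complex) \<Rightarrow> (nat \<Rightarrow> complex) \<Rightarrow> complex" where
  "real_partial j d f z = vector_derivative (\<lambda>t::real. f (z(j := z j + of_real t * d))) (at 0)"

primrec Ck_on :: "nat \<Rightarrow> (nat \<Rightarrow> complex) set \<Rightarrow> nat \<Rightarrow> ((nat \<Rightarrow> complex) \<Rightarrow> complex) \<Rightarrow> bool" where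
  "Ck_on n D 0 f \<longleftrightarrow> continuous_map (subtopology (Cn n) D) euclidean f"
| "Ck_on n D (Suc k) f \<longleftrightarrow>
     continuous_map (subtopology (Cn n) D) euclidean f \<and>
     (\<forall>j<n. \<forall>d\<in>{1, \<i>}.
        (\<forall>z\<in>D. (\<lambda>t::real. f (z(j := z j + of_real t * d))) differentiable (at 0)) \<and>
        Ck_on n D k (real_partial j d f))"

definition smooth_Cn :: "nat \<Rightarrow> (nat \<Rightarrow> complex) set \<Rightarrow> ((nat \<Rightarrow> complex) \<Rightarrow> complex) \<Rightarrow> bool" where
  "smooth_Cn n D f \<longleftrightarrow> (\<forall>k. Ck_on n D k f)"

text \<open>The Wirtinger derivatives $\partial/\partial z_j$ and $\partial/\partial\bar z_j$.\<close>

definition d_z :: "nat \<Rightarrow> ((nat \<Rightarrow> complex) \<Rightarrow> complex) \<Rightarrow> (nat \<Rightarrow> complex) \<Rightarrow> complex" where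
  "d_z j f z = (real_partial j 1 f z - \<i> * real_partial j \<i> f z) / 2"

definition d_zbar :: "nat \<Rightarrow> ((nat \<Rightarrow> complex) \<Rightarrow> complex) \<Rightarrow> (nat \<Rightarrow> complex) \<Rightarrow> complex" where
  "d_zbar j f z = (real_partial j 1 f z + \<i> * real_partial j \<i> f z) / 2"


section \<open>Complex manifolds\<close>

text \<open>A chart is a pair of its domain and its coordinate map; the values of the coordinate map
  outside the domain are irrelevant. The atlas is not required to be maximal.\<close>

type_synonym 'a chart = "'a set \<times> ('a \<Rightarrow> nat \<Rightarrow> complex)"

record 'a cmanifold =
  mtop :: "'a topology"
  mdim :: nat
  atlas :: "'a chart set"

abbreviation mpoints :: "'a cmanifold \<Rightarrow> 'a set" where
  "mpoints M \<equiv> topspace (mtop M)"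

definition chart_inv :: "'a chart \<Rightarrow> (nat \<Rightarrow> complex) \<Rightarrow> 'a" where
  "chart_inv c = inv_into (fst c) (snd c)"

definition complex_manifold :: "'a cmanifold \<Rightarrow> bool" where
  "complex_manifold M \<longleftrightarrow>
     Hausdorff_space (mtop M) \<and> second_countable (mtop M) \<and>
     (\<Union>c\<in>atlas M. fst c) = mpoints M \<and>
     (\<forall>c\<in>atlas M. openin (mtop M) (fst c) \<and> openin (Cn (mdim M)) (snd c ` fst c) \<and>
        homeomorphic_map (subtopology (mtop M) (fst c))
          (subtopology (Cn (mdim M)) (snd c ` fst c)) (snd c)) \<and>
     (\<forall>c\<in>atlas M. \<forall>c'\<in>atlas M. \<forall>a<mdim M.
        holomorphic_Cn (mdim M) (snd c ` (fst c \<inter> fst c')) (\<lambda>z. snd c' (chart_inv c z) a))"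

definition holomorphic_fun :: "'a cmanifold \<Rightarrow> 'a set \<Rightarrow> ('a \<Rightarrow> complex) \<Rightarrow> bool" where
  "holomorphic_fun M W f \<longleftrightarrow>
     (\<forall>c\<in>atlas M. holomorphic_Cn (mdim M) (snd c ` (fst c \<inter> W)) (\<lambda>z. f (chart_inv c z)))"

definition holomorphic_map :: "'a cmanifold \<Rightarrow> 'b cmanifold \<Rightarrow> ('a \<Rightarrow> 'b) \<Rightarrow> bool" where
  "holomorphic_map M M' f \<longleftrightarrow>
     continuous_map (mtop M) (mtop M') f \<and>
     (\<forall>c'\<in>atlas M'. \<forall>a<mdim M'.
        holomorphic_fun M {x \<in> mpoints M. f x \<in> fst c'} (\<lambda>x. snd c' (f x) a))"

definition holomorphic_immersion :: "'a cmanifold \<Rightarrow> 'b cmanifold \<Rightarrow> ('a \<Rightarrow> 'b) \<Rightarrow> bool" where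
  "holomorphic_immersion M M' f \<longleftrightarrow>
     holomorphic_map M M' f \<and>
     (\<forall>c\<in>atlas M. \<forall>c'\<in>atlas M'. \<forall>x\<in>fst c. f x \<in> fst c' \<longrightarrow>
        (\<forall>v :: nat \<Rightarrow> complex.
           (\<forall>a<mdim M'. (\<Sum>j<mdim M. d_z j (\<lambda>z. snd c' (f (chart_inv c z)) a) (snd c x) * v j) = 0)
           \<longrightarrow> (\<forall>j<mdim M. v j = 0)))"

definition holomorphic_embedding :: "'a cmanifold \<Rightarrow> 'b cmanifold \<Rightarrow> ('a \<Rightarrow> 'b) \<Rightarrow> bool" where
  "holomorphic_embedding M M' f \<longleftrightarrow>
     holomorphic_immersion M M' f \<and> embedding_map (mtop M) (mtop M') f"


section \<open>Kaehler forms and the Liouville volume\<close>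

text \<open>A $(1,1)$-form is given by its coefficients in all charts: \<open>\<omega> c j k x\<close> is the
  coefficient $g_{jk}(x)$ in $\omega = \mathrm{i}\sum_{j,k} g_{jk}\,dz_j\wedge d\bar z_k$, where
  $z_0,\dots,z_{n-1}$ are the coordinates of the chart \<open>c\<close>.\<close>

type_synonym 'a form11 = "'a chart \<Rightarrow> nat \<Rightarrow> nat \<Rightarrow> 'a \<Rightarrow> complex"

definition smooth_form11 :: "'a cmanifold \<Rightarrow> 'a form11 \<Rightarrow> bool" where
  "smooth_form11 M \<omega> \<longleftrightarrow>
     (\<forall>c\<in>atlas M. \<forall>j<mdim M. \<forall>k<mdim M.
        smooth_Cn (mdim M) (snd c ` fst c) (\<lambda>z. \<omega> c j k (chart_inv c z))) \<and>
     (\<forall>c\<in>atlas M. \<forall>c'\<in>atlas M. \<forall>x\<in>fst c \<inter> fst c'. \<forall>j<mdim M. \<forall>k<mdim M.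
        \<omega> c j k x = (\<Sum>a<mdim M. \<Sum>b<mdim M.
           \<omega> c' a b x * d_z j (\<lambda>z. snd c' (chart_inv c z) a) (snd c x)
                      * cnj (d_z k (\<lambda>z. snd c' (chart_inv c z) b) (snd c x))))"

text \<open>For a real form, closedness consists of
  $\partial_l g_{jk} = \partial_j g_{lk}$ (the $(2,1)$-part of $d\omega$) and
  $\bar\partial_l g_{jk} = \bar\partial_k g_{jl}$ (the $(1,2)$-part).\<close>

definition kaehler_form :: "'a cmanifold \<Rightarrow> 'a form11 \<Rightarrow> bool" where
  "kaehler_form M \<omega> \<longleftrightarrow>
     smooth_form11 M \<omega> \<and>
     (\<forall>c\<in>atlas M. \<forall>x\<in>fst c.
        (\<forall>j<mdim M. \<forall>k<mdim M. \<omega> c k j x = cnj (\<omega> c j k x)) \<and>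
        (\<forall>v :: nat \<Rightarrow> complex. (\<exists>j<mdim M. v j \<noteq> 0) \<longrightarrow>
           0 < Re (\<Sum>j<mdim M. \<Sum>k<mdim M. \<omega> c j k x * v j * cnj (v k))) \<and>
        (\<forall>j<mdim M. \<forall>k<mdim M. \<forall>l<mdim M.
           d_z l (\<lambda>z. \<omega> c j k (chart_inv c z)) (snd c x)
             = d_z j (\<lambda>z. \<omega> c l k (chart_inv c z)) (snd c x) \<and>
           d_zbar l (\<lambda>z. \<omega> c j k (chart_inv c z)) (snd c x)
             = d_zbar k (\<lambda>z. \<omega> c j l (chart_inv c z)) (snd c x)))"

text \<open>The value of $\mathrm{i}\sum g_{jk}\,dz_j\wedge d\bar z_k$ on two real tangent vectors, written
  as vectors of $\mathbb{C}^n$ ($\partial_{x_j}$ is the \<open>j\<close>-th unit vector and $\partial_{y_j}$ its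
  multiple by $\mathrm{i}$). It is real if $g$ is hermitian.\<close>

definition eval_form11 ::
    "nat \<Rightarrow> (nat \<Rightarrow> nat \<Rightarrow> complex) \<Rightarrow> (nat \<Rightarrow> complex) \<Rightarrow> (nat \<Rightarrow> complex) \<Rightarrow> real" where
  "eval_form11 n g u v =
     Re (\<i> * (\<Sum>j<n. \<Sum>k<n. g j k * (u j * cnj (v k) - v j * cnj (u k))))"

text \<open>The value of the $n$-fold wedge power of a two-form on \<open>2 * n\<close> vectors (normalised such that
  $(\alpha\wedge\beta)(u,v) = \alpha(u)\beta(v)-\alpha(v)\beta(u)$ for one-forms).\<close>

definition wedge_power :: "nat \<Rightarrow> ('v \<Rightarrow> 'v \<Rightarrow> real) \<Rightarrow> (nat \<Rightarrow> 'v) \<Rightarrow> real" where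
  "wedge_power n W v =
     (\<Sum>\<sigma> | \<sigma> permutes {..<2 * n}.
        of_int (sign \<sigma>) * (\<Prod>i<n. W (v (\<sigma> (2 * i))) (v (\<sigma> (2 * i + 1))))) / 2 ^ n"

text \<open>The frame $\partial_{x_0},\partial_{y_0},\partial_{x_1},\partial_{y_1},\dots$\<close>

definition real_frame :: "nat \<Rightarrow> nat \<Rightarrow> complex" where
  "real_frame a = (\<lambda>i. if i = a div 2 then (if even a then 1 else \<i>) else 0)"

text \<open>The density of $\Omega=\frac1{n!}\omega^n$ with respect to
  $dx_0\wedge dy_0\wedge dx_1\wedge dy_1\wedge\dots$ in the chart \<open>c\<close>.\<close>

definition liouville_density :: "'a cmanifold \<Rightarrow> 'a form11 \<Rightarrow> 'a chart \<Rightarrow> 'a \<Rightarrow> real" where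
  "liouville_density M \<omega> c x =
     wedge_power (mdim M) (eval_form11 (mdim M) (\<lambda>j k. \<omega> c j k x)) real_frame / fact (mdim M)"

text \<open>To integrate over a compact \<open>M\<close>, decompose it into finitely many disjoint Borel pieces
  \<open>B i\<close>, each relatively compact in the domain of a chart \<open>c i\<close>, and integrate over each piece in its
  chart. By the change of variables formula the measure obtained does not depend on the
  decomposition.\<close>

definition chart_decomposition :: "'a cmanifold \<Rightarrow> (nat \<Rightarrow> 'a set) \<Rightarrow> (nat \<Rightarrow> 'a chart) \<Rightarrow> bool" where
  "chart_decomposition M B c \<longleftrightarrow>
     disjoint_family B \<and> finite {i. B i \<noteq> {}} \<and> (\<Union>i. B i) = mpoints M \<and>
     (\<forall>i. c i \<in> atlas M \<and> B i \<in> sigma_sets (mpoints M) {U. openin (mtop M) U} \<and>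
          (\<exists>K. compactin (mtop M) K \<and> B i \<subseteq> K \<and> K \<subseteq> fst (c i)))"

definition liouville_measure :: "'a cmanifold \<Rightarrow> 'a form11 \<Rightarrow> 'a measure" where
  "liouville_measure M \<omega> =
     (let (B, c) = (SOME (B, c). chart_decomposition M B c)
      in measure_of (mpoints M) {U. openin (mtop M) U}
           (\<lambda>A. \<Sum>i. \<integral>\<^sup>+ z. ennreal (liouville_density M \<omega> (c i) (chart_inv (c i) z))
                          * indicator (snd (c i) ` (B i \<inter> A)) z \<partial>lebesgue_Cn (mdim M)))"

definition vol :: "'a cmanifold \<Rightarrow> 'a form11 \<Rightarrow> real" where
  "vol M \<omega> = measure (liouville_measure M \<omega>) (mpoints M)"


section \<open>Hermitian holomorphic line bundles\<close>

text \<open>\<open>triv L\<close> is a family of local trivialisations: a member \<open>(V, \<psi>)\<close> consists of the set over which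
  the bundle is trivialised and the component $\pi^{-1}(V)\to\mathbb{C}$ of the trivialisation,
  which is a linear isomorphism on every fibre over \<open>V\<close>.\<close>

record ('a, 'l) line_bundle =
  tot :: "'l set"
  proj :: "'l \<Rightarrow> 'a"
  fadd :: "'l \<Rightarrow> 'l \<Rightarrow> 'l"
  fscale :: "complex \<Rightarrow> 'l \<Rightarrow> 'l"
  triv :: "('a set \<times> ('l \<Rightarrow> complex)) set"

definition fibre :: "('a, 'l) line_bundle \<Rightarrow> 'a \<Rightarrow> 'l set" where
  "fibre L x = {q \<in> tot L. proj L q = x}"

text \<open>The local frame determined by a trivialisation.\<close>

definition frame :: "('a, 'l) line_bundle \<Rightarrow> 'a set \<times> ('l \<Rightarrow> complex) \<Rightarrow> 'a \<Rightarrow> 'l" where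
  "frame L \<tau> x = inv_into (fibre L x) (snd \<tau>) 1"

definition holomorphic_line_bundle :: "'a cmanifold \<Rightarrow> ('a, 'l) line_bundle \<Rightarrow> bool" where
  "holomorphic_line_bundle M L \<longleftrightarrow>
     proj L ` tot L \<subseteq> mpoints M \<and>
     (\<Union>\<tau>\<in>triv L. fst \<tau>) = mpoints M \<and>
     (\<forall>\<tau>\<in>triv L. openin (mtop M) (fst \<tau>) \<and>
        (\<forall>x\<in>fst \<tau>. bij_betw (snd \<tau>) (fibre L x) UNIV \<and>
           (\<forall>p\<in>fibre L x. \<forall>q\<in>fibre L x.
              fadd L p q \<in> fibre L x \<and> snd \<tau> (fadd L p q) = snd \<tau> p + snd \<tau> q) \<and>
           (\<forall>a. \<forall>q\<in>fibre L x.
              fscale L a q \<in> fibre L x \<and> snd \<tau> (fscale L a q) = a * snd \<tau> q))) \<and>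
     (\<forall>\<tau>\<in>triv L. \<forall>\<tau>'\<in>triv L.
        holomorphic_fun M (fst \<tau> \<inter> fst \<tau>') (\<lambda>x. snd \<tau>' (frame L \<tau> x)))"

text \<open>The total space minus the zero section.\<close>

definition nonzero :: "('a, 'l) line_bundle \<Rightarrow> 'l set" where
  "nonzero L = {q \<in> tot L. fscale L 0 q \<noteq> q}"

text \<open>Global holomorphic sections; their values outside \<open>M\<close> are fixed by extensionality, so that
  equality of functions is equality of sections.\<close>

definition hol_sections :: "'a cmanifold \<Rightarrow> ('a, 'l) line_bundle \<Rightarrow> ('a \<Rightarrow> 'l) set" where
  "hol_sections M L =
     {s \<in> extensional (mpoints M).
        (\<forall>x\<in>mpoints M. s x \<in> fibre L x) \<and>
        (\<forall>\<tau>\<in>triv L. holomorphic_fun M (fst \<tau>) (\<lambda>x. snd \<tau> (s x)))}"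

text \<open>\<open>lincomb L c s m x\<close> is $\sum_{j=0}^m c_j s_j(x)$.\<close>

primrec lincomb ::
    "('a, 'l) line_bundle \<Rightarrow> (nat \<Rightarrow> complex) \<Rightarrow> (nat \<Rightarrow> 'a \<Rightarrow> 'l) \<Rightarrow> nat \<Rightarrow> 'a \<Rightarrow> 'l" where
  "lincomb L c s 0 x = fscale L (c 0) (s 0 x)"
| "lincomb L c s (Suc m) x = fadd L (lincomb L c s m x) (fscale L (c (Suc m)) (s (Suc m) x))"

definition section_basis ::
    "'a cmanifold \<Rightarrow> ('a, 'l) line_bundle \<Rightarrow> nat \<Rightarrow> (nat \<Rightarrow> 'a \<Rightarrow> 'l) \<Rightarrow> bool" where
  "section_basis M L N s \<longleftrightarrow>
     (\<forall>j\<le>N. s j \<in> hol_sections M L) \<and>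
     (\<forall>f\<in>hol_sections M L. \<exists>!c. c \<in> extensional {..N} \<and>
        f = (\<lambda>x\<in>mpoints M. lincomb L c s N x))"

text \<open>Conjugate linear in the first argument.\<close>

definition hermitian_metric ::
    "'a cmanifold \<Rightarrow> ('a, 'l) line_bundle \<Rightarrow> ('l \<Rightarrow> 'l \<Rightarrow> complex) \<Rightarrow> bool" where
  "hermitian_metric M L h \<longleftrightarrow>
     (\<forall>x\<in>mpoints M. \<forall>p\<in>fibre L x. \<forall>q\<in>fibre L x.
        h q p = cnj (h p q) \<and>
        (\<forall>a. h p (fscale L a q) = a * h p q) \<and>
        (\<forall>r\<in>fibre L x. h p (fadd L q r) = h p q + h p r) \<and>
        (p \<in> nonzero L \<longrightarrow> 0 < Re (h p p))) \<and>
     (\<forall>\<tau>\<in>triv L. \<forall>c\<in>atlas M.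
        smooth_Cn (mdim M) (snd c ` (fst c \<inter> fst \<tau>))
          (\<lambda>z. h (frame L \<tau> (chart_inv c z)) (frame L \<tau> (chart_inv c z))))"

text \<open>\<open>log_metric L h \<tau> c\<close> is $\log\hat h$ for the frame of \<open>\<tau>\<close>, in the coordinates of \<open>c\<close>. The
  Chern connection form is $\theta=\partial\log\hat h$ and its curvature is
  $d\theta=\bar\partial\partial\log\hat h$; \<open>chern_curvature L h \<tau> c j k\<close> is the coefficient of
  $dz_j\wedge d\bar z_k$ in it.\<close>

definition log_metric ::
    "('a, 'l) line_bundle \<Rightarrow> ('l \<Rightarrow> 'l \<Rightarrow> complex) \<Rightarrow> 'a set \<times> ('l \<Rightarrow> complex) \<Rightarrow> 'a chart
     \<Rightarrow> (nat \<Rightarrow> complex) \<Rightarrow> complex" where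
  "log_metric L h \<tau> c z =
     complex_of_real (ln (Re (h (frame L \<tau> (chart_inv c z)) (frame L \<tau> (chart_inv c z)))))"

definition chern_curvature ::
    "('a, 'l) line_bundle \<Rightarrow> ('l \<Rightarrow> 'l \<Rightarrow> complex) \<Rightarrow> 'a set \<times> ('l \<Rightarrow> complex) \<Rightarrow> 'a chart
     \<Rightarrow> nat \<Rightarrow> nat \<Rightarrow> 'a \<Rightarrow> complex" where
  "chern_curvature L h \<tau> c j k x = - d_zbar k (d_z j (log_metric L h \<tau> c)) (snd c x)"

text \<open>The curvature is $-\mathrm{i}\,\omega$, where the coefficient of $dz_j\wedge d\bar z_k$ in
  $\omega$ is \<open>\<i> * \<omega> c j k x\<close>.\<close>

definition quantum_line_bundle ::
    "'a cmanifold \<Rightarrow> 'a form11 \<Rightarrow> ('a, 'l) line_bundle \<Rightarrow> ('l \<Rightarrow> 'l \<Rightarrow> complex) \<Rightarrow> bool" where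
  "quantum_line_bundle M \<omega> L h \<longleftrightarrow>
     holomorphic_line_bundle M L \<and> hermitian_metric M L h \<and>
     (\<forall>\<tau>\<in>triv L. \<forall>c\<in>atlas M. \<forall>x\<in>fst c \<inter> fst \<tau>. \<forall>j<mdim M. \<forall>k<mdim M.
        chern_curvature L h \<tau> c j k x = - \<i> * (\<i> * \<omega> c j k x))"

definition scalar_product ::
    "'a cmanifold \<Rightarrow> 'a form11 \<Rightarrow> ('l \<Rightarrow> 'l \<Rightarrow> complex) \<Rightarrow> ('a \<Rightarrow> 'l) \<Rightarrow> ('a \<Rightarrow> 'l) \<Rightarrow> complex" where
  "scalar_product M \<omega> h f g = (LINT x|liouville_measure M \<omega>. h (f x) (g x))"

definition orthonormal_section_basis ::
    "'a cmanifold \<Rightarrow> 'a form11 \<Rightarrow> ('a, 'l) line_bundle \<Rightarrow> ('l \<Rightarrow> 'l \<Rightarrow> complex)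
     \<Rightarrow> nat \<Rightarrow> (nat \<Rightarrow> 'a \<Rightarrow> 'l) \<Rightarrow> bool" where
  "orthonormal_section_basis M \<omega> L h N s \<longleftrightarrow>
     section_basis M L N s \<and>
     (\<forall>j\<le>N. \<forall>k\<le>N. scalar_product M \<omega> h (s j) (s k) = (if j = k then 1 else 0))"


section \<open>Coherent vectors\<close>

text \<open>The linear form $\hat q$, determined by $s(\pi(q)) = \hat q(s)\,q$.\<close>

definition qhat :: "('a, 'l) line_bundle \<Rightarrow> 'l \<Rightarrow> ('a \<Rightarrow> 'l) \<Rightarrow> complex" where
  "qhat L q s = (THE a. s (proj L q) = fscale L a q)"

definition coherent_vector ::
    "'a cmanifold \<Rightarrow> 'a form11 \<Rightarrow> ('a, 'l) line_bundle \<Rightarrow> ('l \<Rightarrow> 'l \<Rightarrow> complex) \<Rightarrow> 'l \<Rightarrow> 'a \<Rightarrow> 'l" where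
  "coherent_vector M \<omega> L h q =
     (THE e. e \<in> hol_sections M L \<and>
        (\<forall>s\<in>hol_sections M L. scalar_product M \<omega> h e s = qhat L q s))"

text \<open>$\langle e_x,e_y\rangle_s = \langle e_{s(x)},e_{s(y)}\rangle$\<close>

definition coherent_product ::
    "'a cmanifold \<Rightarrow> 'a form11 \<Rightarrow> ('a, 'l) line_bundle \<Rightarrow> ('l \<Rightarrow> 'l \<Rightarrow> complex)
     \<Rightarrow> ('a \<Rightarrow> 'l) \<Rightarrow> 'a \<Rightarrow> 'a \<Rightarrow> complex" where
  "coherent_product M \<omega> L h s x y =
     scalar_product M \<omega> h (coherent_vector M \<omega> L h (s x)) (coherent_vector M \<omega> L h (s y))"


section \<open>Projective space\<close>

text \<open>The homogeneous coordinate vectors of $\mathbb{P}^N$ are the points \<open>z\<close> of $\mathbb{C}^{N+1}$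
  with indices \<open>0, \<dots>, N\<close>; a point of $\mathbb{P}^N$ is a line, i.e. a one-dimensional linear
  subspace of $\mathbb{C}^{N+1}$.\<close>

definition hscale :: "nat \<Rightarrow> complex \<Rightarrow> (nat \<Rightarrow> complex) \<Rightarrow> nat \<Rightarrow> complex" where
  "hscale N a z = (\<lambda>i\<in>{..N}. a * z i)"

definition hadd :: "nat \<Rightarrow> (nat \<Rightarrow> complex) \<Rightarrow> (nat \<Rightarrow> complex) \<Rightarrow> nat \<Rightarrow> complex" where
  "hadd N z w = (\<lambda>i\<in>{..N}. z i + w i)"

definition hvectors :: "nat \<Rightarrow> (nat \<Rightarrow> complex) set" where
  "hvectors N = {z \<in> extensional {..N}. \<exists>i\<le>N. z i \<noteq> 0}"

definition line :: "nat \<Rightarrow> (nat \<Rightarrow> complex) \<Rightarrow> (nat \<Rightarrow> complex) set" where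
  "line N z = range (\<lambda>a. hscale N a z)"

text \<open>The quotient topology of the projection \<open>line N\<close>.\<close>

definition projective_topology :: "nat \<Rightarrow> (nat \<Rightarrow> complex) set topology" where
  "projective_topology N =
     topology (\<lambda>U. U \<subseteq> line N ` hvectors N \<and> openin (Cn (Suc N)) {z \<in> hvectors N. line N z \<in> U})"

text \<open>The affine chart $z_k\neq0$, with coordinates $z_i/z_k$ for $i\neq k$, in increasing order
  of \<open>i\<close>.\<close>

definition affine_domain :: "nat \<Rightarrow> nat \<Rightarrow> (nat \<Rightarrow> complex) set set" where
  "affine_domain N k = line N ` {z \<in> hvectors N. z k \<noteq> 0}"

definition affine_rep :: "nat \<Rightarrow> (nat \<Rightarrow> complex) set \<Rightarrow> nat \<Rightarrow> complex" where
  "affine_rep k l = (THE z. z \<in> l \<and> z k = 1)"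

definition affine_chart :: "nat \<Rightarrow> nat \<Rightarrow> (nat \<Rightarrow> complex) set chart" where
  "affine_chart N k =
     (affine_domain N k, \<lambda>l. \<lambda>i\<in>{..<N}. affine_rep k l (if i < k then i else Suc i))"

definition projective_space :: "nat \<Rightarrow> (nat \<Rightarrow> complex) set cmanifold" where
  "projective_space N =
     \<lparr>mtop = projective_topology N, mdim = N, atlas = affine_chart N ` {..N}\<rparr>"

text \<open>$\omega_{FS} = \mathrm{i}\,\partial\bar\partial\log(1+\|w\|^2)$. This is the expression in every
  affine chart, since $\log(\|z\|^2/|z_k|^2)$ and $\log(\|z\|^2/|z_0|^2)$ differ by a function
  annihilated by $\partial\bar\partial$.\<close>

definition fubini_study :: "nat \<Rightarrow> (nat \<Rightarrow> complex) set form11" where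
  "fubini_study N c j k l =
     d_z j (d_zbar k (\<lambda>w. complex_of_real (ln (1 + (\<Sum>i<N. (cmod (w i))\<^sup>2))))) (snd c l)"

text \<open>The dual of the tautological bundle: an element over the line \<open>l\<close> is a linear functional
  on \<open>l\<close>. Over $z_k\neq0$ it is trivialised by the frame $t_k$, that is, by evaluating functionals
  on the vector of \<open>l\<close> with $z_k = 1$.\<close>

type_synonym hyp = "(nat \<Rightarrow> complex) set \<times> ((nat \<Rightarrow> complex) \<Rightarrow> complex)"

definition hyperplane_bundle :: "nat \<Rightarrow> ((nat \<Rightarrow> complex) set, hyp) line_bundle" where
  "hyperplane_bundle N =
     \<lparr>tot = {(l, \<xi>). l \<in> line N ` hvectors N \<and> \<xi> \<in> extensional l \<and>
               (\<forall>z\<in>l. \<forall>w\<in>l. \<xi> (hadd N z w) = \<xi> z + \<xi> w) \<and>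
               (\<forall>a. \<forall>z\<in>l. \<xi> (hscale N a z) = a * \<xi> z)},
      proj = fst,
      fadd = (\<lambda>(l, \<xi>) (_, \<eta>). (l, \<lambda>z\<in>l. \<xi> z + \<eta> z)),
      fscale = (\<lambda>a (l, \<xi>). (l, \<lambda>z\<in>l. a * \<xi> z)),
      triv = (\<lambda>k. (affine_domain N k, \<lambda>(l, \<xi>). \<xi> (affine_rep k l))) ` {..N}\<rparr>"

text \<open>The section of $H$ corresponding to the coordinate $Z_j$.\<close>

definition coord_section :: "nat \<Rightarrow> nat \<Rightarrow> (nat \<Rightarrow> complex) set \<Rightarrow> hyp" where
  "coord_section N j = (\<lambda>l\<in>line N ` hvectors N. (l, \<lambda>z\<in>l. z j))"

text \<open>The dual of the standard metric, $\overline{\xi(z)}\,\eta(z)/\|z\|^2$ for any \<open>z \<noteq> 0\<close> on the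
  line. On the frame $t_0$ its value is $|z_0|^2/\|z\|^2 = 1/(1+\|w\|^2)$.\<close>

definition hyperplane_metric :: "nat \<Rightarrow> hyp \<Rightarrow> hyp \<Rightarrow> complex" where
  "hyperplane_metric N p q =
     (let z = (SOME z. z \<in> fst p \<inter> hvectors N)
      in cnj (snd p z) * snd q z / complex_of_real (\<Sum>i\<le>N. (cmod (z i))\<^sup>2))"


section \<open>Maps to projective space, pullbacks and very ampleness\<close>

text \<open>The map $x\mapsto(s_0(x):\dots:s_N(x))$, the homogeneous coordinates being taken with respect
  to an arbitrary nonzero element of the fibre over \<open>x\<close>.\<close>

definition projective_map ::
    "('a, 'l) line_bundle \<Rightarrow> nat \<Rightarrow> (nat \<Rightarrow> 'a \<Rightarrow> 'l) \<Rightarrow> 'a \<Rightarrow> (nat \<Rightarrow> complex) set" where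
  "projective_map L N s x =
     (let q = (SOME q. q \<in> fibre L x \<inter> nonzero L) in line N (\<lambda>j\<in>{..N}. qhat L q (s j)))"

definition very_ample :: "'a cmanifold \<Rightarrow> ('a, 'l) line_bundle \<Rightarrow> bool" where
  "very_ample M L \<longleftrightarrow>
     (\<exists>N s. section_basis M L N s \<and>
        (\<forall>x\<in>mpoints M. \<exists>j\<le>N. s j x \<in> nonzero L) \<and>
        holomorphic_embedding M (projective_space N) (projective_map L N s))"

definition pullback_bundle ::
    "'a cmanifold \<Rightarrow> ('a \<Rightarrow> 'b) \<Rightarrow> ('b, 'l) line_bundle \<Rightarrow> ('a, 'a \<times> 'l) line_bundle" where
  "pullback_bundle M f H =
     \<lparr>tot = {(x, p). x \<in> mpoints M \<and> p \<in> fibre H (f x)},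
      proj = fst,
      fadd = (\<lambda>(x, p) (_, q). (x, fadd H p q)),
      fscale = (\<lambda>a (x, p). (x, fscale H a p)),
      triv = (\<lambda>\<tau>. ({x \<in> mpoints M. f x \<in> fst \<tau>}, \<lambda>(x, p). snd \<tau> p)) ` triv H\<rparr>"

definition pullback_section ::
    "'a cmanifold \<Rightarrow> ('a \<Rightarrow> 'b) \<Rightarrow> ('b \<Rightarrow> 'l) \<Rightarrow> 'a \<Rightarrow> 'a \<times> 'l" where
  "pullback_section M f t = (\<lambda>x\<in>mpoints M. (x, t (f x)))"

definition line_bundle_iso ::
    "'a cmanifold \<Rightarrow> ('a, 'k) line_bundle \<Rightarrow> ('a, 'l) line_bundle \<Rightarrow> ('k \<Rightarrow> 'l) \<Rightarrow> bool" where
  "line_bundle_iso M K L \<Phi> \<longleftrightarrow>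
     (\<forall>x\<in>mpoints M. bij_betw \<Phi> (fibre K x) (fibre L x) \<and>
        (\<forall>p\<in>fibre K x. \<forall>q\<in>fibre K x. \<Phi> (fadd K p q) = fadd L (\<Phi> p) (\<Phi> q)) \<and>
        (\<forall>a. \<forall>q\<in>fibre K x. \<Phi> (fscale K a q) = fscale L a (\<Phi> q))) \<and>
     (\<forall>\<tau>\<in>triv K. \<forall>\<tau>'\<in>triv L.
        holomorphic_fun M (fst \<tau> \<inter> fst \<tau>') (\<lambda>x. snd \<tau>' (\<Phi> (frame K \<tau> x))))"

end

(* In the fibre over x every s_j(x) is a multiple a_j(x) of i^*t(x), and these ratios are the same on
   M and on projective space, because the isomorphism i^*H = L is fibrewise linear and maps Z_j to s_j.
   If a basis of sections satisfies <s_j, s_k> = v delta_jk, then the coherent vector of q is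
   1/v times the sum of the cnj(hat q(s_j)) s_j, so <e_x, e_y> is 1/v times the sum of the
   a_j(x) cnj(a_j(y)). On M one has v = 1. On P^N the sections of H are the linear forms (by
   Liouville's theorem), and v = vol(P^N)/(N+1): the Liouville measure is the image of a multiple of
   the Lebesgue measure on the unit ball of C^(N+1), which is invariant under z_j -> -z_j and under
   permutations of the coordinates, and the squared norms |Z_j|^2 add up to 1. *)

theory Submission
  imports Defs "HOL-Complex_Analysis.Cauchy_Integral_Formula"
begin


section \<open>Powers of real two-forms in a frame\<close>

text \<open>The link to the ball is the exponent N + 1. In an affine chart the top power of the
  Fubini-Study form has density const / (1 + |w|^2)^(N+1): the coefficient matrix is a multiple of
  the identity minus a rank one matrix, so the wedge power, a signed sum over permutations, can be
  expanded and stops after the linear term. On the other side, the unit ball meets the line with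
  affine coordinates w in the disc |u| < (1 + |w|^2)^(-1/2), over which the Jacobian |u|^(2N)
  integrates to a constant times (1 + |w|^2)^(-(N+1)). Since vol(P^N) stays symbolic in the claim,
  both constants enter through positivity and finiteness alone. \<open>liouville_measure\<close>
  depends on a chart decomposition picked by \<open>SOME\<close>. On P^N the image description
  settles this, because the contribution of a piece no longer mentions its chart. On M the measure
  stays abstract: integrability of products of sections comes from <s_j, s_j> = 1, as a function
  that is not integrable has integral 0. Coherent vectors are given by \<open>THE\<close>; on P^N
  the positive volume makes them well determined.\<close>

abbreviation swap :: "nat \<Rightarrow> nat \<Rightarrow> nat \<Rightarrow> nat" where
  "swap \<equiv> Transposition.transpose"

text \<open>The indices \<open>2 * i\<close> and \<open>2 * i + 1\<close> stand for $\partial_{x_i}$ and $\partial_{y_i}$.\<close>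

definition partner :: "nat \<Rightarrow> nat" where
  "partner a = (if even a then Suc a else a - 1)"

text \<open>These are the permutations whose term in the power of the flat form is nonzero, see
  \<open>prod_flat_form\<close>.\<close>

definition paired :: "nat \<Rightarrow> (nat \<Rightarrow> nat) \<Rightarrow> bool" where
  "paired n p \<longleftrightarrow> (\<forall>i<n. p (Suc (2 * i)) = partner (p (2 * i)))"

text \<open>The values on \<open>real_frame\<close> of i times the sum of the dz_j wedge conj(dz_j),
  that is, of twice the sum of the dx_j wedge dy_j; hence the 2.\<close>

definition flat_form :: "nat \<Rightarrow> nat \<Rightarrow> real" where
  "flat_form a b = (if b = partner a then (if even a then 2 else -2) else 0)"

text \<open>The permutation sum of \<open>wedge_power\<close> for a form already evaluated on the
  frame; the factor \<open>1 / 2 ^ n\<close> is supplied in \<open>fs_constant\<close>.\<close>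

definition alternating_sum :: "nat \<Rightarrow> (nat \<Rightarrow> nat \<Rightarrow> real) \<Rightarrow> real" where
  "alternating_sum n W = (\<Sum>p | p permutes {..<2 * n}.
     of_int (sign p) * (\<Prod>i<n. W (p (2 * i)) (p (Suc (2 * i)))))"

lemma partner_partner [simp]: "partner (partner a) = a"
  by (auto simp: partner_def elim!: oddE)

lemma partner_neq [simp]: "partner a \<noteq> a" "a \<noteq> partner a"
  by (auto simp: partner_def elim!: oddE)

lemma partner_eq_iff: "partner a = b \<longleftrightarrow> a = partner b"
  by auto

lemma partner_div [simp]: "partner a div 2 = a div 2"
  by (auto simp: partner_def elim!: oddE)

lemma partner_double [simp]: "partner (2 * i) = Suc (2 * i)" "partner (Suc (2 * i)) = 2 * i"
  by (auto simp: partner_def)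

lemma even_partner [simp]: "even (partner a) \<longleftrightarrow> odd a"
  by (auto simp: partner_def elim!: oddE)

lemma div2_eq_partner: "a div 2 = b div 2 \<Longrightarrow> a = b \<or> a = partner b"
  by (cases "even a"; cases "even b") (auto simp: partner_def elim!: evenE oddE)

lemma prod_flat_form:
  "(\<Prod>i<n. flat_form (p (2 * i)) (p (Suc (2 * i)))) =
     (if paired n p then \<Prod>i<n. if even (p (2 * i)) then 2 else -2 else 0)"
proof (cases "paired n p")
  case True
  then show ?thesis by (auto simp: paired_def flat_form_def intro!: prod.cong)
next
  case False
  then obtain i where "i < n" "flat_form (p (2 * i)) (p (Suc (2 * i))) = 0"
    by (auto simp: paired_def flat_form_def)
  then show ?thesis using False by (auto intro!: prod_zero)
qed

text \<open>If two pairs of positions had their images in the same pair, some index would have two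
  preimages. The induced permutation of the n pairs serves to reindex the sum of \<open>r\<close> in
  \<open>alternating_sum_rank_one\<close>.\<close>

lemma bij_betw_paired:
  assumes "p permutes {..<2 * n}" "paired n p"
  shows "bij_betw (\<lambda>i. p (2 * i) div 2) {..<n} {..<n}"
proof -
  have inj: "inj_on (\<lambda>i. p (2 * i) div 2) {..<n}"
  proof (rule inj_onI)
    fix i j assume ij: "i \<in> {..<n}" "j \<in> {..<n}" "p (2 * i) div 2 = p (2 * j) div 2"
    have "p (2 * i) = p (2 * j) \<or> p (2 * i) = p (Suc (2 * j))"
      using div2_eq_partner[OF ij(3)] assms(2) ij by (auto simp: paired_def)
    then have "2 * i = 2 * j \<or> 2 * i = Suc (2 * j)"
      by (simp add: inj_eq[OF permutes_inj[OF assms(1)]])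
    then show "i = j" by presburger
  qed
  moreover have "(\<lambda>i. p (2 * i) div 2) ` {..<n} \<subseteq> {..<n}"
  proof clarify
    fix i assume "i < n"
    then have "p (2 * i) < 2 * n" using permutes_in_image[OF assms(1), of "2 * i"] by simp
    then show "p (2 * i) div 2 < n" by presburger
  qed
  ultimately show ?thesis
    unfolding bij_betw_def using endo_inj_surj[of "{..<n}"] by blast
qed

text \<open>A paired permutation factors as \<open>doubled \<tau> \<circ> flip F\<close>:
  \<open>F\<close> is the set of pairs whose order gets reversed, and \<open>doubled \<tau>\<close>
  moves the pairs without reversing them. This factorisation makes the sign visible.\<close>

definition doubled :: "(nat \<Rightarrow> nat) \<Rightarrow> nat \<Rightarrow> nat" where
  "doubled \<tau> a = 2 * \<tau> (a div 2) + a mod 2"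

definition flip :: "nat set \<Rightarrow> nat \<Rightarrow> nat" where
  "flip F a = (if a div 2 \<in> F then partner a else a)"

lemma flip_insert:
  assumes "i \<notin> F" shows "flip (insert i F) = swap (2 * i) (Suc (2 * i)) \<circ> flip F"
proof
  fix a
  show "flip (insert i F) a = (swap (2 * i) (Suc (2 * i)) \<circ> flip F) a"
  proof (cases "a div 2 = i")
    case True
    then have "a = 2 * i \<or> a = Suc (2 * i)" by presburger
    then show ?thesis using assms by (auto simp: flip_def)
  next
    case False
    then have "flip F a \<noteq> 2 * i" "flip F a \<noteq> Suc (2 * i)"
      by (auto simp: flip_def partner_eq_iff)
    then show ?thesis using False by (auto simp: flip_def transpose_def)
  qed
qed

lemma flip_permutes:
  assumes "finite F"
  shows "permutation (flip F) \<and> sign (flip F) = (-1) ^ card F"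
  using assms
proof (induction F rule: finite_induct)
  case empty
  have "flip {} = id" by (auto simp: flip_def)
  then show ?case by (simp add: permutation_id)
next
  case (insert i F)
  have p: "permutation (swap (2 * i) (Suc (2 * i)))" by (rule permutation_swap_id)
  show ?case
    unfolding flip_insert[OF insert(2)] sign_compose[OF p conjunct1[OF insert(3)]]
    using insert p permutation_compose[OF p conjunct1[OF insert(3)]]
    by (auto simp: sign_swap_id o_def)
qed

text \<open>Exchanging two pairs is a product of two transpositions, one of the even and one of the
  odd members, and so has sign 1.\<close>

lemma sign_doubled:
  assumes "\<tau> permutes A" "finite A"
  shows "permutation (doubled \<tau>) \<and> sign (doubled \<tau>) = 1"
  using assms
proof (induction rule: permutes_induct)
  case id
  have *: "doubled id = id" by (auto simp: doubled_def)
  show ?case unfolding * by (simp add: permutation_id)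
next
  case (swap a b r)
  have "doubled (swap a b \<circ> r) =
    swap (2 * a) (2 * b) \<circ> (swap (Suc (2 * a)) (Suc (2 * b)) \<circ> doubled r)"
  proof
    fix x :: nat
    define y where "y = r (x div 2)"
    have "x mod 2 = 0 \<or> x mod 2 = 1" by presburger
    then show "doubled (swap a b \<circ> r) x =
      (swap (2 * a) (2 * b) \<circ> (swap (Suc (2 * a)) (Suc (2 * b)) \<circ> doubled r)) x"
      unfolding doubled_def o_def y_def[symmetric]
      by (elim disjE; cases "y = a"; cases "y = b")
        (simp_all add: Transposition.transpose_def)
  qed
  then show ?case
    using swap
    by (auto simp: permutation_compose sign_compose permutation_swap_id sign_swap_id
        simp del: o_apply)
qed

text \<open>Each reversed pair contributes a factor -1 to the sign and turns one factor 2 of the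
  product into -2, so the signs cancel.\<close>

lemma sign_paired:
  assumes "p permutes {..<2 * n}" "paired n p"
  shows "of_int (sign p) * (\<Prod>i<n. if even (p (2 * i)) then 2 else -2 :: real) = 2 ^ n"
proof -
  define \<tau> where "\<tau> i = (if i < n then p (2 * i) div 2 else i)" for i
  define F where "F = {i. i < n \<and> odd (p (2 * i))}"
  have fin: "finite F" by (simp add: F_def)
  have "bij_betw \<tau> {..<n} {..<n}"
    using bij_betw_paired[OF assms] by (rule bij_betw_cong[THEN iffD1, rotated]) (auto simp: \<tau>_def)
  then have \<tau>: "\<tau> permutes {..<n}"
    by (rule bij_imp_permutes) (auto simp: \<tau>_def)
  have eq: "p = doubled \<tau> \<circ> flip F"
  proof
    fix a
    show "p a = (doubled \<tau> \<circ> flip F) a"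
    proof (cases "a < 2 * n")
      case False
      then have "\<not> a div 2 < n" by presburger
      then show ?thesis using permutes_not_in[OF assms(1), of a] False
        by (auto simp: flip_def F_def doubled_def \<tau>_def)
    next
      case True
      define i where "i = a div 2"
      have i: "i < n" using True unfolding i_def by presburger
      have s: "p (Suc (2 * i)) = partner (p (2 * i))"
        using assms(2) i by (auto simp: paired_def)
      have "a = 2 * i \<or> a = Suc (2 * i)" unfolding i_def by presburger
      then show ?thesis
      proof
        assume "a = 2 * i"
        then show ?thesis using i
          by (cases "even (p (2 * i))") (simp_all add: flip_def F_def doubled_def \<tau>_def odd_iff_mod_2_eq_one)
      next
        assume "a = Suc (2 * i)"
        then show ?thesis using i s
          by (cases "even (p (2 * i))")
            (simp_all add: flip_def F_def doubled_def \<tau>_def partner_def odd_iff_mod_2_eq_one)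
      qed
    qed
  qed
  have "sign p = (-1) ^ card F"
    using sign_doubled[OF \<tau>] flip_permutes[OF fin] by (simp add: eq sign_compose)
  moreover have "(\<Prod>i<n. if even (p (2 * i)) then 2 else -2 :: real) = (-1) ^ card F * 2 ^ n"
  proof -
    have "(\<Prod>i<n. if even (p (2 * i)) then 2 else -2 :: real)
        = (\<Prod>i<n. (if i \<in> F then -1 else 1) * 2)"
      by (intro prod.cong) (auto simp: F_def)
    also have "\<dots> = (\<Prod>i<n. if i \<in> F then -1 else 1) * 2 ^ n"
      by (simp add: prod.distrib)
    also have "(\<Prod>i<n. if i \<in> F then -1 else 1 :: real) = (\<Prod>i\<in>F. -1)"
      by (rule prod.mono_neutral_cong_right) (auto simp: F_def)
    finally show ?thesis by simp
  qed
  ultimately show ?thesis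
    by (simp flip: power_mult_distrib mult.assoc)
qed

text \<open>All paired permutations contribute the same positive amount, all others 0, and the
  identity is paired.\<close>

lemma alternating_sum_flat_pos: "alternating_sum n flat_form > 0"
  unfolding alternating_sum_def prod_flat_form
proof (rule sum_pos2)
  show "finite {p. p permutes {..<2 * n}}" by (simp add: finite_permutations)
  show "id \<in> {p. p permutes {..<2 * n}}" by (simp add: permutes_id)
  show "0 < of_int (sign id) * (if paired n id then \<Prod>i<n. if even (id (2 * i)) then 2 else - 2 else 0 :: real)"
    by (simp add: paired_def)
  fix p assume "p \<in> {p. p permutes {..<2 * n}}"
  then show "0 \<le> of_int (sign p) * (if paired n p then \<Prod>i<n. if even (p (2 * i)) then 2 else - 2 else 0 :: real)"
    using sign_paired[of p n] by auto
qed

text \<open>Composing with a transposition rearranges the summands, reverses the sign and preserves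
  \<open>G\<close>, so the sum equals its own negative.\<close>

lemma alternating_sum_eq_0:
  fixes G :: "(nat \<Rightarrow> nat) \<Rightarrow> real"
  assumes "a \<in> A" "b \<in> A" "a \<noteq> b" and sym: "\<And>p. G (p \<circ> swap a b) = G p"
    and fin: "finite A"
  shows "(\<Sum>p | p permutes A. of_int (sign p) * G p) = 0"
proof -
  let ?S = "\<Sum>p | p permutes A. of_int (sign p) * G p"
  have t: "swap a b permutes A" using assms by (simp add: permutes_swap_id)
  have "?S = (\<Sum>p | p permutes A. of_int (sign (p \<circ> swap a b)) * G (p \<circ> swap a b))"
    by (rule sum_permutations_compose_right[OF t])
  also have "\<dots> = (\<Sum>p | p permutes A. - (of_int (sign p) * G p))"
  proof (rule sum.cong[OF refl])
    fix p assume "p \<in> {p. p permutes A}"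
    then have "permutation p" using fin by (auto simp: permutation_permutes)
    then show "of_int (sign (p \<circ> swap a b)) * G (p \<circ> swap a b) = - (of_int (sign p) * G p)"
      using assms(3) by (simp add: sign_compose permutation_swap_id sign_swap_id sym)
  qed
  also have "\<dots> = - ?S" by (simp add: sum_negf)
  finally show ?thesis by simp
qed

section \<open>The flat form minus a multiple of a decomposable two-form\<close>

context
  fixes n :: nat and \<theta> \<eta> r :: "nat \<Rightarrow> real" and R :: "nat \<Rightarrow> nat \<Rightarrow> real"
  assumes R: "R = (\<lambda>a b. 2 * (\<theta> a * \<eta> b - \<eta> a * \<theta> b))"
    and Rp: "\<And>a. a < 2 * n \<Longrightarrow> R a (partner a) = r (a div 2) * flat_form a (partner a)"
begin

text \<open>This is R wedge R = 0. Each of the four products in the expansion contains the same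
  covector, \<theta> or \<eta>, at a position of pair \<open>i\<close> and at a position of pair
  \<open>j\<close>, and exchanging these two positions leaves the product unchanged.
  \<open>X\<close> stands for the factors at the other pairs, which do not notice the
  exchange.\<close>

lemma alternating_sum_rank_one_square:
  assumes ij: "i < n" "j < n" "i \<noteq> j"
    and X: "\<And>p p'. (\<And>a. a div 2 \<noteq> i \<Longrightarrow> a div 2 \<noteq> j \<Longrightarrow> p a = p' a) \<Longrightarrow> X p = X p'"
  shows "(\<Sum>p | p permutes {..<2 * n}. of_int (sign p) *
     (R (p (2 * i)) (p (Suc (2 * i))) * R (p (2 * j)) (p (Suc (2 * j))) * X p)) = 0"
proof -
  let ?p = "2 * i" and ?q = "Suc (2 * i)" and ?r = "2 * j" and ?s = "Suc (2 * j)"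
  have Xt: "X (p \<circ> swap a b) = X p" if "a div 2 = i" "b div 2 = j" for p a b
    by (rule X) (use that in \<open>auto simp: transpose_def\<close>)
  have ne: "?p \<noteq> ?r" "?p \<noteq> ?s" "?q \<noteq> ?r" "?q \<noteq> ?s" using ij by presburger+
  have m: "?p \<in> {..<2 * n}" "?q \<in> {..<2 * n}" "?r \<in> {..<2 * n}" "?s \<in> {..<2 * n}" using ij by auto
  have z: "(\<Sum>p | p permutes {..<2 * n}. of_int (sign p) *
      (u (p a) * u (p b) * (v (p c) * v (p d)) * X p)) = 0"
    if "a div 2 = i" "b div 2 = j" "a < 2 * n" "b < 2 * n" "a \<noteq> b" "c \<noteq> a" "c \<noteq> b" "d \<noteq> a" "d \<noteq> b"
    for u v :: "nat \<Rightarrow> real" and a b c d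
  proof (rule alternating_sum_eq_0[of a _ b])
    fix p :: "nat \<Rightarrow> nat"
    show "u ((p \<circ> swap a b) a) * u ((p \<circ> swap a b) b) *
        (v ((p \<circ> swap a b) c) * v ((p \<circ> swap a b) d)) *
        X (p \<circ> swap a b) = u (p a) * u (p b) * (v (p c) * v (p d)) * X p"
      using that Xt[of a b p] by simp
  qed (use that in auto)
  have z1: "(\<Sum>p | p permutes {..<2 * n}. of_int (sign p) *
      (\<theta> (p ?p) * \<theta> (p ?r) * (\<eta> (p ?q) * \<eta> (p ?s)) * X p)) = 0"
    by (rule z) (use ne ij in auto)
  have z2: "(\<Sum>p | p permutes {..<2 * n}. of_int (sign p) *
      (\<theta> (p ?p) * \<theta> (p ?s) * (\<eta> (p ?q) * \<eta> (p ?r)) * X p)) = 0"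
    by (rule z) (use ne ij in auto)
  have z3: "(\<Sum>p | p permutes {..<2 * n}. of_int (sign p) *
      (\<eta> (p ?p) * \<eta> (p ?s) * (\<theta> (p ?q) * \<theta> (p ?r)) * X p)) = 0"
    by (rule z) (use ne ij in auto)
  have z4: "(\<Sum>p | p permutes {..<2 * n}. of_int (sign p) *
      (\<eta> (p ?p) * \<eta> (p ?r) * (\<theta> (p ?q) * \<theta> (p ?s)) * X p)) = 0"
    by (rule z) (use ne ij in auto)
  have "(\<Sum>p | p permutes {..<2 * n}. of_int (sign p) *
     (R (p ?p) (p ?q) * R (p ?r) (p ?s) * X p)) =
    (\<Sum>p | p permutes {..<2 * n}.
      4 * (of_int (sign p) * (\<theta> (p ?p) * \<theta> (p ?r) * (\<eta> (p ?q) * \<eta> (p ?s)) * X p))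
      - 4 * (of_int (sign p) * (\<theta> (p ?p) * \<theta> (p ?s) * (\<eta> (p ?q) * \<eta> (p ?r)) * X p))
      - 4 * (of_int (sign p) * (\<eta> (p ?p) * \<eta> (p ?s) * (\<theta> (p ?q) * \<theta> (p ?r)) * X p))
      + 4 * (of_int (sign p) * (\<eta> (p ?p) * \<eta> (p ?r) * (\<theta> (p ?q) * \<theta> (p ?s)) * X p)))"
    by (intro sum.cong refl) (simp add: R algebra_simps)
  also have "\<dots> = 0"
    unfolding sum.distrib sum_subtractf sum_distrib_left[symmetric] z1 z2 z3 z4 by simp
  finally show ?thesis .
qed

text \<open>On a matched pair, \<open>R\<close> is \<open>r\<close> times the flat form by
  \<open>Rp\<close>. If pair \<open>i\<close> is not matched, both sides vanish: a permutation
  cannot mismatch a single pair, so some other factor \<open>flat_form\<close> is 0 as well.\<close>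

lemma rank_one_term:
  assumes p: "p permutes {..<2 * n}" and i: "i < n"
  shows "R (p (2 * i)) (p (Suc (2 * i))) *
       (\<Prod>k\<in>{..<n} - {i}. flat_form (p (2 * k)) (p (Suc (2 * k)))) =
     r (p (2 * i) div 2) * (\<Prod>k<n. flat_form (p (2 * k)) (p (Suc (2 * k))))"
proof (cases "p (Suc (2 * i)) = partner (p (2 * i))")
  case True
  have "p (2 * i) < 2 * n" using permutes_in_image[OF p, of "2 * i"] i by auto
  then show ?thesis using True i
    by (simp add: Rp prod.remove[of "{..<n}" i])
next
  case False
  have "\<exists>k\<in>{..<n} - {i}. p (Suc (2 * k)) \<noteq> partner (p (2 * k))"
  proof (rule ccontr)
    assume "\<not> ?thesis"
    then have all: "\<And>k. k < n \<Longrightarrow> k \<noteq> i \<Longrightarrow> p (Suc (2 * k)) = partner (p (2 * k))" by auto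
    define b where "b = p (2 * i)"
    have "b \<in> {..<2 * n}" using permutes_in_image[OF p, of "2 * i"] i by (auto simp: b_def)
    then have "partner b \<in> {..<2 * n}" by (auto simp: partner_def)
    \<comment> \<open>\<open>c\<close> is the position that \<open>p\<close> sends to the partner of
      \<open>p (2 * i)\<close>, and \<open>k\<close> will be its pair. If \<open>k = i\<close>, then
      pair \<open>i\<close> is matched; otherwise the matched pair \<open>k\<close> would also take
      the value \<open>p (2 * i)\<close>, against injectivity.\<close>
    then obtain c where c: "c < 2 * n" "p c = partner b"
      using permutes_image[OF p] by (metis image_iff lessThan_iff)
    define k where "k = c div 2"
    have k: "k < n" using c unfolding k_def by presburger
    have ck: "c = 2 * k \<or> c = Suc (2 * k)" unfolding k_def by presburger
    show False
    proof (cases "k = i")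
      case True
      then show ?thesis using ck c False by (auto simp: b_def)
    next
      case False
      then have "p (partner c) = b" using ck all[OF k False] c
        by (metis partner_double partner_partner)
      then have "partner c = 2 * i" unfolding b_def using permutes_inj[OF p] by (auto dest: injD)
      then have "c div 2 = i" by (metis partner_div nonzero_mult_div_cancel_left zero_neq_numeral)
      then show ?thesis using False by (simp add: k_def)
    qed
  qed
  then have z: "(\<Prod>k\<in>{..<n} - {i}. flat_form (p (2 * k)) (p (Suc (2 * k)))) = 0"
    by (auto simp: flat_form_def)
  then show ?thesis using i by (simp add: prod.remove[of "{..<n}" i])
qed

text \<open>The square of the decomposable two-form \<open>R\<close> vanishes, so that only the terms of degree at
  most one in \<open>\<beta>\<close> survive.\<close>

lemma alternating_sum_rank_one:
  "alternating_sum n (\<lambda>a b. \<alpha> * flat_form a b - \<beta> * R a b) =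
     (\<alpha> ^ n - \<beta> * \<alpha> ^ (n - 1) * (\<Sum>j<n. r j)) * alternating_sum n flat_form"
proof -
  define P where "P = {p. p permutes {..<2 * n}}"
  define f where "f p i = - \<beta> * R (p (2 * i)) (p (Suc (2 * i)))" for p i
  define g where "g p i = \<alpha> * flat_form (p (2 * i)) (p (Suc (2 * i)))" for p i
  \<comment> \<open>\<open>T X\<close> collects the terms in which the factor with \<open>R\<close>
    is chosen exactly at the pairs in \<open>X\<close>; \<open>S\<close> lists the sets
    \<open>X\<close> with at most one element.\<close>
  define T where "T X = (\<Sum>p\<in>P. of_int (sign p) * (prod (f p) X * prod (g p) ({..<n} - X)))" for X
  define S where "S = insert {} ((\<lambda>i. {i}) ` {..<n})"
  have "alternating_sum n (\<lambda>a b. \<alpha> * flat_form a b - \<beta> * R a b) =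
      (\<Sum>p\<in>P. of_int (sign p) * (\<Prod>i<n. f p i + g p i))"
    unfolding alternating_sum_def P_def f_def g_def by (intro sum.cong refl) simp
  also have "\<dots> = (\<Sum>X\<in>Pow {..<n}. T X)"
    unfolding T_def
    by (subst sum.swap) (intro sum.cong refl, simp only: prod_add[OF finite_lessThan] sum_distrib_left)
  also have "\<dots> = (\<Sum>X\<in>S. T X)"
  proof (rule sum.mono_neutral_right)
    show "\<forall>X\<in>Pow {..<n} - S. T X = 0"
    proof
      fix X assume X: "X \<in> Pow {..<n} - S"
      then obtain i where i: "i \<in> X" by (auto simp: S_def)
      then have "X \<noteq> {i}" using X by (auto simp: S_def)
      then obtain j where j: "j \<in> X" "j \<noteq> i" using i by auto
      have fX: "finite X" using X by (auto intro: finite_subset)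
      have "T X = \<beta>\<^sup>2 * (\<Sum>p | p permutes {..<2 * n}. of_int (sign p) *
        (R (p (2 * i)) (p (Suc (2 * i))) * R (p (2 * j)) (p (Suc (2 * j))) *
          (prod (f p) (X - {i} - {j}) * prod (g p) ({..<n} - X))))"
        unfolding T_def sum_distrib_left P_def
      proof (intro sum.cong refl)
        fix p
        have "prod (f p) X = f p i * (f p j * prod (f p) (X - {i} - {j}))"
          using i j fX prod.remove[of X i "f p"] prod.remove[of "X - {i}" j "f p"] by auto
        then show "of_int (sign p) * (prod (f p) X * prod (g p) ({..<n} - X)) =
          \<beta>\<^sup>2 * (of_int (sign p) * (R (p (2 * i)) (p (Suc (2 * i))) * R (p (2 * j)) (p (Suc (2 * j))) *
          (prod (f p) (X - {i} - {j}) * prod (g p) ({..<n} - X))))"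
          by (simp add: f_def[of _ i] f_def[of _ j] power2_eq_square)
      qed
      also have "\<dots> = 0"
      proof (subst alternating_sum_rank_one_square)
        fix p p' :: "nat \<Rightarrow> nat"
        assume eq: "\<And>a. a div 2 \<noteq> i \<Longrightarrow> a div 2 \<noteq> j \<Longrightarrow> p a = p' a"
        have "prod (f p) (X - {i} - {j}) = prod (f p') (X - {i} - {j})"
          by (rule prod.cong) (auto simp: f_def eq)
        moreover have "prod (g p) ({..<n} - X) = prod (g p') ({..<n} - X)"
        proof (rule prod.cong[OF refl])
          fix k assume "k \<in> {..<n} - X"
          then have "k \<noteq> i" "k \<noteq> j" using i j by auto
          then show "g p k = g p' k" by (simp add: g_def eq)
        qed
        ultimately show "prod (f p) (X - {i} - {j}) * prod (g p) ({..<n} - X) =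
            prod (f p') (X - {i} - {j}) * prod (g p') ({..<n} - X)" by simp
      qed (use i j X in auto)
      finally show "T X = 0" .
    qed
  qed (auto simp: S_def)
  also have "\<dots> = T {} + (\<Sum>i<n. T {i})"
    unfolding S_def by (subst sum.insert) (auto simp: sum.reindex inj_on_def)
  also have "T {} = \<alpha> ^ n * alternating_sum n flat_form"
    unfolding T_def P_def g_def alternating_sum_def sum_distrib_left
    by (intro sum.cong refl) (simp add: prod.distrib)
  also have "(\<Sum>i<n. T {i}) = - \<beta> * \<alpha> ^ (n - 1) * (\<Sum>j<n. r j) * alternating_sum n flat_form"
  proof -
    define w where "w p = of_int (sign p) * (\<Prod>k<n. flat_form (p (2 * k)) (p (Suc (2 * k))))" for p
    have "T {i} = (\<Sum>p\<in>P. - \<beta> * \<alpha> ^ (n - 1) * (w p * r (p (2 * i) div 2)))" if "i < n" for i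
      unfolding T_def
    proof (rule sum.cong[OF refl])
      fix p assume "p \<in> P"
      then have *: "R (p (2 * i)) (p (Suc (2 * i))) *
       (\<Prod>k\<in>{..<n} - {i}. flat_form (p (2 * k)) (p (Suc (2 * k)))) =
       r (p (2 * i) div 2) * (\<Prod>k<n. flat_form (p (2 * k)) (p (Suc (2 * k))))"
        using that by (intro rank_one_term) (auto simp: P_def)
      have "prod (f p) {i} * prod (g p) ({..<n} - {i}) = - \<beta> * \<alpha> ^ (n - 1) *
          (R (p (2 * i)) (p (Suc (2 * i))) *
       (\<Prod>k\<in>{..<n} - {i}. flat_form (p (2 * k)) (p (Suc (2 * k)))))"
        using that by (simp add: f_def g_def prod.distrib)
      then show "of_int (sign p) * (prod (f p) {i} * prod (g p) ({..<n} - {i})) =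
         - \<beta> * \<alpha> ^ (n - 1) * (w p * r (p (2 * i) div 2))"
        unfolding * by (simp add: w_def)
    qed
    then have "(\<Sum>i<n. T {i}) = (\<Sum>i<n. \<Sum>p\<in>P. - \<beta> * \<alpha> ^ (n - 1) * (w p * r (p (2 * i) div 2)))"
      by simp
    also have "\<dots> = - \<beta> * \<alpha> ^ (n - 1) * (\<Sum>p\<in>P. w p * (\<Sum>i<n. r (p (2 * i) div 2)))"
      by (subst sum.swap) (simp add: sum_distrib_left)
    \<comment> \<open>A paired \<open>p\<close> permutes the pairs, so the sum of \<open>r\<close>
      does not depend on it; every other \<open>p\<close> has weight \<open>w p = 0\<close>.\<close>
    also have "(\<Sum>p\<in>P. w p * (\<Sum>i<n. r (p (2 * i) div 2))) = (\<Sum>p\<in>P. w p * (\<Sum>j<n. r j))"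
    proof (rule sum.cong[OF refl])
      fix p assume p: "p \<in> P"
      show "w p * (\<Sum>i<n. r (p (2 * i) div 2)) = w p * (\<Sum>j<n. r j)"
      proof (cases "paired n p")
        case True
        then show ?thesis
          using sum.reindex_bij_betw[OF bij_betw_paired, of p n r] p by (simp add: P_def)
      next
        case False
        then show ?thesis by (simp add: w_def prod_flat_form)
      qed
    qed
    also have "(\<Sum>p\<in>P. w p * (\<Sum>j<n. r j)) = (\<Sum>j<n. r j) * alternating_sum n flat_form"
      by (simp add: w_def P_def alternating_sum_def sum_distrib_right[symmetric])
    finally show ?thesis by simp
  qed
  finally show ?thesis by (simp only: ring_distribs mult_minus_left diff_conv_add_uminus)
qed

end

section \<open>The Liouville density of the Fubini-Study form\<close>

abbreviation sq_norm :: "nat set \<Rightarrow> (nat \<Rightarrow> complex) \<Rightarrow> real" where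
  "sq_norm A w \<equiv> \<Sum>i\<in>A. (cmod (w i))\<^sup>2"

section \<open>The coefficients of the Fubini-Study form\<close>

lemma real_partial_eqI:
  "((\<lambda>t::real. f (z(j := z j + of_real t * d))) has_vector_derivative D) (at 0) \<Longrightarrow> real_partial j d f z = D"
  unfolding real_partial_def by (rule vector_derivative_at)

lemma sum_cmod_fun_upd_has_derivative:
  fixes w :: "nat \<Rightarrow> complex"
  assumes "j < N"
  shows "((\<lambda>t. 1 + (\<Sum>i<N. (cmod ((w(j := w j + complex_of_real t * d)) i))\<^sup>2))
    has_field_derivative 2 * Re (cnj (w j) * d)) (at 0)"
proof -
  have "(\<lambda>t. 1 + (\<Sum>i<N. (cmod ((w(j := w j + complex_of_real t * d)) i))\<^sup>2)) =
    (\<lambda>t. 1 + (\<Sum>i\<in>{..<N} - {j}. (cmod (w i))\<^sup>2) +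
        ((Re (w j) + t * Re d)\<^sup>2 + (Im (w j) + t * Im d)\<^sup>2))"
  proof
    fix t
    have "(\<Sum>i<N. (cmod ((w(j := w j + complex_of_real t * d)) i))\<^sup>2) =
      (cmod (w j + complex_of_real t * d))\<^sup>2 + (\<Sum>i\<in>{..<N} - {j}. (cmod (w i))\<^sup>2)"
      using assms by (subst sum.remove[of "{..<N}" j]) auto
    then show "1 + (\<Sum>i<N. (cmod ((w(j := w j + complex_of_real t * d)) i))\<^sup>2) =
      1 + (\<Sum>i\<in>{..<N} - {j}. (cmod (w i))\<^sup>2) +
        ((Re (w j) + t * Re d)\<^sup>2 + (Im (w j) + t * Im d)\<^sup>2)"
      by (simp add: cmod_power2[of "w j + _"])
  qed
  moreover have "(\<dots> has_field_derivative 2 * Re (cnj (w j) * d)) (at 0)"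
    by (auto intro!: derivative_eq_intros)
  ultimately show ?thesis by simp
qed

lemma one_plus_sum_cmod_pos: "1 + sq_norm {..<N} w > 0"
  by (intro add_pos_nonneg sum_nonneg) auto

text \<open>The real factor is kept in a \<open>*\<^sub>R\<close>, the form in which
  \<open>d_z_quotient\<close> differentiates it by the product rule.\<close>

lemma d_zbar_log:
  assumes "k < N"
  shows "d_zbar k (\<lambda>w. complex_of_real (ln (1 + sq_norm {..<N} w))) w =
    (1 / (1 + sq_norm {..<N} w)) *\<^sub>R w k"
proof -
  have *: "real_partial k d (\<lambda>w. complex_of_real (ln (1 + sq_norm {..<N} w))) w =
     complex_of_real (2 * Re (cnj (w k) * d) / (1 + sq_norm {..<N} w))" for d
  proof (rule real_partial_eqI, rule bounded_linear.has_vector_derivative[OF bounded_linear_of_real])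
    show "((\<lambda>t. ln (1 + (\<Sum>i<N. (cmod ((w(k := w k + complex_of_real t * d)) i))\<^sup>2)))
       has_vector_derivative 2 * Re (cnj (w k) * d) / (1 + sq_norm {..<N} w)) (at 0)"
      unfolding has_real_derivative_iff_has_vector_derivative[symmetric]
      by (rule DERIV_cong, rule DERIV_chain2[OF DERIV_ln], simp add: one_plus_sum_cmod_pos,
          rule sum_cmod_fun_upd_has_derivative[OF assms]) (simp add: field_simps)
  qed
  define S where "S = 1 + sq_norm {..<N} w"
  show ?thesis unfolding d_zbar_def * S_def[symmetric] by (simp add: complex_eq_iff field_simps)
qed

lemma d_z_quotient:
  assumes "j < N"
  shows "d_z j (\<lambda>w. (1 / (1 + sq_norm {..<N} w)) *\<^sub>R w k) w =
    (if j = k then of_real (1 / (1 + sq_norm {..<N} w)) else 0)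
     - of_real (1 / (1 + sq_norm {..<N} w)\<^sup>2) * (cnj (w j) * w k)"
proof -
  define S where "S = 1 + sq_norm {..<N} w"
  have S: "S > 0" unfolding S_def by (rule one_plus_sum_cmod_pos)
  have *: "real_partial j d (\<lambda>w. (1 / (1 + sq_norm {..<N} w)) *\<^sub>R w k) w =
     (1 / S) *\<^sub>R (if j = k then d else 0) + (- 2 * Re (cnj (w j) * d) / S\<^sup>2) *\<^sub>R w k" for d
  proof (rule real_partial_eqI)
    have d1: "((\<lambda>t. 1 / (1 + (\<Sum>i<N. (cmod ((w(j := w j + complex_of_real t * d)) i))\<^sup>2)))
        has_field_derivative (- 2 * Re (cnj (w j) * d) / S\<^sup>2)) (at 0)"
      by (rule DERIV_cong, rule DERIV_divide[OF DERIV_const sum_cmod_fun_upd_has_derivative[OF assms]])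
        (use S in \<open>simp_all add: S_def[symmetric] power2_eq_square[of S, symmetric]\<close>)
    have d2: "((\<lambda>t. (w(j := w j + complex_of_real t * d)) k) has_vector_derivative (if j = k then d else 0)) (at 0)"
    proof (cases "j = k")
      case True
      have "((\<lambda>t. w k + complex_of_real t * d) has_vector_derivative d) (at 0)"
        by (auto intro!: derivative_eq_intros simp: scaleR_conv_of_real has_vector_derivative_def)
      then show ?thesis using True by simp
    qed simp
    show "((\<lambda>t. (1 / (1 + (\<Sum>i<N. (cmod ((w(j := w j + complex_of_real t * d)) i))\<^sup>2))) *\<^sub>R
         (w(j := w j + complex_of_real t * d)) k) has_vector_derivative
       (1 / S) *\<^sub>R (if j = k then d else 0) + (- 2 * Re (cnj (w j) * d) / S\<^sup>2) *\<^sub>R w k) (at 0)"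
      using has_vector_derivative_scaleR[OF d1 d2] by (simp add: S_def)
  qed
  show ?thesis using S
    unfolding d_z_def * S_def[symmetric] by (auto simp: complex_eq_iff field_simps)
qed

text \<open>A multiple of the identity minus a rank one matrix: this shape brings the top power
  within reach of \<open>alternating_sum_rank_one\<close>.\<close>

lemma fubini_study_eq:
  fixes N c l defines "w \<equiv> snd c l" and "S \<equiv> 1 + (\<Sum>i<N. (cmod (snd c l i))\<^sup>2)"
  assumes "j < N" "k < N"
  shows "fubini_study N c j k l =
    (if j = k then of_real (1 / S) else 0) - of_real (1 / S\<^sup>2) * (cnj (w j) * w k)"
proof -
  have "d_zbar k (\<lambda>w. complex_of_real (ln (1 + sq_norm {..<N} w))) =
     (\<lambda>w. (1 / (1 + sq_norm {..<N} w)) *\<^sub>R w k)"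
    using d_zbar_log[OF assms(4)] by blast
  then show ?thesis unfolding fubini_study_def w_def S_def by (simp add: d_z_quotient[OF assms(3)])
qed

lemma sum_real_frame:
  assumes "a < 2 * n"
  shows "(\<Sum>j<n. f j * real_frame a j) = f (a div 2) * (if even a then 1 else \<i>)"
proof -
  have "a div 2 < n" using assms by linarith
  have "(\<Sum>j<n. f j * real_frame a j) = (\<Sum>j<n. if j = a div 2 then f j * (if even a then 1 else \<i>) else 0)"
    by (intro sum.cong) (auto simp: real_frame_def)
  also have "\<dots> = f (a div 2) * (if even a then 1 else \<i>)"
    using \<open>a div 2 < n\<close> by simp
  finally show ?thesis .
qed

lemma eval_form11_flat:
  assumes "a < 2 * n" "b < 2 * n"
  shows "eval_form11 n (\<lambda>j k. if j = k then 1 else 0) (real_frame a) (real_frame b) = flat_form a b"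
proof -
  have "(\<Sum>j<n. \<Sum>k<n. (if j = k then 1 else 0) *
        (real_frame a j * cnj (real_frame b k) - real_frame b j * cnj (real_frame a k))) =
     (\<Sum>j<n. cnj (real_frame b j) * real_frame a j) - (\<Sum>j<n. cnj (real_frame a j) * real_frame b j)"
    unfolding sum_subtractf[symmetric] by (intro sum.cong refl) (simp add: if_distrib[of "\<lambda>x. x * _"] mult.commute cong: if_cong)
  also have "\<dots> = cnj (real_frame b (a div 2)) * (if even a then 1 else \<i>)
      - cnj (real_frame a (b div 2)) * (if even b then 1 else \<i>)"
    by (simp only: sum_real_frame[OF assms(1)] sum_real_frame[OF assms(2)])
  finally have *: "(\<Sum>j<n. \<Sum>k<n. (if j = k then 1 else 0) *
        (real_frame a j * cnj (real_frame b k) - real_frame b j * cnj (real_frame a k))) =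
     cnj (real_frame b (a div 2)) * (if even a then 1 else \<i>)
      - cnj (real_frame a (b div 2)) * (if even b then 1 else \<i>)" .
  show ?thesis
  proof (cases "a div 2 = b div 2")
    case False
    then have "b \<noteq> partner a" by auto
    then show ?thesis using False unfolding eval_form11_def * by (simp add: real_frame_def flat_form_def)
  next
    case True
    then have "b = partner a \<longleftrightarrow> even a \<noteq> even b"
      using div2_eq_partner[of b a] by auto
    then show ?thesis using True unfolding eval_form11_def * by (auto simp: real_frame_def flat_form_def)
  qed
qed

text \<open>The matrix belongs to i times \<beta> wedge conj(\<beta>), where \<beta> is the sum of
  the conj(w_j) dz_j, and this form equals twice Re \<beta> wedge Im \<beta>, which is decomposable.
  \<open>\<theta> a\<close> is the value of \<beta> on the frame vector with index
  \<open>a\<close>.\<close>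

lemma eval_form11_rank_one:
  fixes w :: "nat \<Rightarrow> complex" and n :: nat
  defines "\<theta> \<equiv> \<lambda>a. cnj (w (a div 2)) * (if even a then 1 else \<i>)"
  assumes "a < 2 * n" "b < 2 * n"
  shows "eval_form11 n (\<lambda>j k. cnj (w j) * w k) (real_frame a) (real_frame b) =
     2 * (Re (\<theta> a) * Im (\<theta> b) - Im (\<theta> a) * Re (\<theta> b))"
proof -
  have t: "(\<Sum>j<n. cnj (w j) * real_frame c j) = \<theta> c" if "c < 2 * n" for c
    unfolding \<theta>_def by (rule sum_real_frame[OF that])
  have p: "(\<Sum>j<n. \<Sum>k<n. cnj (w j) * w k * (u j * cnj (v k))) =
      (\<Sum>j<n. cnj (w j) * u j) * cnj (\<Sum>k<n. cnj (w k) * v k)" for u v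
    by (simp add: sum_product mult_ac)
  have "(\<Sum>j<n. \<Sum>k<n. cnj (w j) * w k *
        (real_frame a j * cnj (real_frame b k) - real_frame b j * cnj (real_frame a k))) =
     \<theta> a * cnj (\<theta> b) - \<theta> b * cnj (\<theta> a)"
    by (simp only: right_diff_distrib sum_subtractf p t[OF assms(2)] t[OF assms(3)])
  then show ?thesis unfolding eval_form11_def by simp
qed

lemma eval_form11_linear:
  "eval_form11 n (\<lambda>j k. of_real \<alpha> * f j k - of_real \<beta> * g j k) u v = \<alpha> * eval_form11 n f u v - \<beta> * eval_form11 n g u v"
proof -
  have "(\<Sum>j<n. \<Sum>k<n. (of_real \<alpha> * f j k - of_real \<beta> * g j k) * (u j * cnj (v k) - v j * cnj (u k))) =
    of_real \<alpha> * (\<Sum>j<n. \<Sum>k<n. f j k * (u j * cnj (v k) - v j * cnj (u k))) -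
    of_real \<beta> * (\<Sum>j<n. \<Sum>k<n. g j k * (u j * cnj (v k) - v j * cnj (u k)))"
    unfolding sum_distrib_left sum_subtractf[symmetric] 
    by (intro sum.cong refl) (simp only: left_diff_distrib mult.assoc)
  then show ?thesis unfolding eval_form11_def
    by (simp add: right_diff_distrib)
qed

text \<open>The Liouville density at the origin of an affine chart; the divisors are those of
  \<open>wedge_power\<close> and \<open>liouville_density\<close>.\<close>

definition fs_constant :: "nat \<Rightarrow> real" where
  "fs_constant N = alternating_sum N flat_form / 2 ^ N / fact N"

lemma fs_constant_pos: "fs_constant N > 0"
  by (simp add: fs_constant_def alternating_sum_flat_pos)

text \<open>With Q = |w|^2 the rank one formula gives (1+Q)^(-N) - Q (1+Q)^(-N-1) = (1+Q)^(-N-1),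
  the determinant of the coefficient matrix.\<close>

lemma liouville_density_fubini_study:
  assumes "mdim M = N"
  shows "liouville_density M (fubini_study N) c x =
    fs_constant N / (1 + (\<Sum>i<N. (cmod (snd c x i))\<^sup>2)) ^ Suc N"
proof -
  define w where "w = snd c x"
  define Q where "Q = sq_norm {..<N} w"
  define \<theta> where "\<theta> = (\<lambda>a. cnj (w (a div 2)) * (if even a then 1 else \<i>))"
  define R where "R = (\<lambda>a b. 2 * (Re (\<theta> a) * Im (\<theta> b) - Im (\<theta> a) * Re (\<theta> b)))"
  have Q: "1 + Q > 0" unfolding Q_def by (rule one_plus_sum_cmod_pos)
  have Rp: "R a (partner a) = (cmod (w (a div 2)))\<^sup>2 * flat_form a (partner a)" for a
    by (auto simp: R_def \<theta>_def flat_form_def cmod_power2 power2_eq_square[of "Re _"] power2_eq_square[of "Im _"] algebra_simps)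
  have e: "eval_form11 N (\<lambda>j k. fubini_study N c j k x) (real_frame a) (real_frame b) =
      1 / (1 + Q) * flat_form a b - 1 / (1 + Q)\<^sup>2 * R a b" if ab: "a < 2 * N" "b < 2 * N" for a b
  proof -
    have "eval_form11 N (\<lambda>j k. fubini_study N c j k x) (real_frame a) (real_frame b) =
      eval_form11 N (\<lambda>j k. of_real (1 / (1 + Q)) * (if j = k then 1 else 0) - of_real (1 / (1 + Q)\<^sup>2) * (cnj (w j) * w k))
        (real_frame a) (real_frame b)"
      unfolding eval_form11_def
      by (intro arg_cong[where f = Re] arg_cong[where f = "\<lambda>x. \<i> * x"] sum.cong refl)
        (simp add: fubini_study_eq w_def Q_def)
    then show ?thesis
      unfolding eval_form11_linear eval_form11_flat[OF ab] eval_form11_rank_one[OF ab] R_def \<theta>_def .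
  qed
  have "(\<Sum>p | p permutes {..<2 * N}. of_int (sign p) * (\<Prod>i<N.
      eval_form11 N (\<lambda>j k. fubini_study N c j k x) (real_frame (p (2 * i))) (real_frame (p (2 * i + 1))))) =
    alternating_sum N (\<lambda>a b. 1 / (1 + Q) * flat_form a b - 1 / (1 + Q)\<^sup>2 * R a b)"
    unfolding alternating_sum_def
  proof (intro sum.cong refl arg_cong2[where f = "(*)"] prod.cong)
    fix p i assume p: "p \<in> {p. p permutes {..<2 * N}}" and i: "i \<in> {..<N}"
    have "p (2 * i) < 2 * N" "p (2 * i + 1) < 2 * N"
      using permutes_in_image[of p "{..<2 * N}" "2 * i"] permutes_in_image[of p "{..<2 * N}" "2 * i + 1"] p i by auto
    then show "eval_form11 N (\<lambda>j k. fubini_study N c j k x) (real_frame (p (2 * i))) (real_frame (p (2 * i + 1))) =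
      1 / (1 + Q) * flat_form (p (2 * i)) (p (Suc (2 * i))) - 1 / (1 + Q)\<^sup>2 * R (p (2 * i)) (p (Suc (2 * i)))"
      using e[of "p (2 * i)" "p (2 * i + 1)"] by simp
  qed
  also have "\<dots> = ((1 / (1 + Q)) ^ N - 1 / (1 + Q)\<^sup>2 * (1 / (1 + Q)) ^ (N - 1) * Q) * alternating_sum N flat_form"
    unfolding Q_def by (rule alternating_sum_rank_one[where \<theta> = "\<lambda>a. Re (\<theta> a)" and \<eta> = "\<lambda>a. Im (\<theta> a)"])
      (rule R_def, rule Rp)
  also have "(1 / (1 + Q)) ^ N - 1 / (1 + Q)\<^sup>2 * (1 / (1 + Q)) ^ (N - 1) * Q = 1 / (1 + Q) ^ Suc N"
  proof (cases N)
    \<comment> \<open>Here \<open>N - 1\<close> is truncated; the identity survives because the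
      empty sum \<open>Q\<close> is 0.\<close>
    case 0
    then show ?thesis by (simp add: Q_def)
  next
    case (Suc m)
    have "(1 / (1 + Q)) ^ Suc m - 1 / (1 + Q)\<^sup>2 * (1 / (1 + Q)) ^ m * Q =
       (1 / (1 + Q)) ^ m * (1 / (1 + Q) - Q / (1 + Q)\<^sup>2)" by (simp add: algebra_simps)
    also have "1 / (1 + Q) - Q / (1 + Q)\<^sup>2 = 1 / (1 + Q)\<^sup>2"
      using Q by (simp add: divide_simps) (simp add: algebra_simps power2_eq_square)
    finally show ?thesis using Suc by (simp add: power_one_over power2_eq_square)
  qed
  finally show ?thesis
    unfolding liouville_density_def wedge_power_def assms fs_constant_def
    by (simp add: Q_def w_def)
qed

section \<open>Lebesgue measure on complex coordinate space\<close>

lemma borel_measurable_Complex [measurable]: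
  "f \<in> borel_measurable M \<Longrightarrow> g \<in> borel_measurable M \<Longrightarrow> (\<lambda>p. Complex (f p) (g p)) \<in> borel_measurable M"
  unfolding borel_measurable_complex_iff by simp

text \<open>Both measures give a box its area, which determines Lebesgue measure. Integrals over the
  complex plane become iterated real integrals in this way.\<close>

lemma lborel_complex_eq:
  "(lborel :: complex measure) = distr (lborel \<Otimes>\<^sub>M lborel) borel (\<lambda>(x, y). Complex x y)"
proof (rule lborel_eqI)
  have m: "(\<lambda>(x, y). Complex x y) \<in> borel_measurable (lborel \<Otimes>\<^sub>M lborel)"
    by (simp add: case_prod_unfold)
  fix l u :: complex assume le: "\<And>b. b \<in> Basis \<Longrightarrow> l \<bullet> b \<le> u \<bullet> b"
  have "Re l \<le> Re u" "Im l \<le> Im u" using le[of 1] le[of \<i>] by (auto simp: Basis_complex_def)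
  moreover have "(\<lambda>(x, y). Complex x y) -` box l u \<inter> space (lborel \<Otimes>\<^sub>M lborel) = {Re l<..<Re u} \<times> {Im l<..<Im u}"
    by (auto simp: box_def Basis_complex_def space_pair_measure)
  ultimately show "emeasure (distr (lborel \<Otimes>\<^sub>M lborel) borel (\<lambda>(x, y). Complex x y)) (box l u)
      = ennreal (\<Prod>b\<in>Basis. (u - l) \<bullet> b)"
    using m by (simp add: emeasure_distr lborel.emeasure_pair_measure_Times Basis_complex_def ennreal_mult)
qed simp

lemma nn_integral_lborel_complex:
  assumes "f \<in> borel_measurable borel"
  shows "(\<integral>\<^sup>+z. f z \<partial>lborel) = (\<integral>\<^sup>+x. \<integral>\<^sup>+y. f (Complex x y) \<partial>lborel \<partial>lborel)"
proof -
  have m: "(\<lambda>(x, y). Complex x y) \<in> borel_measurable (lborel \<Otimes>\<^sub>M lborel)"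
    by (simp add: case_prod_unfold)
  have "(\<lambda>p. f (case p of (x, y) \<Rightarrow> Complex x y)) \<in> borel_measurable (lborel \<Otimes>\<^sub>M lborel)"
    using measurable_compose[OF m assms] .
  then show ?thesis
    by (subst lborel_complex_eq, subst nn_integral_distr[OF m])
      (use assms in \<open>simp_all add: lborel.nn_integral_fst[symmetric]\<close>)
qed

text \<open>Multiplication by c has real determinant |c|^2. If Re c is nonzero, it is split into two
  substitutions in one real variable each, joined by Fubini; a purely imaginary c is a product of
  two numbers with nonzero real part.\<close>

lemma nn_integral_lborel_complex_mult:
  fixes f :: "complex \<Rightarrow> ennreal"
  assumes f: "f \<in> borel_measurable borel" and c: "c \<noteq> 0"
  shows "(\<integral>\<^sup>+z. f z \<partial>lborel) = ennreal ((cmod c)\<^sup>2) * (\<integral>\<^sup>+z. f (c * z) \<partial>lborel)"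
proof -
  have Re: "(\<integral>\<^sup>+z. g z \<partial>lborel) = ennreal ((cmod c)\<^sup>2) * (\<integral>\<^sup>+z. g (c * z) \<partial>lborel)"
    if a: "Re c \<noteq> 0" and g[measurable]: "g \<in> borel_measurable borel" for c and g :: "complex \<Rightarrow> ennreal"
  proof -
    define a b n where "a = Re c" and "b = Im c" and "n = (cmod c)\<^sup>2"
    have a0: "a \<noteq> 0" and n: "n = a\<^sup>2 + b\<^sup>2" "n > 0" 
      using a by (auto simp: a_def b_def n_def cmod_power2 add_pos_nonneg)
    \<comment> \<open>If c = a + i b and c (x + i y) = X + i Y, then Y = b X / a + (n / a) y. First
      Y is replaced by y for fixed X, then X = a x - b y by x for fixed y; the Jacobians |n / a| and
      |a| multiply to n.\<close>
    define G where "G X y = g (Complex X (b * X / a + n / a * y))" for X y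
    have [measurable]: "case_prod G \<in> borel_measurable (lborel \<Otimes>\<^sub>M lborel)"
      unfolding G_def[abs_def] by simp
    have [measurable]: "G X \<in> borel_measurable borel" "(\<lambda>X. G X y) \<in> borel_measurable borel" for X y
      unfolding G_def[abs_def] by simp_all
    have "(\<integral>\<^sup>+z. g z \<partial>lborel) = (\<integral>\<^sup>+X. \<integral>\<^sup>+Y. g (Complex X Y) \<partial>lborel \<partial>lborel)"
      by (rule nn_integral_lborel_complex[OF g])
    also have "\<dots> = (\<integral>\<^sup>+X. ennreal \<bar>n / a\<bar> * (\<integral>\<^sup>+y. G X y \<partial>lborel) \<partial>lborel)"
      unfolding G_def by (intro nn_integral_cong nn_integral_real_affine) (use a0 n in auto)
    also have "\<dots> = ennreal \<bar>n / a\<bar> * (\<integral>\<^sup>+X. \<integral>\<^sup>+y. G X y \<partial>lborel \<partial>lborel)"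
      by (rule nn_integral_cmult) simp
    also have "(\<integral>\<^sup>+X. \<integral>\<^sup>+y. G X y \<partial>lborel \<partial>lborel) = (\<integral>\<^sup>+y. \<integral>\<^sup>+X. G X y \<partial>lborel \<partial>lborel)"
      by (rule lborel_pair.Fubini') simp
    also have "\<dots> = (\<integral>\<^sup>+y. ennreal \<bar>a\<bar> * (\<integral>\<^sup>+x. G (- b * y + a * x) y \<partial>lborel) \<partial>lborel)"
      by (intro nn_integral_cong nn_integral_real_affine) (use a0 in auto)
    also have "\<dots> = ennreal \<bar>a\<bar> * (\<integral>\<^sup>+y. \<integral>\<^sup>+x. G (- b * y + a * x) y \<partial>lborel \<partial>lborel)"
      unfolding G_def by (rule nn_integral_cmult) simp
    also have "(\<integral>\<^sup>+y. \<integral>\<^sup>+x. G (- b * y + a * x) y \<partial>lborel \<partial>lborel) =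
       (\<integral>\<^sup>+y. \<integral>\<^sup>+x. g (c * Complex x y) \<partial>lborel \<partial>lborel)"
    proof -
      have "Complex (- b * y + a * x) (b * (- b * y + a * x) / a + n / a * y) = c * Complex x y" for x y
        using a0 n by (simp add: complex_eq_iff a_def[symmetric] b_def[symmetric] field_simps power2_eq_square)
      then show ?thesis by (simp add: G_def)
    qed
    also have "\<dots> = (\<integral>\<^sup>+x. \<integral>\<^sup>+y. g (c * Complex x y) \<partial>lborel \<partial>lborel)"
      by (rule lborel_pair.Fubini'[symmetric]) simp
    also have "\<dots> = (\<integral>\<^sup>+z. g (c * z) \<partial>lborel)"
      by (rule nn_integral_lborel_complex[symmetric]) simp
    finally show ?thesis
      using a0 n by (simp add: mult.assoc[symmetric] ennreal_mult[symmetric] abs_mult[symmetric] n_def[symmetric])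
  qed
  show ?thesis
  proof (cases "Re c = 0")
    case False
    then show ?thesis by (rule Re[OF _ f])
  next
    case True
    \<comment> \<open>The two factors of c are c (1 + i) and 1 / (1 + i); the contributions |1 +
      i|^2 and |1 + i|^(-2) cancel.\<close>
    have 1: "Re (c * (1 + \<i>)) \<noteq> 0" using True c by (auto simp: complex_eq_iff)
    have 2: "Re (inverse (1 + \<i>)) \<noteq> 0" by simp
    have i: "1 + \<i> \<noteq> 0" by (simp add: complex_eq_iff)
    have [measurable]: "(\<lambda>z. f (c * (1 + \<i>) * z)) \<in> borel_measurable borel"
      by (rule measurable_compose[OF _ f]) simp
    have "(\<integral>\<^sup>+z. f z \<partial>lborel) = ennreal ((cmod (c * (1 + \<i>)))\<^sup>2) * (\<integral>\<^sup>+z. f (c * (1 + \<i>) * z) \<partial>lborel)"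
      by (rule Re[OF 1 f])
    also have "(\<integral>\<^sup>+z. f (c * (1 + \<i>) * z) \<partial>lborel) = ennreal ((cmod (inverse (1 + \<i>)))\<^sup>2) *
       (\<integral>\<^sup>+z. f (c * (1 + \<i>) * (inverse (1 + \<i>) * z)) \<partial>lborel)"
      by (rule Re[OF 2]) simp
    also have "(\<lambda>z. f (c * (1 + \<i>) * (inverse (1 + \<i>) * z))) = (\<lambda>z. f (c * z))"
      using right_inverse[OF i] by (metis mult.assoc mult.right_neutral)
    also have "ennreal ((cmod (c * (1 + \<i>)))\<^sup>2) * (ennreal ((cmod (inverse (1 + \<i>)))\<^sup>2) * (\<integral>\<^sup>+z. f (c * z) \<partial>lborel)) =
      ennreal ((cmod c)\<^sup>2) * (\<integral>\<^sup>+z. f (c * z) \<partial>lborel)"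
    proof -
      have "(cmod (c * (1 + \<i>)))\<^sup>2 * (cmod (inverse (1 + \<i>)))\<^sup>2 = (cmod c)\<^sup>2"
        using i by (simp add: norm_mult norm_inverse power_mult_distrib power_inverse)
      then show ?thesis by (simp add: mult.assoc[symmetric] ennreal_mult[symmetric])
    qed
    finally show ?thesis .
  qed
qed

lemma emeasure_lborel_complex_mult:
  assumes "c \<noteq> (0::complex)" "A \<in> sets borel"
  shows "emeasure lborel A = ennreal ((cmod c)\<^sup>2) * emeasure lborel {z. c * z \<in> A}"
proof -
  have [measurable]: "A \<in> sets borel" by fact
  have "{z. c * z \<in> A} = (\<lambda>z. c * z) -` A \<inter> space borel" by auto
  then have m: "{z. c * z \<in> A} \<in> sets borel"
    using measurable_sets[of "\<lambda>z. c * z" borel borel A] by simp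
  have "emeasure lborel A = (\<integral>\<^sup>+z. indicator A z \<partial>lborel)" by simp
  also have "\<dots> = ennreal ((cmod c)\<^sup>2) * (\<integral>\<^sup>+z. indicator A (c * z) \<partial>lborel)"
    by (rule nn_integral_lborel_complex_mult) (use assms in auto)
  also have "(\<lambda>z. indicator A (c * z) :: ennreal) = indicator {z. c * z \<in> A}"
    by (auto simp: indicator_def)
  finally show ?thesis using m by simp
qed

section \<open>Product Lebesgue measure in cone coordinates\<close>

interpretation product_Cn: product_sigma_finite "\<lambda>_::nat. lborel :: complex measure"
  by standard

interpretation lebesgue_Cn: sigma_finite_measure "lebesgue_Cn n"
  unfolding lebesgue_Cn_def by (rule product_Cn.sigma_finite) simp

lemma space_lebesgue_Cn: "space (lebesgue_Cn n) = (\<Pi>\<^sub>E i\<in>{..<n}. UNIV)"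
  by (simp add: lebesgue_Cn_def space_PiM)

lemma sets_lebesgue_Cn: "sets (lebesgue_Cn n) = sets (\<Pi>\<^sub>M i\<in>{..<n}. borel)"
  unfolding lebesgue_Cn_def by (rule sets_PiM_cong) auto

lemma measurable_lebesgue_CnI:
  assumes "\<And>i. i < n \<Longrightarrow> (\<lambda>x. f x i) \<in> borel_measurable M"
    and "\<And>x. x \<in> space M \<Longrightarrow> f x \<in> extensional {..<n}"
  shows "f \<in> measurable M (lebesgue_Cn n)"
proof -
  have "(\<lambda>x i. f x i) \<in> measurable M (\<Pi>\<^sub>M i\<in>{..<n}. borel)"
    by (rule measurable_PiM_single') (use assms in \<open>auto simp: PiE_def\<close>)
  then show ?thesis by (simp cong: measurable_cong_sets add: sets_lebesgue_Cn)
qed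

lemma measurable_lebesgue_Cn_component:
  "i < n \<Longrightarrow> (\<lambda>z. z i) \<in> borel_measurable (lebesgue_Cn n)"
  by (simp cong: measurable_cong_sets add: sets_lebesgue_Cn)

definition skip :: "nat \<Rightarrow> nat \<Rightarrow> nat" where
  "skip k i = (if i < k then i else Suc i)"

text \<open>For \<open>u = 1\<close> this is the homogeneous vector whose coordinates in the affine
  chart \<open>k\<close> are \<open>w\<close>; \<open>skip k\<close> numbers the remaining indices
  as \<open>affine_chart\<close> does.\<close>

definition insert_coord :: "nat \<Rightarrow> nat \<Rightarrow> complex \<Rightarrow> (nat \<Rightarrow> complex) \<Rightarrow> nat \<Rightarrow> complex" where
  "insert_coord N k u w = (\<lambda>j\<in>{..N}. if j < k then w j else if j = k then u else w (j - 1))"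

lemma insert_coord_skip [simp]: "i < N \<Longrightarrow> insert_coord N k u w (skip k i) = w i"
  by (auto simp: insert_coord_def skip_def)

lemma insert_coord_same [simp]: "k \<le> N \<Longrightarrow> insert_coord N k u w k = u"
  by (auto simp: insert_coord_def)

lemma insert_coord_extensional [simp]: "insert_coord N k u w \<in> extensional {..N}"
  by (simp add: insert_coord_def)

lemma bij_betw_skip: "k \<le> N \<Longrightarrow> bij_betw (skip k) {..<N} ({..N} - {k})"
  by (rule bij_betw_byWitness[where f' = "\<lambda>j. if j < k then j else j - 1"]) (auto simp: skip_def)

lemma atMost_eq_insert_skip: "k \<le> N \<Longrightarrow> {..N} = insert k (skip k ` {..<N})"
  using bij_betw_skip[of k N] by (auto simp: bij_betw_def)

lemma prod_insert_skip:
  fixes f :: "nat \<Rightarrow> 'b::comm_monoid_mult"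
  assumes "k \<le> N" shows "(\<Prod>j\<le>N. f j) = f k * (\<Prod>i<N. f (skip k i))"
  using prod.remove[of "{..N}" k f] prod.reindex_bij_betw[OF bij_betw_skip[OF assms], of f] assms by simp

lemma sum_insert_skip:
  fixes f :: "nat \<Rightarrow> 'b::comm_monoid_add"
  assumes "k \<le> N" shows "(\<Sum>j\<le>N. f j) = f k + (\<Sum>i<N. f (skip k i))"
  using sum.remove[of "{..N}" k f] sum.reindex_bij_betw[OF bij_betw_skip[OF assms], of f] assms by simp

lemma measurable_insert_coord:
  assumes "k \<le> N"
  shows "(\<lambda>(u, w). insert_coord N k u w) \<in> measurable (lborel \<Otimes>\<^sub>M lebesgue_Cn N) (lebesgue_Cn (Suc N))"
proof (rule measurable_lebesgue_CnI)
  fix j assume "j < Suc N"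
  then consider "j < k" "j < N" | "j = k" | "j > k" "j - 1 < N" "j \<le> N" using assms by linarith
  then show "(\<lambda>x. (case x of (u, w) \<Rightarrow> insert_coord N k u w) j) \<in> borel_measurable (lborel \<Otimes>\<^sub>M lebesgue_Cn N)"
    by cases (use assms in \<open>auto simp: insert_coord_def case_prod_unfold
      intro!: measurable_compose[OF measurable_snd measurable_lebesgue_Cn_component]\<close>)
qed (auto simp: lessThan_Suc_atMost)

text \<open>Boxes determine the product measure, and the preimage of a box is a box. Coordinate
  \<open>k\<close> is split off so that it can serve as the scale of the cone over the affine chart
  \<open>k\<close>.\<close>

lemma lebesgue_Cn_Suc_eq:
  assumes k: "k \<le> N"
  shows "lebesgue_Cn (Suc N) = distr (lborel \<Otimes>\<^sub>M lebesgue_Cn N) (lebesgue_Cn (Suc N)) (\<lambda>(u, w). insert_coord N k u w)"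
  unfolding lebesgue_Cn_def[of "Suc N"]
proof (rule product_Cn.PiM_eqI[symmetric])
  fix A :: "nat \<Rightarrow> complex set" assume A: "\<And>i. i \<in> {..<Suc N} \<Longrightarrow> A i \<in> sets lborel"
  have sk: "skip k i < Suc N" if "i < N" for i using that by (simp add: skip_def)
  have "(\<lambda>(u, w). insert_coord N k u w) -` Pi\<^sub>E {..<Suc N} A \<inter> space (lborel \<Otimes>\<^sub>M lebesgue_Cn N) =
     A k \<times> Pi\<^sub>E {..<N} (\<lambda>i. A (skip k i))" (is "?l = ?r")
  proof (rule set_eqI, clarify)
    fix u w
    have "(u, w) \<in> ?l \<longleftrightarrow> (\<forall>j\<in>{..N}. insert_coord N k u w j \<in> A j) \<and> w \<in> extensional {..<N}"
      by (auto simp: space_pair_measure space_lebesgue_Cn PiE_def Pi_def lessThan_Suc_atMost[symmetric] insert_coord_def)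
    also have "(\<forall>j\<in>{..N}. insert_coord N k u w j \<in> A j) \<longleftrightarrow> u \<in> A k \<and> (\<forall>i\<in>{..<N}. w i \<in> A (skip k i))"
      unfolding atMost_eq_insert_skip[OF k] using k by auto
    finally show "(u, w) \<in> ?l \<longleftrightarrow> (u, w) \<in> ?r" by (auto simp: PiE_def Pi_def)
  qed
  moreover have "Pi\<^sub>E {..<N} (\<lambda>i. A (skip k i)) \<in> sets (lebesgue_Cn N)"
    unfolding lebesgue_Cn_def by (rule sets_PiM_I_finite) (use A sk in auto)
  moreover have "Pi\<^sub>E {..<Suc N} A \<in> sets (lebesgue_Cn (Suc N))"
    unfolding lebesgue_Cn_def by (rule sets_PiM_I_finite) (use A in auto)
  ultimately have "emeasure (distr (lborel \<Otimes>\<^sub>M lebesgue_Cn N) (lebesgue_Cn (Suc N)) (\<lambda>(u, w). insert_coord N k u w)) (Pi\<^sub>E {..<Suc N} A)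
    = emeasure lborel (A k) * emeasure (lebesgue_Cn N) (Pi\<^sub>E {..<N} (\<lambda>i. A (skip k i)))"
    using A k by (subst emeasure_distr[OF measurable_insert_coord[OF k]]) (auto simp: lebesgue_Cn.emeasure_pair_measure_Times)
  also have "emeasure (lebesgue_Cn N) (Pi\<^sub>E {..<N} (\<lambda>i. A (skip k i))) = (\<Prod>i<N. emeasure lborel (A (skip k i)))"
    unfolding lebesgue_Cn_def by (rule product_Cn.emeasure_PiM) (use A sk in auto)
  also have "emeasure lborel (A k) * \<dots> = (\<Prod>j<Suc N. emeasure lborel (A j))"
    unfolding lessThan_Suc_atMost by (rule prod_insert_skip[OF k, symmetric])
  finally show "emeasure (distr (lborel \<Otimes>\<^sub>M lebesgue_Cn N) (\<Pi>\<^sub>M i\<in>{..<Suc N}. lborel) (\<lambda>(u, w). insert_coord N k u w)) (Pi\<^sub>E {..<Suc N} A)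
    = (\<Prod>i<Suc N. emeasure lborel (A i))" by (simp add: lebesgue_Cn_def)
qed auto

lemma measurable_scale_Cn:
  "(\<lambda>w. \<lambda>i\<in>{..<n}. u * w i) \<in> measurable (lebesgue_Cn n) (lebesgue_Cn n)"
  by (rule measurable_lebesgue_CnI) (auto intro!: borel_measurable_times measurable_lebesgue_Cn_component)

text \<open>Each of the n complex coordinates contributes one factor |u|^2 from
  \<open>emeasure_lborel_complex_mult\<close>.\<close>

lemma lebesgue_Cn_scale:
  assumes u: "u \<noteq> 0"
  shows "lebesgue_Cn n = density (distr (lebesgue_Cn n) (lebesgue_Cn n) (\<lambda>w. \<lambda>i\<in>{..<n}. u * w i)) (\<lambda>_. ennreal ((cmod u) ^ (2 * n)))"
    (is "_ = density ?D _")
  unfolding lebesgue_Cn_def[of n]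
proof (rule product_Cn.PiM_eqI[symmetric], goal_cases)
  case (3 A)
  have A: "Pi\<^sub>E {..<n} A \<in> sets (lebesgue_Cn n)"
    unfolding lebesgue_Cn_def by (rule sets_PiM_I_finite) (use 3 in auto)
  have A': "{z. u * z \<in> A i} \<in> sets lborel" if "i < n" for i
  proof -
    have "{z. u * z \<in> A i} = (\<lambda>z. u * z) -` A i \<inter> space borel" by auto
    also have "\<dots> \<in> sets borel" using 3[of i] that by (intro measurable_sets[of _ borel borel]) auto
    finally show ?thesis by simp
  qed
  have "emeasure (density ?D (\<lambda>_. ennreal ((cmod u) ^ (2 * n)))) (Pi\<^sub>E {..<n} A) =
    ennreal ((cmod u) ^ (2 * n)) * emeasure ?D (Pi\<^sub>E {..<n} A)"
    using A by (simp add: emeasure_density nn_integral_cmult_indicator)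
  also have "emeasure ?D (Pi\<^sub>E {..<n} A) = emeasure (lebesgue_Cn n) (Pi\<^sub>E {..<n} (\<lambda>i. {z. u * z \<in> A i}))"
  proof (subst emeasure_distr[OF measurable_scale_Cn A], rule arg_cong[where f = "emeasure _"])
    show "(\<lambda>w. \<lambda>i\<in>{..<n}. u * w i) -` Pi\<^sub>E {..<n} A \<inter> space (lebesgue_Cn n) = Pi\<^sub>E {..<n} (\<lambda>i. {z. u * z \<in> A i})"
      by (auto simp: space_lebesgue_Cn PiE_def Pi_def)
  qed
  also have "\<dots> = (\<Prod>i<n. emeasure lborel {z. u * z \<in> A i})"
    unfolding lebesgue_Cn_def by (rule product_Cn.emeasure_PiM) (use A' in auto)
  also have "ennreal ((cmod u) ^ (2 * n)) * (\<Prod>i<n. emeasure lborel {z. u * z \<in> A i}) =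
     (\<Prod>i<n. ennreal ((cmod u)\<^sup>2) * emeasure lborel {z. u * z \<in> A i})"
    by (simp add: power_mult ennreal_power prod.distrib)
  also have "\<dots> = (\<Prod>i<n. emeasure lborel (A i))"
    by (intro prod.cong refl emeasure_lborel_complex_mult[OF u, symmetric]) (use 3 in auto)
  finally show ?case unfolding lebesgue_Cn_def .
qed (auto simp: lebesgue_Cn_def)

lemma insert_coord_eq_hscale:
  "k \<le> N \<Longrightarrow> insert_coord N k u (\<lambda>i\<in>{..<N}. u * w i) = hscale N u (insert_coord N k 1 w)"
  by (auto simp: insert_coord_def hscale_def fun_eq_iff)

text \<open>The substitution $z = u\cdot(w_0,\dots,1,\dots,w_{N-1})$, with Jacobian $|u|^{2N}$.\<close>

lemma nn_integral_lebesgue_Cn_cone: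
  assumes k: "k \<le> N" and f: "f \<in> borel_measurable (lebesgue_Cn (Suc N))"
  shows "(\<integral>\<^sup>+z. f z \<partial>lebesgue_Cn (Suc N)) =
    (\<integral>\<^sup>+u. \<integral>\<^sup>+w. ennreal ((cmod u) ^ (2 * N)) * f (hscale N u (insert_coord N k 1 w)) \<partial>lebesgue_Cn N \<partial>lborel)"
proof -
  have fm: "(\<lambda>p. f (case p of (u, w) \<Rightarrow> insert_coord N k u w)) \<in> borel_measurable (lborel \<Otimes>\<^sub>M lebesgue_Cn N)"
    by (rule measurable_compose[OF measurable_insert_coord[OF k] f])
  have "(\<integral>\<^sup>+z. f z \<partial>lebesgue_Cn (Suc N)) = (\<integral>\<^sup>+u. \<integral>\<^sup>+w. f (insert_coord N k u w) \<partial>lebesgue_Cn N \<partial>lborel)"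
    by (subst lebesgue_Cn_Suc_eq[OF k], subst nn_integral_distr[OF measurable_insert_coord[OF k]])
      (use f lebesgue_Cn.nn_integral_fst[OF fm] in simp_all)
  also have "\<dots> = (\<integral>\<^sup>+u. \<integral>\<^sup>+w. ennreal ((cmod u) ^ (2 * N)) * f (hscale N u (insert_coord N k 1 w)) \<partial>lebesgue_Cn N \<partial>lborel)"
  proof (rule nn_integral_cong_AE)
    \<comment> \<open>For u = 0 the scaling of the remaining coordinates is not invertible, but a
      single point is a null set.\<close>
    have "AE u in lborel. u \<noteq> (0::complex)" by (rule AE_lborel_singleton)
    then show "AE u in lborel. (\<integral>\<^sup>+w. f (insert_coord N k u w) \<partial>lebesgue_Cn N) =
      (\<integral>\<^sup>+w. ennreal ((cmod u) ^ (2 * N)) * f (hscale N u (insert_coord N k 1 w)) \<partial>lebesgue_Cn N)"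
    proof eventually_elim
      case (elim u)
      have m: "(\<lambda>w. f (insert_coord N k u w)) \<in> borel_measurable (lebesgue_Cn N)"
        using measurable_compose[OF measurable_Pair1'[of u lborel "lebesgue_Cn N"] fm] by simp
      have "(\<integral>\<^sup>+w. f (insert_coord N k u w) \<partial>lebesgue_Cn N) =
        (\<integral>\<^sup>+w. ennreal ((cmod u) ^ (2 * N)) * f (insert_coord N k u (\<lambda>i\<in>{..<N}. u * w i)) \<partial>lebesgue_Cn N)"
        by (subst lebesgue_Cn_scale[OF elim], subst nn_integral_density)
          (use m measurable_compose[OF measurable_scale_Cn m] in \<open>simp_all add: nn_integral_distr measurable_scale_Cn nn_integral_cmult\<close>)
      then show ?case using k by (simp add: insert_coord_eq_hscale)
    qed
  qed
  finally show ?thesis .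
qed

text \<open>In polar coordinates this is pi / (N + 1). What enters later is that it is finite and
  positive.\<close>

definition radial_constant :: "nat \<Rightarrow> ennreal" where
  "radial_constant N = (\<integral>\<^sup>+u. ennreal ((cmod u) ^ (2 * N)) * indicator (ball 0 1) u \<partial>lborel)"

lemma radial_measurable:
  "(\<lambda>u. ennreal ((cmod u) ^ (2 * N)) * indicator (ball 0 r) u) \<in> borel_measurable borel"
  by (intro borel_measurable_times_ennreal borel_measurable_indicator) auto

text \<open>The substitution u = r u' contributes r^2 by its Jacobian and r^(2N) by the integrand.
  With r^2 = 1 / (1 + |w|^2) the total exponent reproduces the Fubini-Study density.\<close>

lemma radial_integral:
  assumes r: "r > 0"
  shows "(\<integral>\<^sup>+u. ennreal ((cmod u) ^ (2 * N)) * indicator (ball 0 r) u \<partial>lborel) = ennreal (r ^ (2 * Suc N)) * radial_constant N"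
proof -
  have "(\<integral>\<^sup>+u. ennreal ((cmod u) ^ (2 * N)) * indicator (ball 0 r) u \<partial>lborel) =
    ennreal ((cmod (of_real r))\<^sup>2) *
    (\<integral>\<^sup>+u. ennreal ((cmod (of_real r * u)) ^ (2 * N)) * indicator (ball 0 r) (of_real r * u) \<partial>lborel)"
    by (rule nn_integral_lborel_complex_mult) (use r radial_measurable in auto)
  also have "(\<integral>\<^sup>+u. ennreal ((cmod (of_real r * u)) ^ (2 * N)) * indicator (ball 0 r) (of_real r * u) \<partial>lborel) =
    (\<integral>\<^sup>+u. ennreal (r ^ (2 * N)) * (ennreal ((cmod u) ^ (2 * N)) * indicator (ball 0 1) u) \<partial>lborel)"
    using r by (intro nn_integral_cong)
      (auto simp: indicator_def norm_mult power_mult_distrib ennreal_mult mult.commute)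
  also have "\<dots> = ennreal (r ^ (2 * N)) * radial_constant N"
    unfolding radial_constant_def by (rule nn_integral_cmult) (use radial_measurable in auto)
  finally show ?thesis using r
    by (simp add: mult.assoc[symmetric] ennreal_mult[symmetric] power2_eq_square)
qed

lemma radial_constant_finite: "radial_constant N < \<infinity>"
proof -
  have "radial_constant N \<le> (\<integral>\<^sup>+u. indicator (ball 0 1) (u::complex) \<partial>lborel)"
    unfolding radial_constant_def
    by (intro nn_integral_mono) (auto simp: indicator_def power_le_one)
  also have "\<dots> < \<infinity>" using emeasure_bounded_finite[of "ball (0::complex) 1"] by simp
  finally show ?thesis .
qed

lemma radial_constant_pos: "radial_constant N > 0"
proof (rule ccontr)
  assume "\<not> radial_constant N > 0"
  then have "AE u in lborel. ennreal ((cmod u) ^ (2 * N)) * indicator (ball 0 1) u = 0"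
    unfolding radial_constant_def by (subst (asm) not_gr_zero, subst (asm) nn_integral_0_iff_AE)
      (use radial_measurable in auto)
  moreover have "AE u in lborel. u \<noteq> (0::complex)" by (rule AE_lborel_singleton)
  ultimately have "AE u in lborel. u \<notin> ball (0::complex) 1"
    by eventually_elim (auto simp: indicator_def)
  then have "emeasure lborel (ball (0::complex) 1) = 0"
    by (subst AE_iff_measurable[symmetric, of _ _ "\<lambda>u. u \<notin> ball 0 1"]) auto
  then show False
    using open_not_negligible[of "ball (0::complex) 1"]
    by (simp add: negligible_iff_null_sets null_sets_completionI null_setsI)
qed

section \<open>The topology and the affine charts of projective space\<close>

lemma continuous_map_mult_normed:
  fixes f g :: "'a \<Rightarrow> 'b::real_normed_algebra"
  assumes "continuous_map X euclidean f" "continuous_map X euclidean g"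
  shows "continuous_map X euclidean (\<lambda>x. f x * g x)"
  using assms by (simp add: continuous_map_atin tendsto_mult)

lemma continuous_map_divide_normed:
  fixes f g :: "'a \<Rightarrow> 'b::real_normed_field"
  assumes "continuous_map X euclidean f" "continuous_map X euclidean g"
    and "\<And>x. x \<in> topspace X \<Longrightarrow> g x \<noteq> 0"
  shows "continuous_map X euclidean (\<lambda>x. f x / g x)"
  using assms by (simp add: continuous_map_atin tendsto_divide)

lemma continuous_map_cnj:
  assumes "continuous_map X euclidean f"
  shows "continuous_map X euclidean (\<lambda>x. cnj (f x))"
  using assms by (simp add: continuous_map_atin tendsto_cnj)

lemma topspace_Cn [simp]: "topspace (Cn n) = extensional {..<n}"
  by (simp add: Cn_def PiE_def)

lemma continuous_map_Cn_component:
  "i < n \<Longrightarrow> continuous_map (Cn n) euclidean (\<lambda>z. z i)"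
  unfolding Cn_def by (rule continuous_map_product_projection) simp

lemma continuous_map_into_Cn:
  assumes "\<And>i. i < n \<Longrightarrow> continuous_map X euclidean (\<lambda>x. f x i)"
    and "\<And>x. x \<in> topspace X \<Longrightarrow> f x \<in> extensional {..<n}"
  shows "continuous_map X (Cn n) f"
  using assms by (auto simp: Cn_def continuous_map_componentwise)

text \<open>Restriction to \<open>{..<n}\<close> exhibits \<open>U\<close> as the trace of an open
  set in the space of all functions on the naturals; there open sets are measurable for the product,
  because the index type is countable.\<close>

lemma openin_Cn_imp_sets:
  assumes "openin (Cn n) U"
  shows "U \<in> sets (lebesgue_Cn n)"
proof -
  define r :: "(nat \<Rightarrow> complex) \<Rightarrow> nat \<Rightarrow> complex" where "r = (\<lambda>f. restrict f {..<n})"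
  have "continuous_map euclidean (Cn n) r"
  proof (rule continuous_map_into_Cn)
    fix i assume "i < n"
    then show "continuous_map euclidean euclidean (\<lambda>f. r f i)"
      by (simp add: r_def continuous_on_product_coordinates)
  qed (auto simp: r_def)
  then have "openin euclidean {f \<in> topspace euclidean. r f \<in> U}"
    using assms by (rule openin_continuous_map_preimage)
  then have "open {f. r f \<in> U}" by simp
  then have b: "{f. r f \<in> U} \<in> sets borel" by simp
  have "(\<lambda>f. f) \<in> measurable (lebesgue_Cn n) (Pi\<^sub>M UNIV (\<lambda>_. borel))"
  proof (rule measurable_PiM_single')
    fix i :: nat
    show "(\<lambda>f. f i) \<in> borel_measurable (lebesgue_Cn n)"
    proof (cases "i < n")
      case False
      then show ?thesis
        by (subst measurable_cong[where g = "\<lambda>_. undefined"])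
          (auto simp: space_lebesgue_Cn PiE_def extensional_def)
    qed (rule measurable_lebesgue_Cn_component)
  qed simp
  then have "(\<lambda>f. f) \<in> measurable (lebesgue_Cn n) borel"
    by (simp cong: measurable_cong_sets add: sets_PiM_equal_borel)
  from measurable_sets[OF this b]
  have "{f. r f \<in> U} \<inter> space (lebesgue_Cn n) \<in> sets (lebesgue_Cn n)" by simp
  also have "{f. r f \<in> U} \<inter> space (lebesgue_Cn n) = U"
    using openin_subset[OF assms]
    by (auto simp: r_def space_lebesgue_Cn PiE_def extensional_restrict)
  finally show ?thesis .
qed

lemma measurable_from_Cn_sigma:
  assumes "continuous_map (Cn n) X f"
  shows "f \<in> measurable (lebesgue_Cn n) (sigma (topspace X) {U. openin X U})"
proof (rule measurable_measure_of)
  show "{U. openin X U} \<subseteq> Pow (topspace X)" by (auto dest: openin_subset)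
  show "f \<in> space (lebesgue_Cn n) \<rightarrow> topspace X"
    using continuous_map_image_subset_topspace[OF assms] by (auto simp: space_lebesgue_Cn PiE_def)
  fix U assume "U \<in> {U. openin X U}"
  then have "openin (Cn n) {z \<in> topspace (Cn n). f z \<in> U}"
    using openin_continuous_map_preimage[OF assms] by auto
  also have "{z \<in> topspace (Cn n). f z \<in> U} = f -` U \<inter> space (lebesgue_Cn n)"
    by (auto simp: space_lebesgue_Cn PiE_def)
  finally show "f -` U \<inter> space (lebesgue_Cn n) \<in> sets (lebesgue_Cn n)"
    by (rule openin_Cn_imp_sets)
qed

section \<open>Homogeneous vectors and the lines they span\<close>

lemma hvectorsD: "z \<in> hvectors N \<Longrightarrow> z \<in> extensional {..N}"
  by (simp add: hvectors_def)

lemma hscale_apply [simp]: "i \<le> N \<Longrightarrow> hscale N a z i = a * z i"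
  by (simp add: hscale_def)

lemma hscale_extensional [simp]: "hscale N a z \<in> extensional {..N}"
  by (simp add: hscale_def)

lemma hscale_1: "z \<in> extensional {..N} \<Longrightarrow> hscale N 1 z = z"
  by (auto simp: hscale_def extensional_def)

lemma hscale_hscale [simp]: "hscale N a (hscale N b z) = hscale N (a * b) z"
  by (auto simp: hscale_def fun_eq_iff)

lemma hscale_in_hvectors [simp]: "z \<in> hvectors N \<Longrightarrow> hscale N a z \<in> hvectors N \<longleftrightarrow> a \<noteq> 0"
  by (auto simp: hvectors_def)

lemma mem_line_self: "z \<in> extensional {..N} \<Longrightarrow> z \<in> line N z"
  unfolding line_def by (metis hscale_1 rangeI)

lemma line_hscale:
  assumes u: "u \<noteq> 0" shows "line N (hscale N u z) = line N z"
  unfolding line_def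
proof (intro equalityI image_subsetI)
  fix a
  show "hscale N a (hscale N u z) \<in> range (\<lambda>a. hscale N a z)" by simp
  have "hscale N a z = hscale N (a / u) (hscale N u z)" using u by simp
  then show "hscale N a z \<in> range (\<lambda>a. hscale N a (hscale N u z))" by blast
qed

lemma line_eq_iff:
  assumes "z \<in> hvectors N" "w \<in> hvectors N"
  shows "line N z = line N w \<longleftrightarrow> (\<exists>u. u \<noteq> 0 \<and> w = hscale N u z)"
proof
  assume "line N z = line N w"
  then have "w \<in> line N z" using mem_line_self[OF hvectorsD[OF assms(2)]] by simp
  then obtain u where "w = hscale N u z" by (auto simp: line_def)
  then show "\<exists>u. u \<noteq> 0 \<and> w = hscale N u z" using assms by auto
qed (auto simp: line_hscale)

lemma insert_coord_1_hvectors [simp]: "k \<le> N \<Longrightarrow> insert_coord N k 1 w \<in> hvectors N"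
  unfolding hvectors_def by (auto intro!: exI[of _ k])

lemma eq_hscale_insert_coord:
  assumes "k \<le> N" "z \<in> extensional {..N}" "z k \<noteq> 0"
  shows "hscale N (z k) (insert_coord N k 1 (\<lambda>i\<in>{..<N}. z (skip k i) / z k)) = z"
  using assms by (auto simp: insert_coord_def hscale_def fun_eq_iff skip_def extensional_def)

lemma openin_hvectors_cond:
  assumes "openin (Cn (Suc N)) {z \<in> extensional {..N}. P z}"
  shows "openin (Cn (Suc N)) {z \<in> hvectors N. P z}"
proof -
  have "openin (Cn (Suc N)) {z \<in> topspace (Cn (Suc N)). z i \<in> - {0}}" if "i \<le> N" for i
    by (rule openin_continuous_map_preimage[OF continuous_map_Cn_component]) (use that in auto)
  then have "openin (Cn (Suc N)) (\<Union>i\<le>N. {z \<in> topspace (Cn (Suc N)). z i \<in> - {0}})"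
    by blast
  also have "(\<Union>i\<le>N. {z \<in> topspace (Cn (Suc N)). z i \<in> - {0}}) = hvectors N"
    by (auto simp: hvectors_def lessThan_Suc_atMost)
  finally have "openin (Cn (Suc N)) (hvectors N \<inter> {z \<in> extensional {..N}. P z})"
    using assms by (rule openin_Int)
  also have "hvectors N \<inter> {z \<in> extensional {..N}. P z} = {z \<in> hvectors N. P z}"
    by (auto simp: hvectors_def)
  finally show ?thesis .
qed

lemma openin_hvectors: "openin (Cn (Suc N)) (hvectors N)"
  using openin_hvectors_cond[of N "\<lambda>_. True"] openin_topspace[of "Cn (Suc N)"]
  by (simp add: lessThan_Suc_atMost)

text \<open>\<open>projective_topology\<close> applies the constructor \<open>topology\<close> to a
  predicate, which is informative only once that predicate is known to be closed under finite
  intersections and arbitrary unions.\<close>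

lemma openin_projective_topology:
  "openin (projective_topology N) U \<longleftrightarrow>
     U \<subseteq> line N ` hvectors N \<and> openin (Cn (Suc N)) {z \<in> hvectors N. line N z \<in> U}"
proof -
  have "istopology (\<lambda>U. U \<subseteq> line N ` hvectors N \<and> openin (Cn (Suc N)) {z \<in> hvectors N. line N z \<in> U})"
    unfolding istopology_def
  proof (intro conjI allI impI; (elim conjE)?)
    fix S T assume "openin (Cn (Suc N)) {z \<in> hvectors N. line N z \<in> S}"
      "openin (Cn (Suc N)) {z \<in> hvectors N. line N z \<in> T}"
    then have "openin (Cn (Suc N)) ({z \<in> hvectors N. line N z \<in> S} \<inter> {z \<in> hvectors N. line N z \<in> T})"
      by (rule openin_Int)
    also have "{z \<in> hvectors N. line N z \<in> S} \<inter> {z \<in> hvectors N. line N z \<in> T} = {z \<in> hvectors N. line N z \<in> S \<inter> T}"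
      by auto
    finally show "openin (Cn (Suc N)) {z \<in> hvectors N. line N z \<in> S \<inter> T}" .
  next
    fix \<K> assume "\<forall>S\<in>\<K>. S \<subseteq> line N ` hvectors N \<and> openin (Cn (Suc N)) {z \<in> hvectors N. line N z \<in> S}"
    then have "openin (Cn (Suc N)) (\<Union>S\<in>\<K>. {z \<in> hvectors N. line N z \<in> S})" by blast
    also have "(\<Union>S\<in>\<K>. {z \<in> hvectors N. line N z \<in> S}) = {z \<in> hvectors N. line N z \<in> \<Union>\<K>}" by auto
    finally show "openin (Cn (Suc N)) {z \<in> hvectors N. line N z \<in> \<Union>\<K>}" .
  qed auto
  then show ?thesis unfolding projective_topology_def by (simp add: topology_inverse')
qed

lemma topspace_projective_topology [simp]:
  "topspace (projective_topology N) = line N ` hvectors N"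
proof (rule antisym)
  show "topspace (projective_topology N) \<subseteq> line N ` hvectors N"
    using openin_topspace[of "projective_topology N"] unfolding openin_projective_topology by blast
  have "{z \<in> hvectors N. line N z \<in> line N ` hvectors N} = hvectors N" by auto
  then have "openin (projective_topology N) (line N ` hvectors N)"
    by (simp add: openin_projective_topology openin_hvectors)
  then show "line N ` hvectors N \<subseteq> topspace (projective_topology N)" by (rule openin_subset)
qed

lemma mpoints_projective_space [simp]: "mpoints (projective_space N) = line N ` hvectors N"
  by (simp add: projective_space_def)

lemma projective_space_sel [simp]:
  "mtop (projective_space N) = projective_topology N"
  "mdim (projective_space N) = N"
  "atlas (projective_space N) = affine_chart N ` {..N}"
  by (simp_all add: projective_space_def)

lemma continuous_map_line:
  "continuous_map (subtopology (Cn (Suc N)) (hvectors N)) (projective_topology N) (line N)"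
  unfolding continuous_map_def
proof (intro conjI allI impI)
  fix U assume "openin (projective_topology N) U"
  then have "openin (Cn (Suc N)) {z \<in> hvectors N. line N z \<in> U}"
    by (simp add: openin_projective_topology)
  moreover have "{z \<in> topspace (subtopology (Cn (Suc N)) (hvectors N)). line N z \<in> U} = {z \<in> hvectors N. line N z \<in> U}"
    by (auto simp: hvectors_def lessThan_Suc_atMost)
  ultimately show "openin (subtopology (Cn (Suc N)) (hvectors N)) {z \<in> topspace (subtopology (Cn (Suc N)) (hvectors N)). line N z \<in> U}"
    using openin_subset_topspace_eq openin_open_subtopology[OF openin_hvectors] by auto
qed auto

text \<open>The inverse of the affine chart \<open>k\<close> by a formula, continuous by
  construction, whereas \<open>chart_inv\<close> merely chooses preimages;
  \<open>chart_inv_affine_chart\<close> identifies the two.\<close>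

definition affine_point :: "nat \<Rightarrow> nat \<Rightarrow> (nat \<Rightarrow> complex) \<Rightarrow> (nat \<Rightarrow> complex) set" where
  "affine_point N k w = line N (insert_coord N k 1 w)"

lemma continuous_map_insert_coord:
  assumes "k \<le> N"
  shows "continuous_map (Cn N) (subtopology (Cn (Suc N)) (hvectors N)) (insert_coord N k 1)"
  unfolding continuous_map_in_subtopology
proof
  show "continuous_map (Cn N) (Cn (Suc N)) (insert_coord N k 1)"
  proof (rule continuous_map_into_Cn)
    fix i assume i: "i < Suc N"
    consider "i < k" "i < N" | "i = k" | "i > k" "i - 1 < N" using i assms by linarith
    then show "continuous_map (Cn N) euclidean (\<lambda>x. insert_coord N k 1 x i)"
      by cases (use i in \<open>auto simp: insert_coord_def intro: continuous_map_Cn_component\<close>)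
  qed (auto simp: lessThan_Suc_atMost)
qed (use assms in auto)

lemma continuous_map_affine_point:
  assumes "k \<le> N"
  shows "continuous_map (Cn N) (projective_topology N) (affine_point N k)"
  using continuous_map_compose[OF continuous_map_insert_coord[OF assms] continuous_map_line]
  by (simp add: o_def affine_point_def[abs_def])

lemma affine_rep_line:
  assumes "z \<in> hvectors N" "k \<le> N" "z k \<noteq> 0"
  shows "affine_rep k (line N z) = hscale N (1 / z k) z"
  unfolding affine_rep_def
proof (rule the_equality)
  show "hscale N (1 / z k) z \<in> line N z \<and> hscale N (1 / z k) z k = 1"
    using assms by (simp add: line_def)
  fix w assume "w \<in> line N z \<and> w k = 1"
  then obtain a where "w = hscale N a z" "a * z k = 1" using assms by (auto simp: line_def)
  then show "w = hscale N (1 / z k) z" using assms by (metis nonzero_eq_divide_eq)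
qed

lemma line_mem_affine_domain:
  assumes "z \<in> hvectors N" "k \<le> N"
  shows "line N z \<in> affine_domain N k \<longleftrightarrow> z k \<noteq> 0"
proof
  assume "line N z \<in> affine_domain N k"
  then obtain w where w: "w \<in> hvectors N" "w k \<noteq> 0" "line N w = line N z" by (auto simp: affine_domain_def)
  then obtain u where "u \<noteq> 0" "z = hscale N u w" using line_eq_iff[OF w(1) assms(1)] by auto
  then show "z k \<noteq> 0" using w assms by auto
qed (use assms in \<open>auto simp: affine_domain_def\<close>)

lemma affine_domain_subset: "affine_domain N k \<subseteq> line N ` hvectors N"
  by (auto simp: affine_domain_def)

lemma openin_affine_domain:
  assumes "k \<le> N" shows "openin (projective_topology N) (affine_domain N k)"
proof -
  have "openin (Cn (Suc N)) {z \<in> topspace (Cn (Suc N)). z k \<in> - {0}}"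
    by (rule openin_continuous_map_preimage[OF continuous_map_Cn_component]) (use assms in auto)
  then have "openin (Cn (Suc N)) {z \<in> hvectors N. z k \<in> - {0}}"
    by (intro openin_hvectors_cond) (simp add: lessThan_Suc_atMost)
  also have "{z \<in> hvectors N. z k \<in> - {0}} = {z \<in> hvectors N. line N z \<in> affine_domain N k}"
    using line_mem_affine_domain[OF _ assms] by auto
  finally show ?thesis using affine_domain_subset by (simp add: openin_projective_topology)
qed

lemma fst_affine_chart [simp]: "fst (affine_chart N k) = affine_domain N k"
  by (simp add: affine_chart_def)

lemma affine_chart_line:
  assumes "z \<in> hvectors N" "k \<le> N" "z k \<noteq> 0"
  shows "snd (affine_chart N k) (line N z) = (\<lambda>i\<in>{..<N}. z (skip k i) / z k)"
proof -
  have "(if i < k then i else Suc i) = skip k i" for i by (simp add: skip_def)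
  moreover have "skip k i \<le> N" if "i < N" for i using that by (auto simp: skip_def)
  ultimately show ?thesis using affine_rep_line[OF assms] by (auto simp: affine_chart_def)
qed

lemma affine_point_mem [simp]: "k \<le> N \<Longrightarrow> affine_point N k w \<in> affine_domain N k"
  by (simp add: affine_point_def line_mem_affine_domain)

lemma affine_chart_affine_point:
  assumes "k \<le> N" "w \<in> extensional {..<N}"
  shows "snd (affine_chart N k) (affine_point N k w) = w"
  using assms by (auto simp: affine_point_def affine_chart_line extensional_def)

lemma affine_point_affine_chart:
  assumes "k \<le> N" "l \<in> affine_domain N k"
  shows "affine_point N k (snd (affine_chart N k) l) = l"
proof -
  obtain z where z: "l = line N z" "z \<in> hvectors N" "z k \<noteq> 0" using assms by (auto simp: affine_domain_def)
  have "line N (insert_coord N k 1 (\<lambda>i\<in>{..<N}. z (skip k i) / z k)) = line N z"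
    using eq_hscale_insert_coord[OF assms(1) hvectorsD[OF z(2)] z(3)] line_hscale[OF z(3)] by metis
  then show ?thesis using z assms by (simp add: affine_point_def affine_chart_line)
qed

lemma affine_chart_extensional [simp]: "snd (affine_chart N k) l \<in> extensional {..<N}"
  by (simp add: affine_chart_def)

lemma inj_on_affine_chart: "k \<le> N \<Longrightarrow> inj_on (snd (affine_chart N k)) (affine_domain N k)"
  by (rule inj_on_inverseI[of _ "affine_point N k"]) (rule affine_point_affine_chart)

lemma affine_chart_image:
  assumes "k \<le> N" "A \<subseteq> affine_domain N k"
  shows "snd (affine_chart N k) ` A = {w \<in> extensional {..<N}. affine_point N k w \<in> A}"
proof (intro equalityI subsetI)
  fix w assume "w \<in> snd (affine_chart N k) ` A"
  then show "w \<in> {w \<in> extensional {..<N}. affine_point N k w \<in> A}"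
    using assms by (auto simp: affine_point_affine_chart subsetD)
next
  fix w assume "w \<in> {w \<in> extensional {..<N}. affine_point N k w \<in> A}"
  then show "w \<in> snd (affine_chart N k) ` A"
    using affine_chart_affine_point[OF assms(1)] by (metis (mono_tags, lifting) image_eqI mem_Collect_eq)
qed

lemma chart_inv_affine_chart:
  assumes "k \<le> N" "w \<in> extensional {..<N}"
  shows "chart_inv (affine_chart N k) w = affine_point N k w"
  unfolding chart_inv_def fst_affine_chart
  by (rule inv_into_f_eq[OF inj_on_affine_chart])
    (use assms affine_chart_affine_point in auto)

text \<open>For \<open>k \<le> N\<close> these sets cover P^N, and each is compact and contained in
  the affine domain \<open>k\<close>. They provide the relatively compact pieces that
  \<open>chart_decomposition\<close> demands.\<close>

definition max_set :: "nat \<Rightarrow> nat \<Rightarrow> (nat \<Rightarrow> complex) set set" where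
  "max_set N k = line N ` {z \<in> hvectors N. \<forall>j\<le>N. cmod (z j) \<le> cmod (z k)}"

definition polydisc :: "nat \<Rightarrow> (nat \<Rightarrow> complex) set" where
  "polydisc n = (\<Pi>\<^sub>E i\<in>{..<n}. cball 0 1)"

lemma compactin_polydisc: "compactin (Cn n) (polydisc n)"
  unfolding polydisc_def Cn_def by (subst compactin_PiE) auto

lemma quotient_mem_polydisc:
  assumes "k \<le> N" "\<And>j. j \<le> N \<Longrightarrow> cmod (z j) \<le> cmod (z k)" "z k \<noteq> 0"
  shows "(\<lambda>i\<in>{..<N}. z (skip k i) / z k) \<in> polydisc N"
  unfolding polydisc_def
proof (rule restrict_PiE_iff[THEN iffD2], rule ballI)
  fix i assume "i \<in> {..<N}"
  then have "skip k i \<le> N" by (auto simp: skip_def)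
  then show "z (skip k i) / z k \<in> cball 0 1" using assms by (simp add: norm_divide)
qed

lemma norm_insert_coord_le:
  assumes "k \<le> N" "j \<le> N" "1 \<le> m" "\<And>i. i < N \<Longrightarrow> cmod (w i) \<le> m"
  shows "cmod (insert_coord N k 1 w j) \<le> m"
proof -
  have "j \<in> insert k (skip k ` {..<N})" using atMost_eq_insert_skip[OF assms(1)] assms(2) by auto
  then consider "j = k" | i where "i < N" "j = skip k i" by blast
  then show ?thesis by cases (use assms in auto)
qed

lemma line_mem_max_set:
  assumes "z \<in> hvectors N" "k \<le> N"
  shows "line N z \<in> max_set N k \<longleftrightarrow> (\<forall>j\<le>N. cmod (z j) \<le> cmod (z k))"
proof
  assume "line N z \<in> max_set N k"
  then obtain w where w0: "line N z = line N w" "w \<in> {z \<in> hvectors N. \<forall>j\<le>N. cmod (z j) \<le> cmod (z k)}"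
    unfolding max_set_def by (rule imageE)
  then have w: "w \<in> hvectors N" "\<forall>j\<le>N. cmod (w j) \<le> cmod (w k)" "line N w = line N z" by simp_all
  obtain u where u: "u \<noteq> 0" "z = hscale N u w" using line_eq_iff[OF w(1) assms(1)] w(3) by blast
  show "\<forall>j\<le>N. cmod (z j) \<le> cmod (z k)"
    using w(2) assms(2) unfolding u(2) by (simp add: norm_mult mult_left_mono)
next
  assume "\<forall>j\<le>N. cmod (z j) \<le> cmod (z k)"
  then show "line N z \<in> max_set N k" unfolding max_set_def using assms(1) by blast
qed

text \<open>Division by the largest coordinate brings all affine coordinates into the closed unit
  disc. Compactness is then inherited from the polydisc.\<close>

lemma max_set_eq:
  assumes "k \<le> N" shows "max_set N k = affine_point N k ` polydisc N"
proof (intro equalityI subsetI)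
  fix l assume "l \<in> max_set N k"
  then obtain z where z: "l = line N z" "z \<in> hvectors N" "\<forall>j\<le>N. cmod (z j) \<le> cmod (z k)"
    unfolding max_set_def by blast
  have zk: "z k \<noteq> 0" using z by (auto simp: hvectors_def)
  have "(\<lambda>i\<in>{..<N}. z (skip k i) / z k) \<in> polydisc N"
    by (rule quotient_mem_polydisc[OF assms]) (use z(3) zk in auto)
  moreover have "affine_point N k (\<lambda>i\<in>{..<N}. z (skip k i) / z k) = l"
    using affine_point_affine_chart[OF assms, of l] affine_chart_line[OF z(2) assms zk] z zk line_mem_affine_domain[OF z(2) assms]
    by simp
  ultimately show "l \<in> affine_point N k ` polydisc N" by (metis image_eqI)
next
  fix l assume "l \<in> affine_point N k ` polydisc N"
  then obtain w where w: "w \<in> polydisc N" "l = line N (insert_coord N k 1 w)" by (auto simp: affine_point_def)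
  have "cmod (insert_coord N k 1 w j) \<le> 1" if "j \<le> N" for j
    by (rule norm_insert_coord_le[OF assms that]) (use PiE_mem[OF w(1)[unfolded polydisc_def]] in auto)
  then show "l \<in> max_set N k" using assms unfolding w by (subst line_mem_max_set) auto
qed

lemma compactin_max_set:
  assumes "k \<le> N" shows "compactin (projective_topology N) (max_set N k)"
  unfolding max_set_eq[OF assms]
  by (rule image_compactin[OF compactin_polydisc continuous_map_affine_point[OF assms]])

lemma max_set_subset: "k \<le> N \<Longrightarrow> max_set N k \<subseteq> affine_domain N k"
  by (auto simp: max_set_eq)

lemma Un_max_set: "(\<Union>k\<le>N. max_set N k) = line N ` hvectors N"
proof (intro equalityI subsetI)
  fix l assume "l \<in> line N ` hvectors N"
  then obtain z where z: "l = line N z" "z \<in> hvectors N" by auto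
  have "Max ((\<lambda>j. cmod (z j)) ` {..N}) \<in> (\<lambda>j. cmod (z j)) ` {..N}" by (rule Max_in) auto
  then obtain k where k: "k \<le> N" "Max ((\<lambda>j. cmod (z j)) ` {..N}) = cmod (z k)"
    unfolding image_iff by blast
  have "cmod (z j) \<le> cmod (z k)" if "j \<le> N" for j
    unfolding k(2)[symmetric] using that by (intro Max_ge) auto
  then show "l \<in> (\<Union>k\<le>N. max_set N k)" using z k by (auto simp: max_set_def)
qed (auto simp: max_set_def)

text \<open>The complement is open, since among homogeneous vectors it is the union of the open
  conditions |z_j| > |z_k|.\<close>

lemma max_set_sets:
  assumes "k \<le> N"
  shows "max_set N k \<in> sigma_sets (line N ` hvectors N) {U. openin (projective_topology N) U}"
proof -
  let ?P = "line N ` hvectors N"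
  have "openin (Cn (Suc N)) {z \<in> topspace (Cn (Suc N)). cmod (z j) - cmod (z k) \<in> {0<..}}" if "j \<le> N" for j
    by (rule openin_continuous_map_preimage[where Y = euclidean], rule continuous_map_diff; (rule continuous_map_norm continuous_map_Cn_component)?)
      (use that assms in \<open>auto intro!: continuous_map_norm continuous_map_Cn_component\<close>)
  then have "openin (Cn (Suc N)) (\<Union>j\<le>N. {z \<in> topspace (Cn (Suc N)). cmod (z j) - cmod (z k) \<in> {0<..}})" by blast
  also have "(\<Union>j\<le>N. {z \<in> topspace (Cn (Suc N)). cmod (z j) - cmod (z k) \<in> {0<..}}) =
     {z \<in> extensional {..N}. \<exists>j\<le>N. cmod (z j) > cmod (z k)}" by (auto simp: lessThan_Suc_atMost)
  finally have "openin (Cn (Suc N)) {z \<in> hvectors N. \<exists>j\<le>N. cmod (z j) > cmod (z k)}"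
    by (rule openin_hvectors_cond)
  also have "{z \<in> hvectors N. \<exists>j\<le>N. cmod (z j) > cmod (z k)} = {z \<in> hvectors N. line N z \<in> ?P - max_set N k}"
  proof (rule Collect_cong, rule conj_cong[OF refl])
    fix z assume "z \<in> hvectors N"
    then show "(\<exists>j\<le>N. cmod (z k) < cmod (z j)) \<longleftrightarrow> line N z \<in> ?P - max_set N k"
      using line_mem_max_set[of z N k] assms by (force simp: not_le)
  qed
  finally have "openin (projective_topology N) (?P - max_set N k)"
    by (auto simp: openin_projective_topology)
  then have "?P - (?P - max_set N k) \<in> sigma_sets ?P {U. openin (projective_topology N) U}"
    by (intro sigma_sets.Compl sigma_sets.Basic) simp
  also have "?P - (?P - max_set N k) = max_set N k" by (auto simp: max_set_def)
  finally show ?thesis .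
qed

text \<open>Guarantees that the pair picked by \<open>SOME\<close> in
  \<open>liouville_measure\<close> really is a decomposition.\<close>

lemma chart_decomposition_exists:
  "\<exists>B c. chart_decomposition (projective_space N) B c"
proof -
  let ?S = "sigma_sets (line N ` hvectors N) {U. openin (projective_topology N) U}"
  interpret sigma_algebra "line N ` hvectors N" ?S
    by (rule sigma_algebra_sigma_sets) (use openin_subset[of "projective_topology N"] in auto)
  \<comment> \<open>Indices beyond \<open>N\<close> get empty pieces. They still need a chart of the
    atlas, hence the \<open>min i N\<close> below.\<close>
  define A where "A k = (if k \<le> N then max_set N k else {})" for k
  define B where "B = disjointed A"
  have A: "range A \<subseteq> ?S" using max_set_sets by (auto simp: A_def)
  have BA: "B i \<subseteq> A i" for i unfolding B_def by (rule disjointed_subset)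
  have "disjoint_family B" unfolding B_def by (rule disjoint_family_disjointed)
  moreover have "finite {i. B i \<noteq> {}}"
    by (rule finite_subset[of _ "{..N}"]) (use BA[unfolded A_def] in \<open>force split: if_splits\<close>, simp)
  moreover have "(\<Union>i. B i) = line N ` hvectors N"
    unfolding B_def UN_disjointed_eq Un_max_set[symmetric] by (auto simp: A_def split: if_splits)
  moreover have "B i \<in> ?S" for i
    using range_disjointed_sets[OF A] by (auto simp: B_def)
  moreover have "\<exists>K. compactin (projective_topology N) K \<and> B i \<subseteq> K \<and> K \<subseteq> affine_domain N (min i N)" for i
  proof (cases "i \<le> N")
    case True
    then show ?thesis using compactin_max_set[of i N] max_set_subset[of i N] BA[of i]
      by (auto simp: A_def min_def)
  next
    case False
    then show ?thesis using BA[of i] by (auto simp: A_def intro!: exI[of _ "{}"])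
  qed
  ultimately have "chart_decomposition (projective_space N) B (\<lambda>i. affine_chart N (min i N))"
    unfolding chart_decomposition_def by simp
  then show ?thesis by blast
qed

section \<open>The Liouville measure of projective space\<close>

definition punctured_ball :: "nat \<Rightarrow> (nat \<Rightarrow> complex) set" where
  "punctured_ball N = {z \<in> hvectors N. sq_norm {..N} z < 1}"

abbreviation line_preimage :: "nat \<Rightarrow> (nat \<Rightarrow> complex) set set \<Rightarrow> (nat \<Rightarrow> complex) set" where
  "line_preimage N A \<equiv> {z \<in> punctured_ball N. line N z \<in> A}"

definition projective_borel :: "nat \<Rightarrow> (nat \<Rightarrow> complex) set measure" where
  "projective_borel N = sigma (line N ` hvectors N) {U. openin (projective_topology N) U}"

text \<open>Extended by an arbitrary value to all of $\mathbb{C}^{N+1}$, as a measurable map.\<close>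

definition total_line :: "nat \<Rightarrow> (nat \<Rightarrow> complex) \<Rightarrow> (nat \<Rightarrow> complex) set" where
  "total_line N z = line N (if z \<in> hvectors N then z else (\<lambda>i\<in>{..N}. 1))"

lemma open_projective_subset: "{U. openin (projective_topology N) U} \<subseteq> Pow (line N ` hvectors N)"
  using openin_subset[of "projective_topology N"] by auto

lemma space_projective_borel [simp]: "space (projective_borel N) = line N ` hvectors N"
  unfolding projective_borel_def by (rule space_measure_of[OF open_projective_subset])

lemma sets_projective_borel:
  "sets (projective_borel N) = sigma_sets (line N ` hvectors N) {U. openin (projective_topology N) U}"
  unfolding projective_borel_def by (rule sets_measure_of[OF open_projective_subset])

lemma openin_projective_sets: "openin (projective_topology N) U \<Longrightarrow> U \<in> sets (projective_borel N)"
  unfolding sets_projective_borel by (rule sigma_sets.Basic) simp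

lemma hvectors_sets: "hvectors N \<in> sets (lebesgue_Cn (Suc N))"
  by (rule openin_Cn_imp_sets[OF openin_hvectors])

lemma hvectors_one: "(\<lambda>i\<in>{..N}. 1) \<in> hvectors N"
  by (auto simp: hvectors_def)

lemma total_line_eq: "z \<in> hvectors N \<Longrightarrow> total_line N z = line N z"
  by (simp add: total_line_def)

lemma measurable_total_line: "total_line N \<in> measurable (lebesgue_Cn (Suc N)) (projective_borel N)"
  unfolding projective_borel_def
proof (rule measurable_measure_of[OF open_projective_subset])
  show "total_line N \<in> space (lebesgue_Cn (Suc N)) \<rightarrow> line N ` hvectors N"
    using hvectors_one by (auto simp: total_line_def)
  fix U assume "U \<in> {U. openin (projective_topology N) U}"
  then have "{z \<in> hvectors N. line N z \<in> U} \<in> sets (lebesgue_Cn (Suc N))"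
    by (intro openin_Cn_imp_sets) (simp add: openin_projective_topology)
  moreover have "total_line N -` U \<inter> space (lebesgue_Cn (Suc N)) = {z \<in> hvectors N. line N z \<in> U} \<union>
     (if line N (\<lambda>i\<in>{..N}. 1) \<in> U then space (lebesgue_Cn (Suc N)) - hvectors N else {})"
    using sets.sets_into_space[OF hvectors_sets[of N]] by (auto simp: total_line_def split: if_splits)
  ultimately show "total_line N -` U \<inter> space (lebesgue_Cn (Suc N)) \<in> sets (lebesgue_Cn (Suc N))"
    using hvectors_sets[of N] by auto
qed

lemma measurable_affine_point:
  "k \<le> N \<Longrightarrow> affine_point N k \<in> measurable (lebesgue_Cn N) (projective_borel N)"
  using measurable_from_Cn_sigma[OF continuous_map_affine_point] by (simp add: projective_borel_def)

lemma punctured_ball_sets: "punctured_ball N \<in> sets (lebesgue_Cn (Suc N))"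
proof -
  have "continuous_map (Cn (Suc N)) euclidean (\<lambda>z. \<Sum>i\<le>N. (cmod (z i))\<^sup>2)"
    by (intro continuous_map_sum continuous_map_real_pow continuous_map_norm continuous_map_Cn_component) auto
  from openin_continuous_map_preimage[OF this, of "{..<1}"]
  have "openin (Cn (Suc N)) {z \<in> extensional {..N}. sq_norm {..N} z < 1}"
    by (simp add: lessThan_Suc_atMost)
  then show ?thesis unfolding punctured_ball_def
    by (intro openin_Cn_imp_sets openin_hvectors_cond)
qed

lemma line_preimage_eq:
  "line_preimage N A = punctured_ball N \<inter> (total_line N -` A \<inter> space (lebesgue_Cn (Suc N)))"
  using sets.sets_into_space[OF punctured_ball_sets[of N]]
  by (auto simp: total_line_eq punctured_ball_def)

lemma line_preimage_sets:
  "A \<in> sets (projective_borel N) \<Longrightarrow> line_preimage N A \<in> sets (lebesgue_Cn (Suc N))"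
  unfolding line_preimage_eq by (intro sets.Int punctured_ball_sets measurable_sets[OF measurable_total_line])

section \<open>The fibres of the ball over the affine charts\<close>

lemma sum_cmod_insert_coord:
  assumes "k \<le> N"
  shows "(\<Sum>i\<le>N. (cmod (insert_coord N k 1 w i))\<^sup>2) = 1 + sq_norm {..<N} w"
  using assms by (simp add: sum_insert_skip[OF assms])

text \<open>By homogeneity the squared norm is |u|^2 (1 + |w|^2), so the fibre over the point with
  affine coordinates w is a punctured disc in the variable u.\<close>

lemma hscale_mem_punctured_ball:
  assumes "k \<le> N" "u \<noteq> 0"
  shows "hscale N u (insert_coord N k 1 w) \<in> punctured_ball N \<longleftrightarrow>
    cmod u < 1 / sqrt (1 + sq_norm {..<N} w)"
proof -
  define S where "S = 1 + sq_norm {..<N} w"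
  have S: "S > 0" unfolding S_def by (rule one_plus_sum_cmod_pos)
  have "(\<Sum>i\<le>N. (cmod (hscale N u (insert_coord N k 1 w) i))\<^sup>2) = (cmod u)\<^sup>2 * S"
    unfolding S_def sum_cmod_insert_coord[OF assms(1), symmetric]
    by (simp add: norm_mult power_mult_distrib sum_distrib_left)
  moreover have "(cmod u)\<^sup>2 * S < 1 \<longleftrightarrow> cmod u < 1 / sqrt S"
  proof -
    have "(cmod u)\<^sup>2 * S = (cmod u * sqrt S)\<^sup>2" using S by (simp add: power_mult_distrib)
    also have "\<dots> < 1 \<longleftrightarrow> cmod u * sqrt S < 1"
      using abs_square_less_1[of "cmod u * sqrt S"] S by (simp add: abs_mult)
    also have "\<dots> \<longleftrightarrow> cmod u < 1 / sqrt S" using S by (simp add: less_divide_eq)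
    finally show ?thesis .
  qed
  ultimately show ?thesis using assms by (simp add: punctured_ball_def S_def)
qed

definition fs_weight :: "nat \<Rightarrow> (nat \<Rightarrow> complex) \<Rightarrow> real" where
  "fs_weight N w = 1 / (1 + sq_norm {..<N} w) ^ Suc N"

lemma measurable_sum_cmod: "(\<lambda>w. \<Sum>i<N. (cmod (w i))\<^sup>2) \<in> borel_measurable (lebesgue_Cn N)"
  by (intro borel_measurable_sum borel_measurable_power
      measurable_compose[OF measurable_lebesgue_Cn_component borel_measurable_norm]) auto

lemma measurable_fs_weight: "fs_weight N \<in> borel_measurable (lebesgue_Cn N)"
  unfolding fs_weight_def[abs_def] using measurable_sum_cmod[of N] by measurable

lemma affine_point_hscale:
  "u \<noteq> 0 \<Longrightarrow> line N (hscale N u (insert_coord N k 1 w)) = affine_point N k w"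
  by (simp add: affine_point_def line_hscale)

lemma affine_chart_image_sets:
  assumes "k \<le> N" "A \<in> sets (projective_borel N)" "A \<subseteq> affine_domain N k"
  shows "snd (affine_chart N k) ` A = affine_point N k -` A \<inter> space (lebesgue_Cn N)"
    and "snd (affine_chart N k) ` A \<in> sets (lebesgue_Cn N)"
proof -
  show "snd (affine_chart N k) ` A = affine_point N k -` A \<inter> space (lebesgue_Cn N)"
    unfolding affine_chart_image[OF assms(1,3)] by (auto simp: space_lebesgue_Cn PiE_def)
  then show "snd (affine_chart N k) ` A \<in> sets (lebesgue_Cn N)"
    using measurable_sets[OF measurable_affine_point[OF assms(1)] assms(2)] by simp
qed

text \<open>In cone coordinates the preimage is a family of punctured discs of radius r(w) over the
  chart image of \<open>A\<close>. Integrating over u first gives \<open>radial_constant\<close>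
  times r(w)^(2(N+1)), and this power is \<open>fs_weight\<close>.\<close>

lemma emeasure_line_preimage:
  assumes k: "k \<le> N" and A: "A \<in> sets (projective_borel N)" "A \<subseteq> affine_domain N k"
  shows "emeasure (lebesgue_Cn (Suc N)) (line_preimage N A) =
    radial_constant N * (\<integral>\<^sup>+w. ennreal (fs_weight N w) * indicator (snd (affine_chart N k) ` A) w \<partial>lebesgue_Cn N)"
proof -
  define A' where "A' = snd (affine_chart N k) ` A"
  define r where "r w = 1 / sqrt (1 + sq_norm {..<N} w)" for w :: "nat \<Rightarrow> complex"
  note A'_eq = affine_chart_image_sets(1)[OF assms, folded A'_def]
    and A' = affine_chart_image_sets(2)[OF assms, folded A'_def]
  have r[measurable]: "r \<in> borel_measurable (lebesgue_Cn N)"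
    unfolding r_def[abs_def] using measurable_sum_cmod[of N] by measurable
  have r0: "r w > 0" and r2: "r w ^ (2 * Suc N) = fs_weight N w" for w
  proof -
    have S: "1 + sq_norm {..<N} w > 0" by (rule one_plus_sum_cmod_pos)
    then show "r w > 0" by (simp add: r_def)
    have "(r w)\<^sup>2 = 1 / (1 + sq_norm {..<N} w)"
      using S by (simp add: r_def power_divide)
    then show "r w ^ (2 * Suc N) = fs_weight N w"
      by (simp only: power_mult fs_weight_def power_one_over)
  qed
  define g where "g u w = ennreal ((cmod u) ^ (2 * N)) * indicator (ball 0 (r w)) u * indicator A' w" for u w
  have g: "case_prod g \<in> borel_measurable (lborel \<Otimes>\<^sub>M lebesgue_Cn N)"
  proof -
    have [measurable]: "(\<lambda>p. r (snd p)) \<in> borel_measurable (lborel \<Otimes>\<^sub>M lebesgue_Cn N)"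
      by (rule measurable_compose[OF measurable_snd r])
    have [measurable]: "(\<lambda>p. indicator A' (snd p) :: ennreal) \<in> borel_measurable (lborel \<Otimes>\<^sub>M lebesgue_Cn N)"
      by (rule measurable_compose[OF measurable_snd borel_measurable_indicator[OF A']])
    have "case_prod g = (\<lambda>p. ennreal ((cmod (fst p)) ^ (2 * N)) * (if cmod (fst p) < r (snd p) then 1 else 0) * indicator A' (snd p))"
      by (auto simp: g_def indicator_def fun_eq_iff)
    then show ?thesis by simp
  qed
  interpret P: pair_sigma_finite "lborel :: complex measure" "lebesgue_Cn N" ..
  have "emeasure (lebesgue_Cn (Suc N)) (line_preimage N A) = (\<integral>\<^sup>+z. indicator (line_preimage N A) z \<partial>lebesgue_Cn (Suc N))"
    using line_preimage_sets[OF A(1)] by simp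
  also have "\<dots> = (\<integral>\<^sup>+u. \<integral>\<^sup>+w. ennreal ((cmod u) ^ (2 * N)) *
      indicator (line_preimage N A) (hscale N u (insert_coord N k 1 w)) \<partial>lebesgue_Cn N \<partial>lborel)"
    by (rule nn_integral_lebesgue_Cn_cone[OF k borel_measurable_indicator[OF line_preimage_sets[OF A(1)]]])
  also have "\<dots> = (\<integral>\<^sup>+u. \<integral>\<^sup>+w. g u w \<partial>lebesgue_Cn N \<partial>lborel)"
  proof (rule nn_integral_cong_AE)
    have "AE u in lborel. u \<noteq> (0::complex)" by (rule AE_lborel_singleton)
    then show "AE u in lborel. (\<integral>\<^sup>+w. ennreal ((cmod u) ^ (2 * N)) *
      indicator (line_preimage N A) (hscale N u (insert_coord N k 1 w)) \<partial>lebesgue_Cn N) = (\<integral>\<^sup>+w. g u w \<partial>lebesgue_Cn N)"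
    proof eventually_elim
      case (elim u)
      show ?case
      proof (rule nn_integral_cong)
        fix w assume "w \<in> space (lebesgue_Cn N)"
        then show "ennreal ((cmod u) ^ (2 * N)) * indicator (line_preimage N A) (hscale N u (insert_coord N k 1 w)) = g u w"
          using hscale_mem_punctured_ball[OF k elim, of w] affine_point_hscale[OF elim, of N k w]
          by (simp add: g_def A'_eq r_def indicator_def)
      qed
    qed
  qed
  also have "\<dots> = (\<integral>\<^sup>+w. \<integral>\<^sup>+u. g u w \<partial>lborel \<partial>lebesgue_Cn N)"
    by (rule P.Fubini'[OF g, symmetric])
  also have "\<dots> = (\<integral>\<^sup>+w. radial_constant N * (ennreal (fs_weight N w) * indicator A' w) \<partial>lebesgue_Cn N)"
  proof (rule nn_integral_cong)
    fix w
    have "(\<integral>\<^sup>+u. g u w \<partial>lborel) = (\<integral>\<^sup>+u. ennreal ((cmod u) ^ (2 * N)) * indicator (ball 0 (r w)) u \<partial>lborel) * indicator A' w"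
      unfolding g_def by (rule nn_integral_multc) (use radial_measurable in auto)
    then show "(\<integral>\<^sup>+u. g u w \<partial>lborel) = radial_constant N * (ennreal (fs_weight N w) * indicator A' w)"
      unfolding radial_integral[OF r0] r2 by (simp add: mult_ac)
  qed
  also have "\<dots> = radial_constant N * (\<integral>\<^sup>+w. ennreal (fs_weight N w) * indicator A' w \<partial>lebesgue_Cn N)"
    by (rule nn_integral_cmult) (use A' measurable_fs_weight in auto)
  finally show ?thesis by (simp add: A'_def)
qed

text \<open>Chosen so that the constant produced by integrating over the discs is exchanged for the
  constant of the Liouville density.\<close>

definition liouville_factor :: "nat \<Rightarrow> real" where
  "liouville_factor N = fs_constant N / enn2real (radial_constant N)"

lemma radial_constant_eq: "radial_constant N = ennreal (enn2real (radial_constant N))"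
  using radial_constant_finite[of N] by simp

lemma enn2real_radial_constant_pos: "enn2real (radial_constant N) > 0"
  using radial_constant_finite[of N] radial_constant_pos[of N] by (simp add: enn2real_positive_iff)

lemma liouville_factor_pos: "liouville_factor N > 0"
  unfolding liouville_factor_def by (intro divide_pos_pos fs_constant_pos enn2real_radial_constant_pos)

text \<open>The right-hand side no longer mentions the chart, so the contributions of pieces lying
  in different charts can be added.\<close>

lemma chart_integral_eq:
  assumes k: "k \<le> N" and A: "A \<in> sets (projective_borel N)" "A \<subseteq> affine_domain N k"
  shows "(\<integral>\<^sup>+w. ennreal (liouville_density (projective_space N) (fubini_study N) (affine_chart N k) (chart_inv (affine_chart N k) w))
      * indicator (snd (affine_chart N k) ` A) w \<partial>lebesgue_Cn N)
    = ennreal (liouville_factor N) * emeasure (lebesgue_Cn (Suc N)) (line_preimage N A)"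
proof -
  let ?A = "snd (affine_chart N k) ` A"
  let ?d = "\<lambda>w. liouville_density (projective_space N) (fubini_study N) (affine_chart N k) (chart_inv (affine_chart N k) w)"
  have "(\<integral>\<^sup>+w. ennreal (?d w) * indicator ?A w \<partial>lebesgue_Cn N)
     = (\<integral>\<^sup>+w. ennreal (fs_constant N) * (ennreal (fs_weight N w) * indicator ?A w) \<partial>lebesgue_Cn N)"
  proof (rule nn_integral_cong)
    fix w assume "w \<in> space (lebesgue_Cn N)"
    then have w: "w \<in> extensional {..<N}" by (simp add: space_lebesgue_Cn PiE_def)
    have "?d w = fs_constant N * fs_weight N w"
      using k w by (simp add: liouville_density_fubini_study chart_inv_affine_chart affine_chart_affine_point fs_weight_def)
    then show "ennreal (?d w) * indicator ?A w = ennreal (fs_constant N) * (ennreal (fs_weight N w) * indicator ?A w)"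
      using fs_constant_pos[of N] by (simp add: ennreal_mult' mult.assoc)
  qed
  also have "\<dots> = ennreal (fs_constant N) * (\<integral>\<^sup>+w. ennreal (fs_weight N w) * indicator ?A w \<partial>lebesgue_Cn N)"
    by (rule nn_integral_cmult) (use affine_chart_image_sets(2)[OF assms] measurable_fs_weight in auto)
  also have "ennreal (fs_constant N) = ennreal (liouville_factor N) * radial_constant N"
    using enn2real_radial_constant_pos[of N] liouville_factor_pos[of N]
    by (subst radial_constant_eq) (simp add: ennreal_mult[symmetric] liouville_factor_def)
  finally show ?thesis unfolding emeasure_line_preimage[OF assms] by (simp add: mult.assoc)
qed

definition ball_measure :: "nat \<Rightarrow> (nat \<Rightarrow> complex) measure" where
  "ball_measure N = density (lebesgue_Cn (Suc N)) (\<lambda>z. ennreal (liouville_factor N) * indicator (punctured_ball N) z)"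

lemma space_ball_measure: "space (ball_measure N) = space (lebesgue_Cn (Suc N))"
  by (simp add: ball_measure_def)

lemma emeasure_ball_measure:
  assumes "A \<in> sets (lebesgue_Cn (Suc N))"
  shows "emeasure (ball_measure N) A = ennreal (liouville_factor N) * emeasure (lebesgue_Cn (Suc N)) (punctured_ball N \<inter> A)"
proof -
  have "emeasure (ball_measure N) A = (\<integral>\<^sup>+z. ennreal (liouville_factor N) * indicator (punctured_ball N \<inter> A) z \<partial>lebesgue_Cn (Suc N))"
    unfolding ball_measure_def using assms punctured_ball_sets[of N]
    by (subst emeasure_density) (auto simp: indicator_inter_arith mult.assoc)
  then show ?thesis using assms punctured_ball_sets[of N] by (simp add: nn_integral_cmult_indicator sets.Int)
qed

lemma measurable_total_line_ball:
  "total_line N \<in> measurable (ball_measure N) (projective_borel N)"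
  using measurable_total_line[of N] by (simp add: ball_measure_def)

text \<open>For every chart decomposition the pieces have disjoint preimages in the ball, whose
  measures add up to that of the preimage of the whole set. Hence the choice made by
  \<open>SOME\<close> does not affect the result.\<close>

lemma liouville_measure_projective_space:
  "liouville_measure (projective_space N) (fubini_study N) = distr (ball_measure N) (projective_borel N) (total_line N)"
proof -
  let ?D = "distr (ball_measure N) (projective_borel N) (total_line N)"
  let ?P = "line N ` hvectors N" and ?O = "{U. openin (projective_topology N) U}"
  obtain B c where Bc: "(SOME (B, c). chart_decomposition (projective_space N) B c) = (B, c)" by fastforce
  have cd: "chart_decomposition (projective_space N) B c"
    using someI_ex[of "\<lambda>(B, c). chart_decomposition (projective_space N) B c"] chart_decomposition_exists[of N]
    unfolding Bc by auto
  define \<mu> where "\<mu> A = (\<Sum>i. \<integral>\<^sup>+ z. ennreal (liouville_density (projective_space N) (fubini_study N) (c i) (chart_inv (c i) z))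
                          * indicator (snd (c i) ` (B i \<inter> A)) z \<partial>lebesgue_Cn N)" for A
  have \<mu>: "\<mu> A = emeasure ?D A" if A: "A \<in> sigma_sets ?P ?O" for A
  proof -
    have As: "A \<in> sets (projective_borel N)" using A by (simp add: sets_projective_borel)
    have Bs: "B i \<in> sets (projective_borel N)" for i
      using cd by (auto simp: chart_decomposition_def sets_projective_borel)
    have BAs: "B i \<inter> A \<in> sets (projective_borel N)" for i using As Bs by blast
    have piece: "(\<integral>\<^sup>+ z. ennreal (liouville_density (projective_space N) (fubini_study N) (c i) (chart_inv (c i) z))
         * indicator (snd (c i) ` (B i \<inter> A)) z \<partial>lebesgue_Cn N) =
        ennreal (liouville_factor N) * emeasure (lebesgue_Cn (Suc N)) (line_preimage N (B i \<inter> A))" for i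
    proof -
      have "c i \<in> affine_chart N ` {..N}" using cd by (simp add: chart_decomposition_def)
      then obtain k where k: "k \<le> N" "c i = affine_chart N k" by auto
      have "\<exists>K. compactin (mtop (projective_space N)) K \<and> B i \<subseteq> K \<and> K \<subseteq> fst (c i)"
        using cd by (simp add: chart_decomposition_def)
      then have "B i \<subseteq> affine_domain N k" unfolding k(2) fst_affine_chart by (elim exE conjE) (rule subset_trans)
      then show ?thesis unfolding k(2) by (intro chart_integral_eq k BAs) auto
    qed
    have "\<mu> A = ennreal (liouville_factor N) * (\<Sum>i. emeasure (lebesgue_Cn (Suc N)) (line_preimage N (B i \<inter> A)))"
      unfolding \<mu>_def piece by (rule ennreal_suminf_cmult)
    also have "(\<Sum>i. emeasure (lebesgue_Cn (Suc N)) (line_preimage N (B i \<inter> A))) =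
       emeasure (lebesgue_Cn (Suc N)) (\<Union>i. line_preimage N (B i \<inter> A))"
    proof (rule suminf_emeasure)
      show "range (\<lambda>i. line_preimage N (B i \<inter> A)) \<subseteq> sets (lebesgue_Cn (Suc N))"
        using line_preimage_sets[OF BAs] by auto
      have "disjoint_family B" using cd by (simp add: chart_decomposition_def)
      then show "disjoint_family (\<lambda>i. line_preimage N (B i \<inter> A))"
        unfolding disjoint_family_on_def by blast
    qed
    also have "(\<Union>i. line_preimage N (B i \<inter> A)) = line_preimage N A"
    proof -
      have "(\<Union>i. B i) = ?P" using cd by (simp add: chart_decomposition_def)
      then show ?thesis by (auto simp: punctured_ball_def)
    qed
    also have "ennreal (liouville_factor N) * emeasure (lebesgue_Cn (Suc N)) (line_preimage N A) = emeasure ?D A"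
      unfolding line_preimage_eq
      using As measurable_sets[OF measurable_total_line As] emeasure_distr[OF measurable_total_line_ball As]
      by (simp add: emeasure_ball_measure space_ball_measure)
    finally show ?thesis .
  qed
  have "liouville_measure (projective_space N) (fubini_study N) = measure_of ?P ?O \<mu>"
    unfolding liouville_measure_def Bc \<mu>_def by simp
  \<comment> \<open>\<open>measure_of\<close> sees a set function on the generated sigma-algebra
    only, where \<mu> agrees with \<open>?D\<close>. Countable additivity, on which
    \<open>measure_of\<close> insists, is then that of the measure \<open>?D\<close>.\<close>
  also have "\<dots> = measure_of ?P ?O (emeasure ?D)"
    by (rule measure_of_eq[OF open_projective_subset \<mu>])
  also have "\<dots> = ?D"
  proof (rule measure_eqI)
    show s: "sets (measure_of ?P ?O (emeasure ?D)) = sets ?D"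
      using sets_measure_of[OF open_projective_subset] by (simp add: sets_projective_borel)
    fix A assume "A \<in> sets (measure_of ?P ?O (emeasure ?D))"
    then show "emeasure (measure_of ?P ?O (emeasure ?D)) A = emeasure ?D A"
      by (intro emeasure_measure_of[OF refl open_projective_subset])
        (simp_all only: s emeasure_positive emeasure_countably_additive)
  qed
  finally show ?thesis .
qed

section \<open>Scalar products of the coordinate sections\<close>

lemma continuous_map_of_real:
  "continuous_map X euclidean f \<Longrightarrow> continuous_map X euclidean (\<lambda>x. of_real (f x) :: 'b::real_normed_algebra_1)"
  by (simp add: continuous_map_atin tendsto_of_real)

lemma hvectors_iff_sum: "z \<in> hvectors N \<longleftrightarrow> z \<in> extensional {..N} \<and> sq_norm {..N} z \<noteq> 0"
  by (auto simp: hvectors_def sum_nonneg_eq_0_iff)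

text \<open>With all |c_i| = 1 and \<pi> a permutation this is a unitary map. It comprises both
  symmetries used below: a sign change (\<open>\<pi> = id\<close>) and a transposition of
  coordinates (all \<open>c i = 1\<close>).\<close>

definition monomial_map :: "nat \<Rightarrow> (nat \<Rightarrow> complex) \<Rightarrow> (nat \<Rightarrow> nat) \<Rightarrow> (nat \<Rightarrow> complex) \<Rightarrow> nat \<Rightarrow> complex" where
  "monomial_map N c \<pi> z = (\<lambda>i\<in>{..N}. c i * z (\<pi> i))"

context
  fixes N :: nat and c :: "nat \<Rightarrow> complex" and \<pi> :: "nat \<Rightarrow> nat"
  assumes c: "\<And>i. cmod (c i) = 1" and \<pi>: "\<pi> permutes {..N}"
begin

lemma perm_le: "i \<le> N \<Longrightarrow> \<pi> i \<le> N"
  using permutes_in_image[OF \<pi>, of i] by simp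

lemma measurable_monomial_map: "monomial_map N c \<pi> \<in> measurable (lebesgue_Cn (Suc N)) (lebesgue_Cn (Suc N))"
proof (rule measurable_lebesgue_CnI)
  fix i assume i: "i < Suc N"
  have "(\<lambda>z. z (\<pi> i)) \<in> borel_measurable (lebesgue_Cn (Suc N))"
    by (rule measurable_lebesgue_Cn_component) (use perm_le[of i] i in simp)
  then show "(\<lambda>z. monomial_map N c \<pi> z i) \<in> borel_measurable (lebesgue_Cn (Suc N))"
    using i by (simp add: monomial_map_def)
qed (simp add: monomial_map_def lessThan_Suc_atMost)

text \<open>The preimage of a box is the box with permuted sides, each rotated by a number of
  modulus 1, and rotations preserve area.\<close>

lemma distr_monomial_map:
  "distr (lebesgue_Cn (Suc N)) (lebesgue_Cn (Suc N)) (monomial_map N c \<pi>) = lebesgue_Cn (Suc N)" (is "?D = _")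
  unfolding lebesgue_Cn_def[of "Suc N"]
proof (rule product_Cn.PiM_eqI, goal_cases)
  case (3 A)
  have c0: "c i \<noteq> 0" for i using c[of i] by auto
  have A: "Pi\<^sub>E {..<Suc N} A \<in> sets (lebesgue_Cn (Suc N))"
    unfolding lebesgue_Cn_def by (rule sets_PiM_I_finite) (use 3 in auto)
  \<comment> \<open>The variable z_j occurs in coordinate \<open>inv \<pi> j\<close> of the image,
    which therefore determines side \<open>j\<close> of the preimage.\<close>
  define A' where "A' j = {x. c (inv \<pi> j) * x \<in> A (inv \<pi> j)}" for j
  have inv_le: "inv \<pi> j \<le> N" if "j \<le> N" for j
    using permutes_in_image[OF permutes_inv[OF \<pi>], of j] that by simp
  have A': "A' j \<in> sets lborel" if "j < Suc N" for j
  proof -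
    have "A' j = (\<lambda>x. c (inv \<pi> j) * x) -` A (inv \<pi> j) \<inter> space borel" by (auto simp: A'_def)
    also have "\<dots> \<in> sets borel" using 3[of "inv \<pi> j"] inv_le[of j] that by (intro measurable_sets[of _ borel borel]) auto
    finally show ?thesis by simp
  qed
  have A'\<pi>: "A' (\<pi> i) = {x. c i * x \<in> A i}" for i
    by (simp add: A'_def permutes_inverses[OF \<pi>])
  have "monomial_map N c \<pi> -` Pi\<^sub>E {..<Suc N} A \<inter> space (lebesgue_Cn (Suc N)) = Pi\<^sub>E {..<Suc N} A'"
  proof (intro equalityI subsetI)
    fix z assume z: "z \<in> monomial_map N c \<pi> -` Pi\<^sub>E {..<Suc N} A \<inter> space (lebesgue_Cn (Suc N))"
    show "z \<in> Pi\<^sub>E {..<Suc N} A'"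
    proof (rule PiE_I)
      fix j assume j: "j \<in> {..<Suc N}"
      have "monomial_map N c \<pi> z (inv \<pi> j) \<in> A (inv \<pi> j)"
        using z inv_le[of j] j by (intro PiE_mem[of _ "{..<Suc N}" A]) auto
      then show "z j \<in> A' j" using j inv_le[of j] by (simp add: A'_def monomial_map_def permutes_inverses[OF \<pi>])
    qed (use z in \<open>auto simp: space_lebesgue_Cn PiE_def extensional_def\<close>)
  next
    fix z assume z: "z \<in> Pi\<^sub>E {..<Suc N} A'"
    have "monomial_map N c \<pi> z i \<in> A i" if "i \<le> N" for i
    proof -
      have "z (\<pi> i) \<in> A' (\<pi> i)" using PiE_mem[OF z, of "\<pi> i"] perm_le[OF that] by simp
      then show ?thesis using that by (simp add: A'\<pi> monomial_map_def)
    qed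
    then show "z \<in> monomial_map N c \<pi> -` Pi\<^sub>E {..<Suc N} A \<inter> space (lebesgue_Cn (Suc N))"
      using z by (auto simp: space_lebesgue_Cn PiE_def monomial_map_def lessThan_Suc_atMost)
  qed
  then have "emeasure ?D (Pi\<^sub>E {..<Suc N} A) = emeasure (lebesgue_Cn (Suc N)) (Pi\<^sub>E {..<Suc N} A')"
    by (simp add: emeasure_distr[OF measurable_monomial_map A])
  also have "\<dots> = (\<Prod>j<Suc N. emeasure lborel (A' j))"
    unfolding lebesgue_Cn_def by (rule product_Cn.emeasure_PiM) (use A' in auto)
  also have "\<dots> = (\<Prod>i<Suc N. emeasure lborel (A' (\<pi> i)))"
    using prod.permute[OF \<pi>, of "\<lambda>j. emeasure lborel (A' j)"] by (simp add: lessThan_Suc_atMost o_def)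
  also have "\<dots> = (\<Prod>i<Suc N. emeasure lborel (A i))"
  proof (intro prod.cong refl)
    fix i assume "i \<in> {..<Suc N}"
    then show "emeasure lborel (A' (\<pi> i)) = emeasure lborel (A i)"
      using emeasure_lborel_complex_mult[OF c0, of "A i" i] 3[of i] c[of i] by (simp add: A'\<pi>)
  qed
  finally show ?case unfolding lebesgue_Cn_def .
qed auto

lemma sum_monomial_map: "(\<Sum>i\<le>N. (cmod (monomial_map N c \<pi> z i))\<^sup>2) = sq_norm {..N} z"
proof -
  have "(\<Sum>i\<le>N. (cmod (monomial_map N c \<pi> z i))\<^sup>2) = (\<Sum>i\<le>N. (cmod (z (\<pi> i)))\<^sup>2)"
    by (intro sum.cong) (auto simp: monomial_map_def norm_mult c)
  also have "\<dots> = sq_norm {..N} z"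
    using sum.permute[OF \<pi>, of "\<lambda>i. (cmod (z i))\<^sup>2"] by (simp add: o_def)
  finally show ?thesis .
qed

lemma monomial_map_punctured_ball:
  "z \<in> extensional {..N} \<Longrightarrow> monomial_map N c \<pi> z \<in> punctured_ball N \<longleftrightarrow> z \<in> punctured_ball N"
  unfolding punctured_ball_def mem_Collect_eq hvectors_iff_sum sum_monomial_map
  by (simp add: monomial_map_def)

lemma integral_monomial_map:
  fixes f :: "(nat \<Rightarrow> complex) \<Rightarrow> complex"
  assumes f: "f \<in> borel_measurable (lebesgue_Cn (Suc N))"
  shows "(LINT z|ball_measure N. f (monomial_map N c \<pi> z)) = (LINT z|ball_measure N. f z)"
proof -
  define g where "g z = liouville_factor N * indicator (punctured_ball N) z" for z
  have g: "g \<in> borel_measurable (lebesgue_Cn (Suc N))"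
    unfolding g_def[abs_def] using punctured_ball_sets[of N] by auto
  have g0: "g z \<ge> 0" for z using liouville_factor_pos[of N] by (simp add: g_def)
  have bm: "ball_measure N = density (lebesgue_Cn (Suc N)) (\<lambda>z. ennreal (g z))"
    unfolding ball_measure_def g_def using liouville_factor_pos[of N]
    by (intro arg_cong[where f = "density _"]) (auto simp: fun_eq_iff indicator_def)
  have fT: "(\<lambda>z. f (monomial_map N c \<pi> z)) \<in> borel_measurable (lebesgue_Cn (Suc N))"
    by (rule measurable_compose[OF measurable_monomial_map f])
  have "(LINT z|ball_measure N. f (monomial_map N c \<pi> z)) = (LINT z|lebesgue_Cn (Suc N). g z *\<^sub>R f (monomial_map N c \<pi> z))"
    unfolding bm by (rule integral_density[OF fT g]) (simp add: g0)
  \<comment> \<open>The map preserves the punctured ball and thus the density \<open>g\<close>, so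
    the whole integrand is composed with it.\<close>
  also have "\<dots> = (LINT z|lebesgue_Cn (Suc N). g (monomial_map N c \<pi> z) *\<^sub>R f (monomial_map N c \<pi> z))"
    by (intro Bochner_Integration.integral_cong refl)
      (simp add: g_def indicator_def monomial_map_punctured_ball space_lebesgue_Cn PiE_def lessThan_Suc_atMost)
  also have "\<dots> = (LINT z|distr (lebesgue_Cn (Suc N)) (lebesgue_Cn (Suc N)) (monomial_map N c \<pi>). g z *\<^sub>R f z)"
    by (rule integral_distr[OF measurable_monomial_map, symmetric]) (use f g in auto)
  also have "\<dots> = (LINT z|lebesgue_Cn (Suc N). g z *\<^sub>R f z)" by (simp add: distr_monomial_map)
  also have "\<dots> = (LINT z|ball_measure N. f z)"
    unfolding bm by (rule integral_density[OF f g, symmetric]) (simp add: g0)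
  finally show ?thesis .
qed

end

section \<open>Finiteness and positivity of the volume\<close>

lemma emeasure_punctured_ball_finite: "emeasure (lebesgue_Cn (Suc N)) (punctured_ball N) < \<infinity>"
proof -
  have "punctured_ball N \<subseteq> (\<Pi>\<^sub>E i\<in>{..<Suc N}. ball 0 1)"
  proof (intro subsetI PiE_I)
    fix z i assume z: "z \<in> punctured_ball N" and i: "i \<in> {..<Suc N}"
    have "(cmod (z i))\<^sup>2 \<le> sq_norm {..N} z" using i by (intro member_le_sum) auto
    then have "(cmod (z i))\<^sup>2 < 1" using z by (simp add: punctured_ball_def)
    then show "z i \<in> ball 0 1" using abs_square_less_1[of "cmod (z i)"] by simp
  qed (auto simp: punctured_ball_def hvectors_def extensional_def)
  then have "emeasure (lebesgue_Cn (Suc N)) (punctured_ball N) \<le> emeasure (lebesgue_Cn (Suc N)) (\<Pi>\<^sub>E i\<in>{..<Suc N}. ball 0 1)"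
    unfolding lebesgue_Cn_def by (intro emeasure_mono sets_PiM_I_finite) auto
  also have "\<dots> = (\<Prod>i<Suc N. emeasure lborel (ball (0::complex) 1))"
    unfolding lebesgue_Cn_def by (rule product_Cn.emeasure_PiM) auto
  also have "\<dots> < \<infinity>"
  proof -
    obtain r where "r \<ge> 0" "emeasure lborel (ball (0::complex) 1) = ennreal r"
      using emeasure_bounded_finite[of "ball (0::complex) 1"] by (cases "emeasure lborel (ball (0::complex) 1)") auto
    then show ?thesis by (simp add: ennreal_power ennreal_mult[symmetric])
  qed
  finally show ?thesis .
qed

text \<open>The part of the ball over the affine chart 0 suffices: up to a positive constant its
  measure is the integral of the strictly positive \<open>fs_weight\<close> over all of C^N. The
  positive volume obtained from this is what the coherent vectors of P^N are divided by.\<close>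

lemma emeasure_punctured_ball_pos: "emeasure (lebesgue_Cn (Suc N)) (punctured_ball N) > 0"
proof -
  let ?A = "affine_domain N 0"
  have A: "?A \<in> sets (projective_borel N)" by (rule openin_projective_sets[OF openin_affine_domain]) simp
  have img: "snd (affine_chart N 0) ` ?A = space (lebesgue_Cn N)"
    unfolding affine_chart_image[OF le0 order_refl] by (auto simp: space_lebesgue_Cn PiE_def)
  have w: "fs_weight N w > 0" for w
    using one_plus_sum_cmod_pos[where w = w and N = N] by (simp add: fs_weight_def)
  have "(\<integral>\<^sup>+w. ennreal (fs_weight N w) \<partial>lebesgue_Cn N) \<noteq> 0"
  proof
    assume "(\<integral>\<^sup>+w. ennreal (fs_weight N w) \<partial>lebesgue_Cn N) = 0"
    then have "AE w in lebesgue_Cn N. ennreal (fs_weight N w) = 0"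
      by (subst (asm) nn_integral_0_iff_AE) (use measurable_fs_weight in auto)
    then have "AE w in lebesgue_Cn N. False" by eventually_elim (metis w ennreal_eq_0_iff not_le)
    then have "emeasure (lebesgue_Cn N) (space (lebesgue_Cn N)) = 0" by (simp add: AE_iff_null null_setsD1)
    moreover have "emeasure (lebesgue_Cn N) (space (lebesgue_Cn N)) = (\<Prod>i<N. emeasure (lborel :: complex measure) UNIV)"
      unfolding space_lebesgue_Cn unfolding lebesgue_Cn_def by (rule product_Cn.emeasure_PiM) auto
    moreover have "(\<Prod>i<n. emeasure (lborel :: complex measure) UNIV) > 0" for n :: nat
      by (induction n) (auto simp: ennreal_zero_less_mult_iff)
    ultimately show False by (metis less_irrefl)
  qed
  also have "(\<integral>\<^sup>+w. ennreal (fs_weight N w) \<partial>lebesgue_Cn N) =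
      (\<integral>\<^sup>+w. ennreal (fs_weight N w) * indicator (snd (affine_chart N 0) ` ?A) w \<partial>lebesgue_Cn N)"
    unfolding img by (rule nn_integral_cong) simp
  finally have "emeasure (lebesgue_Cn (Suc N)) (line_preimage N ?A) > 0"
    unfolding emeasure_line_preimage[OF le0 A order_refl] using radial_constant_pos[of N]
    by (simp add: ennreal_zero_less_mult_iff zero_less_iff_neq_zero)
  also have "\<dots> \<le> emeasure (lebesgue_Cn (Suc N)) (punctured_ball N)"
    by (rule emeasure_mono[OF _ punctured_ball_sets]) auto
  finally show ?thesis .
qed

interpretation ball_measure: finite_measure "ball_measure N"
proof
  have "punctured_ball N \<inter> space (lebesgue_Cn (Suc N)) = punctured_ball N"
    using sets.sets_into_space[OF punctured_ball_sets[of N]] by auto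
  then show "emeasure (ball_measure N) (space (ball_measure N)) \<noteq> \<infinity>"
    using emeasure_punctured_ball_finite[of N]
    by (simp add: emeasure_ball_measure space_ball_measure ennreal_mult_eq_top_iff)
qed

lemma vol_eq: "vol (projective_space N) (fubini_study N) = measure (ball_measure N) (space (ball_measure N))"
proof -
  have "total_line N -` (line N ` hvectors N) \<inter> space (ball_measure N) = space (ball_measure N)"
    using measurable_space[OF measurable_total_line_ball[of N]] by auto
  then show ?thesis
    unfolding vol_def liouville_measure_projective_space mpoints_projective_space
    using sets.top[of "projective_borel N"] by (subst measure_distr[OF measurable_total_line_ball]) auto
qed

lemma vol_pos: "vol (projective_space N) (fubini_study N) > 0"
proof -
  have "punctured_ball N \<inter> space (lebesgue_Cn (Suc N)) = punctured_ball N"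
    using sets.sets_into_space[OF punctured_ball_sets[of N]] by auto
  then have "emeasure (ball_measure N) (space (ball_measure N)) > 0"
    using emeasure_punctured_ball_pos[of N] liouville_factor_pos[of N]
    by (simp add: emeasure_ball_measure space_ball_measure ennreal_zero_less_mult_iff)
  then show ?thesis unfolding vol_eq using ball_measure.emeasure_eq_measure[of N] by simp
qed

lemma AE_ball_measure: "AE z in ball_measure N. z \<in> punctured_ball N"
  unfolding ball_measure_def using punctured_ball_sets[of N]
  by (subst AE_density) (auto simp: indicator_def)

text \<open>The pointwise product of the sections t_j and t_k as a function of homogeneous
  coordinates, see \<open>hyperplane_metric_line\<close>.\<close>

definition coord_product :: "nat \<Rightarrow> nat \<Rightarrow> nat \<Rightarrow> (nat \<Rightarrow> complex) \<Rightarrow> complex" where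
  "coord_product N j k z = cnj (z j) * z k / of_real (sq_norm {..N} z)"

lemma norm_coord_product_le:
  assumes "j \<le> N" "k \<le> N" shows "cmod (coord_product N j k z) \<le> 1"
proof -
  define S where "S = sq_norm {..N} z"
  have le: "cmod (z i) \<le> sqrt S" if "i \<le> N" for i
    unfolding S_def using that member_le_sum[of i "{..N}" "\<lambda>i. (cmod (z i))\<^sup>2"] by (intro real_le_rsqrt) auto
  have S0: "S \<ge> 0" unfolding S_def by (intro sum_nonneg) auto
  have "cmod (z j) * cmod (z k) \<le> sqrt S * sqrt S" using le assms S0 by (intro mult_mono) auto
  then have "cmod (z j) * cmod (z k) \<le> S" using S0 by simp
  then show ?thesis using S0 unfolding coord_product_def S_def[symmetric]
    by (cases "S = 0") (auto simp: norm_divide norm_mult)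
qed

lemma measurable_coord_product:
  assumes "j \<le> N" "k \<le> N" shows "coord_product N j k \<in> borel_measurable (lebesgue_Cn (Suc N))"
proof -
  have [measurable]: "(\<lambda>z. z i) \<in> borel_measurable (lebesgue_Cn (Suc N))" if "i \<le> N" for i
    by (rule measurable_lebesgue_Cn_component) (use that in simp)
  have "(\<lambda>z. \<Sum>i\<le>N. (cmod (z i))\<^sup>2) \<in> borel_measurable (lebesgue_Cn (Suc N))"
    by (intro borel_measurable_sum borel_measurable_power
      measurable_compose[OF measurable_lebesgue_Cn_component borel_measurable_norm]) auto
  moreover have "(\<lambda>z. cnj (z j)) \<in> borel_measurable (lebesgue_Cn (Suc N))"
    by (rule measurable_compose[OF measurable_lebesgue_Cn_component])
      (use assms in \<open>auto intro: borel_measurable_continuous_onI continuous_intros\<close>)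
  ultimately show ?thesis using assms
    unfolding coord_product_def[abs_def] by (intro borel_measurable_divide borel_measurable_times) auto
qed

lemma integrable_coord_product:
  assumes "j \<le> N" "k \<le> N" shows "integrable (ball_measure N) (coord_product N j k)"
  by (rule ball_measure.integrable_const_bound[where B = 1])
    (use measurable_coord_product[OF assms] norm_coord_product_le[OF assms] in \<open>auto simp: ball_measure_def\<close>)

lemma integral_coord_product:
  assumes "j \<le> N" "k \<le> N"
  shows "(LINT z|ball_measure N. coord_product N j k z) =
    (if j = k then of_real (vol (projective_space N) (fubini_study N) / (real N + 1)) else 0)"
proof -
  have off: "(LINT z|ball_measure N. coord_product N j k z) = 0" if jk: "j \<le> N" "k \<le> N" "j \<noteq> k" for j k
  proof -
    define c where "c i = (if i = j then -1 else 1 :: complex)" for i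
    have c: "cmod (c i) = 1" for i by (simp add: c_def)
    have "coord_product N j k (monomial_map N c id z) = - coord_product N j k z" for z
      using jk unfolding coord_product_def sum_monomial_map[of c id N z, OF c permutes_id]
      by (simp add: monomial_map_def c_def)
    then have "(LINT z|ball_measure N. coord_product N j k z) = - (LINT z|ball_measure N. coord_product N j k z)"
      using integral_monomial_map[of c id N, OF c permutes_id measurable_coord_product[OF jk(1,2)]] by simp
    then show ?thesis by simp
  qed
  have diag: "(LINT z|ball_measure N. coord_product N j j z) = (LINT z|ball_measure N. coord_product N k k z)"
    if jk: "j \<le> N" "k \<le> N" for j k
  proof -
    have c: "cmod ((\<lambda>_. 1 :: complex) i) = 1" for i :: nat by simp
    have p: "swap j k permutes {..N}" using jk by (intro permutes_swap_id) auto
    have "coord_product N j j (monomial_map N (\<lambda>_. 1) (swap j k) z) = coord_product N k k z" for z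
      using jk unfolding coord_product_def sum_monomial_map[OF c p]
      by (simp add: monomial_map_def)
    then show ?thesis
      using integral_monomial_map[OF c p measurable_coord_product[OF jk(1,1)]] by simp
  qed
  have "(\<Sum>i\<le>N. LINT z|ball_measure N. coord_product N i i z) = (LINT z|ball_measure N. (\<Sum>i\<le>N. coord_product N i i z))"
    by (rule Bochner_Integration.integral_sum[symmetric]) (auto intro: integrable_coord_product)
  also have "\<dots> = (LINT z|ball_measure N. 1)"
  proof (rule integral_cong_AE)
    show "(\<lambda>z. \<Sum>i\<le>N. coord_product N i i z) \<in> borel_measurable (ball_measure N)"
      by (intro borel_measurable_sum) (auto simp: ball_measure_def measurable_coord_product)
    \<comment> \<open>At the origin the quotients are 0 by the convention for division, so the sum
      is 1 only away from it.\<close>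
    show "AE z in ball_measure N. (\<Sum>i\<le>N. coord_product N i i z) = 1"
      using AE_ball_measure
    proof eventually_elim
      case (elim z)
      then have "sq_norm {..N} z \<noteq> 0" by (auto simp: punctured_ball_def hvectors_def sum_nonneg_eq_0_iff)
      moreover have "(\<Sum>i\<le>N. coord_product N i i z) = (\<Sum>i\<le>N. of_real ((cmod (z i))\<^sup>2)) / of_real (sq_norm {..N} z)"
        unfolding coord_product_def sum_divide_distrib[symmetric]
        by (simp only: complex_norm_square mult.commute)
      ultimately show ?case by (simp flip: of_real_sum of_real_power)
    qed
  qed simp
  also have "\<dots> = of_real (vol (projective_space N) (fubini_study N))" by (simp add: vol_eq scaleR_conv_of_real)
  finally have "(\<Sum>i\<le>N. LINT z|ball_measure N. coord_product N i i z) = of_real (vol (projective_space N) (fubini_study N))" .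
  moreover have "(\<Sum>i\<le>N. LINT z|ball_measure N. coord_product N i i z) = (\<Sum>i\<le>N. LINT z|ball_measure N. coord_product N j j z)"
    by (intro sum.cong refl diag) (use assms in auto)
  ultimately have "of_nat (Suc N) * (LINT z|ball_measure N. coord_product N j j z) = of_real (vol (projective_space N) (fubini_study N))"
    by simp
  then have "(LINT z|ball_measure N. coord_product N j j z) = of_real (vol (projective_space N) (fubini_study N)) / of_nat (Suc N)"
    by (metis nonzero_mult_div_cancel_left of_nat_eq_0_iff nat.distinct(2))
  then show ?thesis using off assms by (auto simp: add.commute)
qed

text \<open>\<open>hyperplane_metric\<close> evaluates at an arbitrary nonzero vector u z of the
  line; numerator and denominator both change by the factor |u|^2.\<close>

lemma hyperplane_metric_line:
  assumes z: "z \<in> hvectors N" and jk: "j \<le> N" "k \<le> N"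
  shows "hyperplane_metric N (coord_section N j (line N z)) (coord_section N k (line N z)) = coord_product N j k z"
proof -
  define z' where "z' = (SOME w. w \<in> line N z \<inter> hvectors N)"
  have "z \<in> line N z \<inter> hvectors N" using z mem_line_self[OF hvectorsD[OF z]] by simp
  then have z': "z' \<in> line N z \<inter> hvectors N"
    unfolding z'_def using someI[of "\<lambda>w. w \<in> line N z \<inter> hvectors N"] by blast
  then obtain u where u: "z' = hscale N u z" "u \<noteq> 0" using z by (auto simp: line_def)
  have S: "sq_norm {..N} z' = (cmod u)\<^sup>2 * sq_norm {..N} z"
    by (simp add: u norm_mult power_mult_distrib sum_distrib_left)
  have "hyperplane_metric N (coord_section N j (line N z)) (coord_section N k (line N z)) = coord_product N j k z'"
    using z z' IntD1[OF z'] unfolding hyperplane_metric_def coord_section_def coord_product_def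
    by (simp add: z'_def[symmetric] Let_def del: Int_iff)
  also have "\<dots> = coord_product N j k z"
  proof -
    have "cnj u * u = of_real ((cmod u)\<^sup>2)" by (simp only: complex_norm_square mult.commute)
    then have "cnj (z' j) * z' k = of_real ((cmod u)\<^sup>2) * (cnj (z j) * z k)" using u jk by (simp add: mult_ac)
    then show ?thesis unfolding coord_product_def S of_real_mult using u(2)
      by (simp add: mult_divide_mult_cancel_left)
  qed
  finally show ?thesis .
qed

lemma coord_sections_orthogonal:
  assumes "j \<le> N" "k \<le> N"
  defines "L \<equiv> liouville_measure (projective_space N) (fubini_study N)"
    and "f \<equiv> \<lambda>l. hyperplane_metric N (coord_section N j l) (coord_section N k l)"
  shows "integrable L f"
    and "integral\<^sup>L L f = (if j = k then of_real (vol (projective_space N) (fubini_study N) / (real N + 1)) else 0)"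
proof -
  have f_line: "f (line N z) = coord_product N j k z" if "z \<in> hvectors N" for z
    unfolding f_def by (rule hyperplane_metric_line[OF that assms(1,2)])
  \<comment> \<open>By the definition of the quotient topology, continuity of
    \<open>coord_product\<close> on the nonzero vectors makes the preimages of open sets under
    \<open>f\<close> open.\<close>
  have fm: "f \<in> borel_measurable (projective_borel N)"
  proof (rule borel_measurableI)
    fix U :: "complex set" assume U: "open U"
    have cont: "continuous_map (subtopology (Cn (Suc N)) (hvectors N)) euclidean (coord_product N j k)"
      unfolding coord_product_def[abs_def]
    proof (intro continuous_map_divide_normed continuous_map_mult_normed continuous_map_cnj)
      show "continuous_map (subtopology (Cn (Suc N)) (hvectors N)) euclidean (\<lambda>x. complex_of_real (sq_norm {..N} x))"
        using assms by (intro continuous_map_of_real continuous_map_sum continuous_map_real_pow continuous_map_norm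
          continuous_map_from_subtopology continuous_map_Cn_component) auto
      show "complex_of_real (sq_norm {..N} x) \<noteq> 0"
        if "x \<in> topspace (subtopology (Cn (Suc N)) (hvectors N))" for x
      proof -
        have "sq_norm {..N} x \<noteq> 0" using that by (auto simp: hvectors_def sum_nonneg_eq_0_iff)
        then show ?thesis by (simp only: of_real_eq_0_iff not_False_eq_True)
      qed
    qed (use assms in \<open>auto intro!: continuous_map_from_subtopology continuous_map_Cn_component\<close>)
    have "openin (subtopology (Cn (Suc N)) (hvectors N)) {z \<in> topspace (subtopology (Cn (Suc N)) (hvectors N)). coord_product N j k z \<in> U}"
      by (rule openin_continuous_map_preimage[OF cont]) (use U in simp)
    then have "openin (Cn (Suc N)) {z \<in> topspace (subtopology (Cn (Suc N)) (hvectors N)). coord_product N j k z \<in> U}"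
      by (simp add: openin_open_subtopology[OF openin_hvectors])
    also have "topspace (subtopology (Cn (Suc N)) (hvectors N)) = hvectors N"
      by (auto simp: hvectors_def lessThan_Suc_atMost)
    also have "{z \<in> hvectors N. coord_product N j k z \<in> U} = {z \<in> hvectors N. line N z \<in> f -` U \<inter> line N ` hvectors N}"
      using f_line by auto
    finally have "openin (projective_topology N) (f -` U \<inter> line N ` hvectors N)"
      by (simp add: openin_projective_topology)
    then show "f -` U \<inter> space (projective_borel N) \<in> sets (projective_borel N)"
      by (simp add: openin_projective_sets)
  qed
  have ae: "AE z in ball_measure N. f (total_line N z) = coord_product N j k z"
    using AE_ball_measure by eventually_elim (simp add: total_line_eq f_line punctured_ball_def)
  have m1: "(\<lambda>z. f (total_line N z)) \<in> borel_measurable (ball_measure N)"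
    by (rule measurable_compose[OF measurable_total_line_ball fm])
  have m2: "coord_product N j k \<in> borel_measurable (ball_measure N)"
    using integrable_coord_product[OF assms(1,2)] by simp
  show "integrable L f"
    unfolding L_def liouville_measure_projective_space integrable_distr_eq[OF measurable_total_line_ball fm]
    using integrable_cong_AE[OF m1 m2 ae] integrable_coord_product[OF assms(1,2)] by simp
  show "integral\<^sup>L L f = (if j = k then of_real (vol (projective_space N) (fubini_study N) / (real N + 1)) else 0)"
    unfolding L_def liouville_measure_projective_space integral_distr[OF measurable_total_line_ball fm]
    using integral_cong_AE[OF m1 m2 ae] integral_coord_product[OF assms(1,2)] by simp
qed

section \<open>Holomorphic sections of the hyperplane bundle\<close>

text \<open>By Liouville's theorem \<open>f\<close> is affine in each variable; the slope is a bounded entire function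
  of the remaining variables, hence constant.\<close>

lemma affine_if_linear_growth:
  fixes f :: "(nat \<Rightarrow> complex) \<Rightarrow> complex"
  assumes hol: "\<And>w j. w \<in> extensional {..<N} \<Longrightarrow> j < N \<Longrightarrow> (\<lambda>u. f (w(j := u))) holomorphic_on UNIV"
    and growth: "\<And>w m. w \<in> extensional {..<N} \<Longrightarrow> 1 \<le> m \<Longrightarrow> (\<And>i. i < N \<Longrightarrow> cmod (w i) \<le> m) \<Longrightarrow> cmod (f w) \<le> B * m"
  shows "\<exists>b. \<forall>w\<in>extensional {..<N}. f w = f (\<lambda>i\<in>{..<N}. 0) + (\<Sum>j<N. b j * w j)"
proof -
  have upd: "w(j := u) \<in> extensional {..<N}" if "w \<in> extensional {..<N}" "j < N" for w :: "nat \<Rightarrow> complex" and j u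
    using that by (auto simp: extensional_def)
  define \<beta> where "\<beta> j w = f (w(j := 1)) - f (w(j := 0))" for j w
  have growth1: "cmod (f (w(j := u))) \<le> B * cmod u"
    if w: "w \<in> extensional {..<N}" "j < N" and u: "1 + (\<Sum>i<N. cmod (w i)) \<le> cmod u" for w j u
  proof (rule growth[OF upd[OF w]])
    have s: "(\<Sum>i<N. cmod (w i)) \<ge> 0" by (intro sum_nonneg) auto
    show "1 \<le> cmod u" using s u by simp
    fix i assume "i < N"
    then have "cmod (w i) \<le> (\<Sum>i<N. cmod (w i))" by (intro member_le_sum) auto
    then show "cmod ((w(j := u)) i) \<le> cmod u" using u by auto
  qed
  have lin: "f (w(j := u)) = f (w(j := 0)) + u * \<beta> j w" if w: "w \<in> extensional {..<N}" "j < N" for w j u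
  proof -
    define d where "d k = (deriv ^^ k) (\<lambda>u. f (w(j := u))) 0 / fact k" for k
    have e: "f (w(j := u)) = d 0 + d 1 * u" for u
    proof -
      have "f (w(j := u)) = (\<Sum>k\<le>1. d k * u ^ k)"
        unfolding d_def
        by (rule Liouville_polynomial[OF hol[OF w], where A = "1 + (\<Sum>i<N. cmod (w i))" and B = B])
          (use growth1[OF w] in simp)
      then show ?thesis by simp
    qed
    show ?thesis unfolding \<beta>_def e by simp
  qed
  have \<beta>_bound: "cmod (\<beta> j w) \<le> B" if w: "w \<in> extensional {..<N}" "j < N" for w j
  proof (rule ccontr)
    assume "\<not> cmod (\<beta> j w) \<le> B"
    then have d: "cmod (\<beta> j w) - B > 0" by simp
    define C where "C = cmod (f (w(j := 0)))"
    \<comment> \<open>\<open>x\<close> lies in the range of \<open>growth1\<close> and exceeds C /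
      (|\<beta>| - B), beyond which the linear term outgrows the bound \<open>B * x\<close> even
      after subtracting the constant term.\<close>
    define x where "x = 1 + (\<Sum>i<N. cmod (w i)) + C / (cmod (\<beta> j w) - B)"
    have s: "(\<Sum>i<N. cmod (w i)) \<ge> 0" by (intro sum_nonneg) auto
    have C0: "C / (cmod (\<beta> j w) - B) \<ge> 0" using d by (auto simp: C_def)
    have x: "x > C / (cmod (\<beta> j w) - B)" "x > 0" using s C0 by (auto simp: x_def)
    have "1 + (\<Sum>i<N. cmod (w i)) \<le> x" using C0 by (simp add: x_def)
    then have "1 + (\<Sum>i<N. cmod (w i)) \<le> cmod (of_real x)" using x by simp
    from growth1[OF w this] have "cmod (f (w(j := 0)) + of_real x * \<beta> j w) \<le> B * x" using x lin[OF w, of "of_real x"] by simp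
    moreover have "cmod (of_real x * \<beta> j w) \<le> cmod (f (w(j := 0)) + of_real x * \<beta> j w) + C"
      using norm_triangle_ineq4[of "f (w(j := 0)) + of_real x * \<beta> j w" "f (w(j := 0))"] by (simp add: C_def)
    ultimately have "x * cmod (\<beta> j w) \<le> B * x + C" using x by (simp add: norm_mult)
    then have "x * (cmod (\<beta> j w) - B) \<le> C" by (simp add: algebra_simps)
    then have "x \<le> C / (cmod (\<beta> j w) - B)" using d by (simp add: pos_le_divide_eq)
    then show False using x by simp
  qed
  have \<beta>_const: "\<beta> j (w(i := 0)) = \<beta> j w" if w: "w \<in> extensional {..<N}" and j: "j < N" and i: "i < N" for w i j
  proof (cases "i = j")
    case True
    then show ?thesis by (simp add: \<beta>_def)
  next
    case False
    have "(\<lambda>u. \<beta> j (w(i := u))) holomorphic_on UNIV"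
      unfolding \<beta>_def using hol[OF upd[OF w j], OF i] False
      by (intro holomorphic_on_diff) (simp_all add: fun_upd_twist)
    moreover have "bounded (range (\<lambda>u. \<beta> j (w(i := u))))"
      unfolding bounded_iff using \<beta>_bound[OF upd[OF w i] j] by auto
    ultimately have "(\<lambda>u. \<beta> j (w(i := u))) constant_on UNIV" by (rule Liouville_theorem)
    then obtain c where c: "\<And>u. \<beta> j (w(i := u)) = c" unfolding constant_on_def by blast
    show ?thesis using c[of 0] c[of "w i"] by (simp only: fun_upd_triv)
  qed
  \<comment> \<open>\<open>Z n w\<close> replaces the first n coordinates by 0. Passing from
    \<open>w\<close> to the origin one coordinate at a time collects the linear terms.\<close>
  define Z where "Z n w i = (if i < n then 0 else w i)" for n and w :: "nat \<Rightarrow> complex" and i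
  have Z0: "Z 0 w = w" for w by (auto simp: Z_def fun_eq_iff)
  have ZS: "Z (Suc n) w = (Z n w)(n := 0)" for n w by (auto simp: Z_def fun_eq_iff)
  have Z_ext: "Z n w \<in> extensional {..<N}" if "w \<in> extensional {..<N}" "n \<le> N" for n w
    using that by (auto simp: Z_def extensional_def)
  have ZN: "Z N w = (\<lambda>i\<in>{..<N}. 0)" if "w \<in> extensional {..<N}" for w
    using that by (auto simp: Z_def extensional_def fun_eq_iff)
  define b where "b j = \<beta> j (\<lambda>i\<in>{..<N}. 0)" for j
  have \<beta>Z: "\<beta> j (Z n w) = \<beta> j w" if "w \<in> extensional {..<N}" "j < N" "n \<le> N" for j n w
    using that(3)
  proof (induction n)
    case (Suc n)
    then have "\<beta> j ((Z n w)(n := 0)) = \<beta> j w"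
      using \<beta>_const[OF Z_ext[OF that(1), of n] that(2), of n] by simp
    then show ?case unfolding ZS .
  qed (simp add: Z0)
  have \<beta>b: "\<beta> j w = b j" if "w \<in> extensional {..<N}" "j < N" for j w
    using \<beta>Z[OF that, of N] ZN[OF that(1)] by (simp add: b_def)
  have "f w = f (Z n w) + (\<Sum>j<n. b j * w j)"
    if w: "w \<in> extensional {..<N}" and n: "n \<le> N" for w n
    using n
  proof (induction n)
    case (Suc n)
    have "f (Z n w) = f ((Z n w)(n := w n))" by (rule arg_cong[where f = f]) (auto simp: Z_def fun_eq_iff)
    also have "\<dots> = f (Z (Suc n) w) + w n * b n"
      unfolding ZS using lin[OF Z_ext[OF w], of n n "w n"] \<beta>b[OF Z_ext[OF w], of n n] Suc(2) by simp
    finally show ?case using Suc by simp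
  qed (simp add: Z0)
  from this[OF _ order_refl] have "f w = f (\<lambda>i\<in>{..<N}. 0) + (\<Sum>j<N. b j * w j)"
    if "w \<in> extensional {..<N}" for w
    using that ZN[OF that] by metis
  then show ?thesis by blast
qed

section \<open>Linear forms as holomorphic sections\<close>

lemma insert_coord_fun_upd:
  assumes "i \<le> N" "j < N" "k \<le> N"
  shows "insert_coord N k a (w(j := u)) i = (if i = skip k j then u else insert_coord N k a w i)"
  using assms by (auto simp: insert_coord_def skip_def)

lemma triv_hyperplane_bundle:
  "triv (hyperplane_bundle N) = (\<lambda>k. (affine_domain N k, \<lambda>(l, \<xi>). \<xi> (affine_rep k l))) ` {..N}"
  by (simp add: hyperplane_bundle_def)

lemma fibre_hyperplane_bundle:
  "p \<in> fibre (hyperplane_bundle N) l \<longleftrightarrow> fst p = l \<and> l \<in> line N ` hvectors N \<and> snd p \<in> extensional l \<and>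
     (\<forall>z\<in>l. \<forall>w\<in>l. snd p (hadd N z w) = snd p z + snd p w) \<and>
     (\<forall>a. \<forall>z\<in>l. snd p (hscale N a z) = a * snd p z)"
  by (cases p) (auto simp: fibre_def hyperplane_bundle_def)

lemma affine_rep_insert_coord:
  assumes "k \<le> N" "l \<le> N" "insert_coord N l 1 w k \<noteq> 0"
  shows "affine_rep k (affine_point N l w) = hscale N (1 / insert_coord N l 1 w k) (insert_coord N l 1 w)"
  unfolding affine_point_def by (rule affine_rep_line) (use assms in auto)

lemma lincomb_coord_section:
  assumes "l \<in> line N ` hvectors N"
  shows "lincomb (hyperplane_bundle N) c (coord_section N) m l = (l, \<lambda>z\<in>l. \<Sum>j\<le>m. c j * z j)"
proof (induction m)
  case 0
  show ?case using assms by (auto simp: coord_section_def hyperplane_bundle_def)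
next
  case (Suc m)
  have "lincomb (hyperplane_bundle N) c (coord_section N) (Suc m) l =
     fadd (hyperplane_bundle N) (l, \<lambda>z\<in>l. \<Sum>j\<le>m. c j * z j) (fscale (hyperplane_bundle N) (c (Suc m)) (coord_section N (Suc m) l))"
    unfolding lincomb.simps Suc ..
  also have "\<dots> = (l, \<lambda>z\<in>l. \<Sum>j\<le>Suc m. c j * z j)"
    using assms by (auto simp: coord_section_def hyperplane_bundle_def)
  finally show ?case .
qed

lemma line_closed:
  assumes "z \<in> line N v" "w \<in> line N v"
  shows "hadd N z w \<in> line N v" "hscale N a z \<in> line N v"
proof -
  obtain b c where "z = hscale N b v" "w = hscale N c v" using assms by (auto simp: line_def)
  then have "hadd N z w = hscale N (b + c) v" "hscale N a z = hscale N (a * b) v"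
    by (auto simp: hadd_def hscale_def fun_eq_iff algebra_simps)
  then show "hadd N z w \<in> line N v" "hscale N a z \<in> line N v" by (auto simp: line_def)
qed

lemma linear_form_fibre:
  assumes "l \<in> line N ` hvectors N"
  shows "(l, \<lambda>z\<in>l. \<Sum>j\<le>N. c j * z j) \<in> fibre (hyperplane_bundle N) l"
proof -
  obtain v where v: "v \<in> hvectors N" "l = line N v" using assms by auto
  have add: "(\<Sum>j\<le>N. c j * hadd N z w j) = (\<Sum>j\<le>N. c j * z j) + (\<Sum>j\<le>N. c j * w j)" for z w
    unfolding sum.distrib[symmetric] by (intro sum.cong) (auto simp: hadd_def distrib_left)
  have scale: "(\<Sum>j\<le>N. c j * hscale N a z j) = a * (\<Sum>j\<le>N. c j * z j)" for a z
    unfolding sum_distrib_left by (intro sum.cong) (auto simp: hscale_def)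
  have closed: "hadd N z w \<in> l" "hscale N a z \<in> l" if "z \<in> l" "w \<in> l" for z w a
    using line_closed[of z N v w] that by (simp_all add: v)
  show ?thesis unfolding fibre_hyperplane_bundle using assms by (simp add: closed add scale del: hscale_apply)
qed

text \<open>Read in chart \<open>m\<close> and in the trivialisation by t_k, the section is the
  quotient of a linear form by the coordinate z_k, both evaluated at
  \<open>insert_coord N m 1 w\<close>. The denominator has no zero on the overlap of the two
  domains.\<close>

lemma linear_form_hol_section:
  "(\<lambda>l\<in>line N ` hvectors N. lincomb (hyperplane_bundle N) c (coord_section N) N l) \<in> hol_sections (projective_space N) (hyperplane_bundle N)"
    (is "?t \<in> _")
proof -
  have t: "?t l = (l, \<lambda>z\<in>l. \<Sum>j\<le>N. c j * z j)" if "l \<in> line N ` hvectors N" for l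
    using that by (simp only: restrict_apply' lincomb_coord_section)
  have "holomorphic_Cn N (snd (affine_chart N m) ` (affine_domain N m \<inter> affine_domain N k))
      (\<lambda>w. (case ?t (chart_inv (affine_chart N m) w) of (l, \<xi>) \<Rightarrow> \<xi> (affine_rep k l)))"
    if m: "m \<le> N" and k: "k \<le> N" for m k
  proof -
    define D where "D = snd (affine_chart N m) ` (affine_domain N m \<inter> affine_domain N k)"
    define q where "q = (\<lambda>w. case ?t (chart_inv (affine_chart N m) w) of (l, \<xi>) \<Rightarrow> \<xi> (affine_rep k l))"
    define g where "g w = (\<Sum>j\<le>N. c j * insert_coord N m 1 w j) / insert_coord N m 1 w k" for w
    have D: "D = {w \<in> extensional {..<N}. insert_coord N m 1 w k \<noteq> 0}"
      unfolding D_def affine_chart_image[OF m Int_lower1]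
      using m k by (auto simp: affine_point_def line_mem_affine_domain)
    have q: "q w = g w" if "w \<in> D" for w
    proof -
      have w: "w \<in> extensional {..<N}" "insert_coord N m 1 w k \<noteq> 0" using that by (auto simp: D)
      have P: "affine_point N m w \<in> line N ` hvectors N" using m by (simp add: affine_point_def)
      have mem: "hscale N (1 / insert_coord N m 1 w k) (insert_coord N m 1 w) \<in> affine_point N m w"
        by (simp add: affine_point_def line_def)
      have "q w = (\<Sum>j\<le>N. c j * hscale N (1 / insert_coord N m 1 w k) (insert_coord N m 1 w) j)"
        unfolding q_def chart_inv_affine_chart[OF m w(1)] t[OF P] prod.case affine_rep_insert_coord[OF k m w(2)]
        using mem by simp
      also have "\<dots> = g w" by (simp add: g_def sum_divide_distrib)
      finally show ?thesis .
    qed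
    have comp: "continuous_map (subtopology (Cn N) D) euclidean (\<lambda>w. insert_coord N m 1 w i)" if "i \<le> N" for i
      using continuous_map_compose[OF continuous_map_insert_coord[OF m]
          continuous_map_from_subtopology[OF continuous_map_Cn_component, of i "Suc N"]] that
      by (intro continuous_map_from_subtopology) (simp add: o_def)
    have "continuous_map (subtopology (Cn N) D) euclidean g"
      unfolding g_def[abs_def]
      by (intro continuous_map_divide_normed continuous_map_sum continuous_map_mult_normed comp)
        (use k in \<open>auto simp: D\<close>)
    then have 1: "continuous_map (subtopology (Cn N) D) euclidean q"
      by (rule continuous_map_eq) (use q in auto)
    have 2: "(\<lambda>u. q (w(j := u))) field_differentiable at (w j)" if w: "w \<in> D" and j: "j < N" for w j
    proof -
      \<comment> \<open>As functions of the affine coordinate \<open>j\<close> alone, the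
        homogeneous coordinates are either the variable itself or constant.\<close>
      define I where "I i u = (if i = skip m j then u else insert_coord N m 1 w i)" for i u
      have I: "insert_coord N m 1 (w(j := u)) i = I i u" if "i \<le> N" for i u
        using insert_coord_fun_upd[OF that j m] by (simp add: I_def)
      have Id: "(I i) field_differentiable at u" for i u
        by (cases "i = skip m j") (auto simp: I_def[abs_def] intro: derivative_intros)
      have Ic: "continuous_on UNIV (I k)"
        by (cases "k = skip m j") (auto simp: I_def[abs_def] intro: continuous_intros)
      have ne: "I k (w j) \<noteq> 0" using w I[OF k, of "w j"] by (simp add: D)
      have op: "open {u. I k u \<noteq> 0}"
        using Ic by (intro open_Collect_neq) (auto intro: continuous_intros)
      have "(\<lambda>u. (\<Sum>i\<le>N. c i * I i u) / I k u) field_differentiable at (w j)"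
        by (intro field_differentiable_divide field_differentiable_sum field_differentiable_mult field_differentiable_const Id ne)
      then obtain d where d: "((\<lambda>u. (\<Sum>i\<le>N. c i * I i u) / I k u) has_field_derivative d) (at (w j))"
        by (auto simp: field_differentiable_def)
      have "((\<lambda>u. q (w(j := u))) has_field_derivative d) (at (w j))"
      proof (rule has_field_derivative_transform_within_open[OF d op])
        show "w j \<in> {u. I k u \<noteq> 0}" using ne by simp
        fix u assume "u \<in> {u. I k u \<noteq> 0}"
        then have "w(j := u) \<in> D" using w j I[OF k] by (auto simp: D extensional_def)
        then have "q (w(j := u)) = g (w(j := u))" by (rule q)
        then show "(\<Sum>i\<le>N. c i * I i u) / I k u = q (w(j := u))"
          using I k by (simp add: g_def)
      qed
      then show ?thesis by (auto simp: field_differentiable_def)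
    qed
    show ?thesis using 1 2 unfolding holomorphic_Cn_def D_def[symmetric] q_def[symmetric] by blast
  qed
  then show ?thesis
    unfolding hol_sections_def holomorphic_fun_def triv_hyperplane_bundle
    using linear_form_fibre[of _ N c] t by (auto simp del: restrict_apply simp: split_beta)
qed

section \<open>Holomorphic sections as linear forms\<close>

context
  fixes N :: nat and t :: "(nat \<Rightarrow> complex) set \<Rightarrow> hyp" and F :: "(nat \<Rightarrow> complex) \<Rightarrow> complex"
  assumes t: "t \<in> hol_sections (projective_space N) (hyperplane_bundle N)"
  defines "F \<equiv> \<lambda>z. snd (t (line N z)) z"
begin

lemma section_fibre: "z \<in> hvectors N \<Longrightarrow> t (line N z) \<in> fibre (hyperplane_bundle N) (line N z)"
  using t by (auto simp: hol_sections_def)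

text \<open>\<open>F\<close> is the section seen as a function of homogeneous coordinates, and
  linearity on the fibres gives it degree one. This reduces the study of \<open>F\<close> to vectors
  with z_k = 1.\<close>

lemma section_homogeneous:
  assumes "z \<in> hvectors N" "a \<noteq> 0" shows "F (hscale N a z) = a * F z"
  using section_fibre[OF assms(1)] mem_line_self[OF hvectorsD[OF assms(1)]] assms
  unfolding F_def fibre_hyperplane_bundle by (simp add: line_hscale)

text \<open>If chart and trivialisation have the same index \<open>k\<close>, the local component of
  \<open>t\<close> is \<open>F\<close> on the affine slice z_k = 1, whose coordinates range over all
  of C^N.\<close>

lemma section_holomorphic:
  assumes k: "k \<le> N"
  shows "continuous_map (Cn N) euclidean (\<lambda>w. F (insert_coord N k 1 w))"
    and "w \<in> extensional {..<N} \<Longrightarrow> j < N \<Longrightarrow> (\<lambda>u. F (insert_coord N k 1 (w(j := u)))) holomorphic_on UNIV"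
proof -
  define q where "q = (\<lambda>w. (case t (chart_inv (affine_chart N k) w) of (l, \<xi>) \<Rightarrow> \<xi> (affine_rep k l)))"
  have q: "q w = F (insert_coord N k 1 w)" if w: "w \<in> extensional {..<N}" for w
  proof -
    have "fst (t (line N (insert_coord N k 1 w))) = line N (insert_coord N k 1 w)"
      using section_fibre[of "insert_coord N k 1 w"] k by (simp add: fibre_hyperplane_bundle)
    moreover have "affine_rep k (affine_point N k w) = insert_coord N k 1 w"
      using affine_rep_insert_coord[OF k k, of w] k by (simp add: hscale_1)
    ultimately show ?thesis
      by (simp add: q_def chart_inv_affine_chart[OF k w] F_def affine_point_def split_beta)
  qed
  have "holomorphic_fun (projective_space N) (affine_domain N k) (\<lambda>x. (case t x of (l, \<xi>) \<Rightarrow> \<xi> (affine_rep k l)))"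
    using t k by (auto simp: hol_sections_def triv_hyperplane_bundle)
  then have "holomorphic_Cn N (snd (affine_chart N k) ` (affine_domain N k \<inter> affine_domain N k)) q"
    using k unfolding holomorphic_fun_def q_def by (auto simp del: Int_absorb dest!: bspec[of _ _ k])
  moreover have "snd (affine_chart N k) ` affine_domain N k = extensional {..<N}"
    unfolding affine_chart_image[OF k order_refl] using k by auto
  ultimately have q_hol: "holomorphic_Cn N (extensional {..<N}) q" by simp
  have "continuous_map (subtopology (Cn N) (topspace (Cn N))) euclidean q"
    using q_hol by (simp add: holomorphic_Cn_def)
  then have "continuous_map (Cn N) euclidean q" by (simp only: subtopology_topspace)
  then show "continuous_map (Cn N) euclidean (\<lambda>w. F (insert_coord N k 1 w))"
    by (rule continuous_map_eq) (use q in auto)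
  assume w: "w \<in> extensional {..<N}" and j: "j < N"
  have upd: "w(j := u) \<in> extensional {..<N}" for u using w j by (auto simp: extensional_def)
  have "(\<lambda>u. q (w(j := u))) field_differentiable at v" for v
  proof -
    have "(\<lambda>u. q ((w(j := v))(j := u))) field_differentiable at ((w(j := v)) j)"
      using q_hol upd[of v] j unfolding holomorphic_Cn_def by blast
    then show ?thesis by simp
  qed
  then have "(\<lambda>u. F (insert_coord N k 1 (w(j := u)))) field_differentiable at v" for v
    by (simp only: q[OF upd])
  then show "(\<lambda>u. F (insert_coord N k 1 (w(j := u)))) holomorphic_on UNIV"
    by (simp add: holomorphic_on_def field_differentiable_at_within)
qed

lemma section_eq_chart:
  assumes "z \<in> hvectors N" "k \<le> N" "z k \<noteq> 0"
  shows "F z = z k * F (insert_coord N k 1 (\<lambda>i\<in>{..<N}. z (skip k i) / z k))"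
  using section_homogeneous[of "insert_coord N k 1 (\<lambda>i\<in>{..<N}. z (skip k i) / z k)" "z k"]
    eq_hscale_insert_coord[OF assms(2) hvectorsD[OF assms(1)] assms(3)] assms by simp

text \<open>Scaled so that a coordinate of largest modulus becomes 1, all vectors come from finitely
  many compact polydiscs, on which \<open>F\<close> is bounded. Homogeneity turns these bounds into
  linear growth.\<close>

lemma section_growth:
  "\<exists>B. \<forall>z\<in>hvectors N. \<forall>m. (\<forall>i\<le>N. cmod (z i) \<le> m) \<longrightarrow> cmod (F z) \<le> B * m"
proof -
  have "\<exists>B. \<forall>w\<in>polydisc N. cmod (F (insert_coord N k 1 w)) \<le> B" if "k \<le> N" for k
  proof -
    have "compactin euclidean ((\<lambda>w. F (insert_coord N k 1 w)) ` polydisc N)"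
      by (rule image_compactin[OF compactin_polydisc section_holomorphic(1)[OF that]])
    then have "bounded ((\<lambda>w. F (insert_coord N k 1 w)) ` polydisc N)" by (simp add: compact_imp_bounded)
    then show ?thesis by (auto simp: bounded_iff)
  qed
  then obtain B where B: "\<And>k w. k \<le> N \<Longrightarrow> w \<in> polydisc N \<Longrightarrow> cmod (F (insert_coord N k 1 w)) \<le> B k" by metis
  define C where "C = (\<Sum>k\<le>N. \<bar>B k\<bar>)"
  have BC: "B k \<le> C" if "k \<le> N" for k
    using member_le_sum[of k "{..N}" "\<lambda>k. \<bar>B k\<bar>"] that by (auto simp: C_def)
  have C0: "C \<ge> 0" unfolding C_def by (intro sum_nonneg) auto
  show ?thesis
  proof (intro exI[of _ C] ballI allI impI)
    fix z m assume z: "z \<in> hvectors N" and m: "\<forall>i\<le>N. cmod (z i) \<le> m"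
    have "line N z \<in> (\<Union>k\<le>N. max_set N k)" unfolding Un_max_set using z by simp
    then obtain k where k: "k \<le> N" "\<forall>j\<le>N. cmod (z j) \<le> cmod (z k)"
      using line_mem_max_set[OF z] by auto
    have zk: "z k \<noteq> 0"
    proof
      assume "z k = 0"
      then have "\<forall>j\<le>N. z j = 0" using k by simp
      then show False using z by (auto simp: hvectors_def)
    qed
    have "(\<lambda>i\<in>{..<N}. z (skip k i) / z k) \<in> polydisc N"
      by (rule quotient_mem_polydisc) (use k zk in auto)
    then have "cmod (F (insert_coord N k 1 (\<lambda>i\<in>{..<N}. z (skip k i) / z k))) \<le> C"
      using B[OF k(1)] BC[OF k(1)] by (meson order_trans)
    then have "cmod (F z) \<le> cmod (z k) * C"
      unfolding section_eq_chart[OF z k(1) zk] norm_mult by (intro mult_left_mono) auto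
    also have "\<dots> \<le> m * C" using m k C0 by (intro mult_right_mono) auto
    finally show "cmod (F z) \<le> C * m" by (simp add: mult.commute)
  qed
qed

text \<open>On the slice z_k = 1 the function \<open>F\<close> is holomorphic in each coordinate and
  grows at most linearly, so it is affine. Homogenising turns its constant term into the coefficient
  of z_k.\<close>

lemma section_linear_on_chart:
  assumes k: "k \<le> N"
  shows "\<exists>c. \<forall>z\<in>hvectors N. z k \<noteq> 0 \<longrightarrow> F z = (\<Sum>j\<le>N. c j * z j)"
proof -
  obtain B where B: "\<And>z m. z \<in> hvectors N \<Longrightarrow> (\<And>i. i \<le> N \<Longrightarrow> cmod (z i) \<le> m) \<Longrightarrow> cmod (F z) \<le> B * m"
    using section_growth by blast
  have "\<exists>b. \<forall>w\<in>extensional {..<N}. F (insert_coord N k 1 w) = F (insert_coord N k 1 (\<lambda>i\<in>{..<N}. 0)) + (\<Sum>j<N. b j * w j)"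
  proof (rule affine_if_linear_growth[where B = B])
    fix w :: "nat \<Rightarrow> complex" and m :: real
    assume w: "w \<in> extensional {..<N}" and m: "1 \<le> m" "\<And>i. i < N \<Longrightarrow> cmod (w i) \<le> m"
    show "cmod (F (insert_coord N k 1 w)) \<le> B * m"
      by (rule B) (use k m norm_insert_coord_le in auto)
  qed (rule section_holomorphic(2)[OF k])
  then obtain b where b: "\<And>w. w \<in> extensional {..<N} \<Longrightarrow> F (insert_coord N k 1 w) = F (insert_coord N k 1 (\<lambda>i\<in>{..<N}. 0)) + (\<Sum>j<N. b j * w j)"
    by blast
  define c where "c = insert_coord N k (F (insert_coord N k 1 (\<lambda>i\<in>{..<N}. 0))) b"
  show ?thesis
  proof (intro exI[of _ c] ballI impI)
    fix z assume z: "z \<in> hvectors N" "z k \<noteq> 0"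
    have "F z = z k * (c k + (\<Sum>j<N. b j * (z (skip k j) / z k)))"
      unfolding section_eq_chart[OF z(1) k z(2)] using k by (subst b) (simp_all add: c_def)
    also have "\<dots> = c k * z k + (\<Sum>j<N. c (skip k j) * z (skip k j))"
      using z(2) by (simp add: distrib_left sum_distrib_left c_def mult.commute)
    also have "\<dots> = (\<Sum>j\<le>N. c j * z j)" by (rule sum_insert_skip[OF k, symmetric])
    finally show "F z = (\<Sum>j\<le>N. c j * z j)" .
  qed
qed

text \<open>The linear forms found on the charts \<open>0\<close> and \<open>k\<close> agree at \<open>z + e\<^sub>0\<close> and \<open>z + 2 e\<^sub>0\<close>, hence at \<open>z\<close>.\<close>

lemma section_linear: "\<exists>c. \<forall>z\<in>hvectors N. F z = (\<Sum>j\<le>N. c j * z j)"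
proof -
  obtain c where c: "\<And>z. z \<in> hvectors N \<Longrightarrow> z 0 \<noteq> 0 \<Longrightarrow> F z = (\<Sum>j\<le>N. c j * z j)"
    using section_linear_on_chart[of 0] by auto
  have "F z = (\<Sum>j\<le>N. c j * z j)" if z: "z \<in> hvectors N" for z
  proof (cases "z 0 = 0")
    case False
    then show ?thesis by (rule c[OF z])
  next
    case True
    obtain k where k: "k \<le> N" "z k \<noteq> 0" using z by (auto simp: hvectors_def)
    obtain d where d: "\<And>z. z \<in> hvectors N \<Longrightarrow> z k \<noteq> 0 \<Longrightarrow> F z = (\<Sum>j\<le>N. d j * z j)"
      using section_linear_on_chart[OF k(1)] by auto
    have k0: "k \<noteq> 0" using True k(2) by (intro notI) simp
    have split: "(\<Sum>j\<le>N. e j * (z(0 := a)) j) = (\<Sum>j\<le>N. e j * z j) + e 0 * a" for a and e :: "nat \<Rightarrow> complex"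
      using True sum.remove[of "{..N}" 0 "\<lambda>j. e j * (z(0 := a)) j"] sum.remove[of "{..N}" 0 "\<lambda>j. e j * z j"] by simp
    have h: "z(0 := a) \<in> hvectors N" if "a \<noteq> 0" for a
      using z that by (auto simp: hvectors_def extensional_def intro!: exI[of _ 0])
    have "(\<Sum>j\<le>N. d j * z j) + d 0 * a = (\<Sum>j\<le>N. c j * z j) + c 0 * a" if "a \<noteq> 0" for a
      using d[OF h[OF that]] c[OF h[OF that]] k k0 that unfolding split by simp
    from this[of 1] this[of 2] have "(\<Sum>j\<le>N. d j * z j) = (\<Sum>j\<le>N. c j * z j)" by simp algebra
    then show ?thesis using d[OF z k(2)] by simp
  qed
  then show ?thesis by blast
qed

end

text \<open>A functional on a line is fixed by its value at one nonzero vector, so linearity of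
  \<open>F\<close> determines the section. This is the description of sections that
  \<open>orthogonal_sections\<close> requires.\<close>

lemma hol_section_hyperplane_bundle_iff:
  "t \<in> hol_sections (projective_space N) (hyperplane_bundle N) \<longleftrightarrow>
    (\<exists>c. t = (\<lambda>l\<in>line N ` hvectors N. lincomb (hyperplane_bundle N) c (coord_section N) N l))"
proof
  assume t: "t \<in> hol_sections (projective_space N) (hyperplane_bundle N)"
  obtain c where c: "\<And>z. z \<in> hvectors N \<Longrightarrow> snd (t (line N z)) z = (\<Sum>j\<le>N. c j * z j)"
    using section_linear[OF t] by blast
  have "t = (\<lambda>l\<in>line N ` hvectors N. lincomb (hyperplane_bundle N) c (coord_section N) N l)"
  proof (rule extensionalityI[of _ "line N ` hvectors N"])
    show "t \<in> extensional (line N ` hvectors N)" using t by (simp add: hol_sections_def)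
    fix l assume l: "l \<in> line N ` hvectors N"
    then obtain v where v: "v \<in> hvectors N" "l = line N v" by auto
    have fib: "fst (t l) = l" "snd (t l) \<in> extensional l" "\<And>a z. z \<in> l \<Longrightarrow> snd (t l) (hscale N a z) = a * snd (t l) z"
      using section_fibre[OF t v(1)] by (auto simp: fibre_hyperplane_bundle v)
    have "snd (t l) = (\<lambda>z\<in>l. \<Sum>j\<le>N. c j * z j)"
    proof (rule extensionalityI[OF fib(2)])
      fix z assume z: "z \<in> l"
      then obtain a where a: "z = hscale N a v" by (auto simp: v line_def)
      have "v \<in> l" using mem_line_self[OF hvectorsD[OF v(1)]] by (simp add: v)
      then have "snd (t l) z = a * (\<Sum>j\<le>N. c j * v j)" using fib(3)[of v a] c[OF v(1)] by (simp add: a v)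
      also have "\<dots> = (\<Sum>j\<le>N. c j * z j)" by (simp add: a sum_distrib_left mult_ac)
      finally show "snd (t l) z = (\<lambda>z\<in>l. \<Sum>j\<le>N. c j * z j) z" using z by simp
    qed simp
    then show "t l = (\<lambda>l\<in>line N ` hvectors N. lincomb (hyperplane_bundle N) c (coord_section N) N l) l"
      using l fib(1) by (simp add: lincomb_coord_section prod_eq_iff)
  qed simp
  then show "\<exists>c. t = (\<lambda>l\<in>line N ` hvectors N. lincomb (hyperplane_bundle N) c (coord_section N) N l)" by blast
qed (use linear_form_hol_section in auto)

section \<open>Coherent vectors in an orthogonal basis of sections\<close>

text \<open>Abstracts from what a trivialisation does on a single fibre. On P^N the evaluation at a
  vector of the line takes its place, with no chart involved.\<close>

definition fibre_coordinate :: "('a, 'l) line_bundle \<Rightarrow> 'a \<Rightarrow> ('l \<Rightarrow> complex) \<Rightarrow> bool" where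
  "fibre_coordinate L x \<theta> \<longleftrightarrow> bij_betw \<theta> (fibre L x) UNIV \<and>
     (\<forall>p\<in>fibre L x. \<forall>q\<in>fibre L x. fadd L p q \<in> fibre L x \<and> \<theta> (fadd L p q) = \<theta> p + \<theta> q) \<and>
     (\<forall>a. \<forall>q\<in>fibre L x. fscale L a q \<in> fibre L x \<and> \<theta> (fscale L a q) = a * \<theta> q)"

lemma fibre_coordinateD:
  assumes "fibre_coordinate L x \<theta>" "p \<in> fibre L x" "q \<in> fibre L x"
  shows "fadd L p q \<in> fibre L x" "\<theta> (fadd L p q) = \<theta> p + \<theta> q"
    "fscale L a p \<in> fibre L x" "\<theta> (fscale L a p) = a * \<theta> p" "\<theta> p = \<theta> q \<longleftrightarrow> p = q"
proof -
  show "\<theta> p = \<theta> q \<longleftrightarrow> p = q"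
    using assms inj_on_eq_iff[of \<theta> "fibre L x" p q] by (simp add: fibre_coordinate_def bij_betw_def)
qed (use assms in \<open>auto simp: fibre_coordinate_def\<close>)

lemma fibre_coordinate_nonzero:
  assumes "fibre_coordinate L x \<theta>" "q \<in> fibre L x"
  shows "q \<in> nonzero L \<longleftrightarrow> \<theta> q \<noteq> 0"
proof -
  have "fscale L 0 q = q \<longleftrightarrow> \<theta> (fscale L 0 q) = \<theta> q"
    using fibre_coordinateD[OF assms(1) fibre_coordinateD(3)[OF assms assms(2)] assms(2)] by auto
  also have "\<dots> \<longleftrightarrow> \<theta> q = 0" using fibre_coordinateD(4)[OF assms assms(2)] by auto
  finally show ?thesis using assms(2) by (auto simp: nonzero_def fibre_def)
qed

lemma fibre_coordinate_lincomb:
  assumes \<theta>: "fibre_coordinate L x \<theta>" and s: "\<And>j. j \<le> m \<Longrightarrow> s j x \<in> fibre L x"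
  shows "lincomb L c s m x \<in> fibre L x \<and> \<theta> (lincomb L c s m x) = (\<Sum>j\<le>m. c j * \<theta> (s j x))"
  using s
proof (induction m)
  case 0
  then show ?case using fibre_coordinateD(3,4)[OF \<theta>] by auto
next
  case (Suc m)
  have *: "lincomb L c s m x \<in> fibre L x \<and> \<theta> (lincomb L c s m x) = (\<Sum>j\<le>m. c j * \<theta> (s j x))"
    using Suc by auto
  have **: "fscale L (c (Suc m)) (s (Suc m) x) \<in> fibre L x"
    "\<theta> (fscale L (c (Suc m)) (s (Suc m) x)) = c (Suc m) * \<theta> (s (Suc m) x)"
    using fibre_coordinateD(3,4)[OF \<theta>] Suc(2)[of "Suc m"] by auto
  show ?case using fibre_coordinateD(1,2)[OF \<theta> conjunct1[OF *] **(1)] * ** by simp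
qed

lemma qhat_eqI:
  assumes "fibre_coordinate L x \<theta>" "q \<in> fibre L x" "q \<in> nonzero L" "f x = fscale L a q"
  shows "qhat L q f = a"
proof -
  have "\<theta> q \<noteq> 0" using assms fibre_coordinate_nonzero by metis
  moreover have "proj L q = x" using assms(2) by (simp add: fibre_def)
  ultimately show ?thesis unfolding qhat_def
    using assms(4) fibre_coordinateD(4)[OF assms(1,2,2)] by (intro the_equality) (auto, metis mult_right_cancel)
qed

lemma qhat_fibre_coordinate:
  assumes "fibre_coordinate L x \<theta>" "q \<in> fibre L x" "q \<in> nonzero L" "f x \<in> fibre L x"
  shows "f x = fscale L (qhat L q f) q" "qhat L q f = \<theta> (f x) / \<theta> q"
proof -
  have q: "\<theta> q \<noteq> 0" using assms fibre_coordinate_nonzero by metis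
  have "\<theta> (fscale L (\<theta> (f x) / \<theta> q) q) = \<theta> (f x)"
    using fibre_coordinateD(4)[OF assms(1,2,2)] q by simp
  then have *: "f x = fscale L (\<theta> (f x) / \<theta> q) q"
    using fibre_coordinateD(5)[OF assms(1) fibre_coordinateD(3)[OF assms(1,2,2)] assms(4)] by simp
  show "qhat L q f = \<theta> (f x) / \<theta> q" by (rule qhat_eqI[where f = f, OF assms(1-3) *])
  then show "f x = fscale L (qhat L q f) q" using * by simp
qed

definition sesquilinear_on_fibre :: "('a, 'l) line_bundle \<Rightarrow> ('l \<Rightarrow> 'l \<Rightarrow> complex) \<Rightarrow> 'a \<Rightarrow> bool" where
  "sesquilinear_on_fibre L h x \<longleftrightarrow> (\<forall>p\<in>fibre L x. \<forall>q\<in>fibre L x.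
     h q p = cnj (h p q) \<and> (\<forall>a. h p (fscale L a q) = a * h p q))"

text \<open>On a one-dimensional fibre, \<open>h\<close> is determined by its value at one vector;
  conjugate linearity in the first argument comes from hermitian symmetry.\<close>

lemma sesquilinear_on_fibre_eq:
  assumes h: "sesquilinear_on_fibre L h x" and \<theta>: "fibre_coordinate L x \<theta>"
    and p: "p \<in> fibre L x" and q: "q \<in> fibre L x" and e: "e \<in> fibre L x" "\<theta> e = 1"
  shows "h p q = cnj (\<theta> p) * \<theta> q * h e e"
proof -
  have rep: "r = fscale L (\<theta> r) e" if "r \<in> fibre L x" for r
    using fibre_coordinateD(5)[OF \<theta> that fibre_coordinateD(3)[OF \<theta> e(1,1), of "\<theta> r"]]
      fibre_coordinateD(4)[OF \<theta> e(1,1), of "\<theta> r"] e(2) by simp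
  have lin: "h r (fscale L a r') = a * h r r'" "h r' r = cnj (h r r')" if "r \<in> fibre L x" "r' \<in> fibre L x" for r r' a
    using h that unfolding sesquilinear_on_fibre_def by blast+
  have "h p q = \<theta> q * h p e" by (subst rep[OF q]) (rule lin(1)[OF p e(1)])
  also have "h p e = cnj (h e p)" by (rule lin(2)[OF e(1) p])
  also have "h e p = \<theta> p * h e e" by (subst rep[OF p]) (rule lin(1)[OF e(1) e(1)])
  also have "cnj (\<theta> p * h e e) = cnj (\<theta> p) * h e e" using arg_cong[OF lin(2)[OF e(1) e(1)], of cnj] by simp
  finally show ?thesis by simp
qed

lemma sesquilinear_on_fibre_lincomb:
  assumes h: "sesquilinear_on_fibre L h x" and \<theta>: "fibre_coordinate L x \<theta>"
    and s: "\<And>j. j \<le> m \<Longrightarrow> s j x \<in> fibre L x"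
  shows "h (lincomb L c s m x) (lincomb L d s m x) = (\<Sum>j\<le>m. \<Sum>k\<le>m. cnj (c j) * d k * h (s j x) (s k x))"
proof -
  obtain e where e: "e \<in> fibre L x" "\<theta> e = 1"
    using \<theta> unfolding fibre_coordinate_def bij_betw_def by (metis UNIV_I imageE)
  note eq = sesquilinear_on_fibre_eq[OF h \<theta> _ _ e]
  have l: "lincomb L c s m x \<in> fibre L x" "\<theta> (lincomb L c s m x) = (\<Sum>j\<le>m. c j * \<theta> (s j x))" for c
    using fibre_coordinate_lincomb[where m = m and s = s, OF \<theta> s] by auto
  have "h (lincomb L c s m x) (lincomb L d s m x) =
    (\<Sum>j\<le>m. \<Sum>k\<le>m. (cnj (c j) * cnj (\<theta> (s j x))) * (d k * \<theta> (s k x))) * h e e"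
    unfolding eq[OF l(1) l(1)] l(2) by (simp add: sum_product)
  also have "\<dots> = (\<Sum>j\<le>m. \<Sum>k\<le>m. cnj (c j) * d k * h (s j x) (s k x))"
    unfolding sum_distrib_right using s by (intro sum.cong refl) (simp add: eq)
  finally show ?thesis .
qed

lemma space_liouville_measure: "space (liouville_measure M \<omega>) = mpoints M"
  and sets_liouville_measure: "sets (liouville_measure M \<omega>) = sigma_sets (mpoints M) {U. openin (mtop M) U}"
proof -
  have *: "{U. openin (mtop M) U} \<subseteq> Pow (mpoints M)" using openin_subset by auto
  show "space (liouville_measure M \<omega>) = mpoints M"
    unfolding liouville_measure_def by (simp add: Let_def split_beta space_measure_of[OF *])
  show "sets (liouville_measure M \<omega>) = sigma_sets (mpoints M) {U. openin (mtop M) U}"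
    unfolding liouville_measure_def by (simp add: Let_def split_beta sets_measure_of[OF *])
qed

text \<open>The common ground of M with the basis s (\<open>v = 1\<close>) and P^N with the
  coordinate sections (\<open>v\<close> = vol / (N + 1)): each side of the theorem is
  \<open>coherent_product_eq\<close> for one of them. Uniqueness of the coefficients up to
  \<open>N\<close> is a consequence of \<open>orthogonal\<close> and
  \<open>v_nonzero\<close>.\<close>

locale orthogonal_sections =
  fixes M :: "'a cmanifold" and \<omega> :: "'a form11" and L :: "('a, 'l) line_bundle"
    and h :: "'l \<Rightarrow> 'l \<Rightarrow> complex" and N :: nat and s :: "nat \<Rightarrow> 'a \<Rightarrow> 'l" and v :: real
  assumes fibre_coordinate: "x \<in> mpoints M \<Longrightarrow> \<exists>\<theta>. fibre_coordinate L x \<theta>"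
    and sesquilinear: "x \<in> mpoints M \<Longrightarrow> sesquilinear_on_fibre L h x"
    and s_fibre: "j \<le> N \<Longrightarrow> x \<in> mpoints M \<Longrightarrow> s j x \<in> fibre L x"
    and hol_sections_iff: "f \<in> hol_sections M L \<longleftrightarrow> (\<exists>c. f = (\<lambda>x\<in>mpoints M. lincomb L c s N x))"
    and integrable: "j \<le> N \<Longrightarrow> k \<le> N \<Longrightarrow> integrable (liouville_measure M \<omega>) (\<lambda>x. h (s j x) (s k x))"
    and orthogonal: "j \<le> N \<Longrightarrow> k \<le> N \<Longrightarrow> scalar_product M \<omega> h (s j) (s k) = (if j = k then of_real v else 0)"
    and v_nonzero: "v \<noteq> 0"
begin

abbreviation combination :: "(nat \<Rightarrow> complex) \<Rightarrow> 'a \<Rightarrow> 'l" where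
  "combination c \<equiv> (\<lambda>x\<in>mpoints M. lincomb L c s N x)"

lemma scalar_product_combination:
  "scalar_product M \<omega> h (combination c) (combination d) = of_real v * (\<Sum>j\<le>N. cnj (c j) * d j)"
proof -
  have "scalar_product M \<omega> h (combination c) (combination d) =
     (LINT x|liouville_measure M \<omega>. (\<Sum>j\<le>N. \<Sum>k\<le>N. cnj (c j) * d k * h (s j x) (s k x)))"
    unfolding scalar_product_def
  proof (rule Bochner_Integration.integral_cong[OF refl])
    fix x assume "x \<in> space (liouville_measure M \<omega>)"
    then have x: "x \<in> mpoints M" by (simp add: space_liouville_measure)
    obtain \<theta> where "fibre_coordinate L x \<theta>" using fibre_coordinate[OF x] by blast
    then show "h (combination c x) (combination d x) = (\<Sum>j\<le>N. \<Sum>k\<le>N. cnj (c j) * d k * h (s j x) (s k x))"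
      using sesquilinear_on_fibre_lincomb[where s = s and m = N, OF sesquilinear[OF x]] s_fibre x by simp
  qed
  also have "\<dots> = (\<Sum>j\<le>N. \<Sum>k\<le>N. cnj (c j) * d k * scalar_product M \<omega> h (s j) (s k))"
    unfolding scalar_product_def
    by (subst Bochner_Integration.integral_sum; (intro Bochner_Integration.integrable_sum integrable_mult_right integrable)?)
      (auto intro!: sum.cong simp: Bochner_Integration.integral_sum integrable)
  also have "\<dots> = (\<Sum>j\<le>N. \<Sum>k\<le>N. if j = k then cnj (c j) * d k * of_real v else 0)"
    by (intro sum.cong refl) (simp add: orthogonal)
  also have "\<dots> = of_real v * (\<Sum>j\<le>N. cnj (c j) * d j)"
    by (simp add: sum_distrib_left mult_ac)
  finally show ?thesis .
qed

lemma qhat_combination: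
  assumes x: "x \<in> mpoints M" and q: "q \<in> fibre L x" "q \<in> nonzero L"
  shows "qhat L q (combination c) = (\<Sum>j\<le>N. c j * qhat L q (s j))"
proof -
  obtain \<theta> where \<theta>: "fibre_coordinate L x \<theta>" using fibre_coordinate[OF x] by blast
  have l: "lincomb L c s N x \<in> fibre L x" "\<theta> (lincomb L c s N x) = (\<Sum>j\<le>N. c j * \<theta> (s j x))"
    using fibre_coordinate_lincomb[where m = N and s = s, OF \<theta>] s_fibre x by auto
  have "qhat L q (combination c) = \<theta> (lincomb L c s N x) / \<theta> q"
    using qhat_fibre_coordinate(2)[OF \<theta> q, of "combination c"] l x by simp
  also have "\<dots> = (\<Sum>j\<le>N. c j * (\<theta> (s j x) / \<theta> q))" by (simp add: l sum_divide_distrib)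
  also have "\<dots> = (\<Sum>j\<le>N. c j * qhat L q (s j))"
    by (intro sum.cong refl) (simp add: qhat_fibre_coordinate(2)[OF \<theta> q] s_fibre x)
  finally show ?thesis .
qed

lemma lincomb_cong: "(\<And>j. j \<le> m \<Longrightarrow> c j = d j) \<Longrightarrow> lincomb L c s m x = lincomb L d s m x"
  by (induction m) auto

text \<open>The scalar product is conjugate linear in its first argument, so testing a section with
  coefficients c against s_k gives v conj(c_k), which has to equal \<open>qhat L q (s k)\<close>.
  These equations have exactly one solution, as \<open>v\<close> is nonzero.\<close>

lemma coherent_vector_eq:
  assumes x: "x \<in> mpoints M" and q: "q \<in> fibre L x" "q \<in> nonzero L"
  shows "coherent_vector M \<omega> L h q = combination (\<lambda>j. cnj (qhat L q (s j)) / of_real v)"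
  unfolding coherent_vector_def
proof (rule the_equality)
  let ?e = "combination (\<lambda>j. cnj (qhat L q (s j)) / of_real v)"
  show "?e \<in> hol_sections M L \<and> (\<forall>f\<in>hol_sections M L. scalar_product M \<omega> h ?e f = qhat L q f)"
  proof (intro conjI ballI)
    show "?e \<in> hol_sections M L" using hol_sections_iff by blast
    fix f assume "f \<in> hol_sections M L"
    then obtain d where f: "f = combination d" using hol_sections_iff by blast
    show "scalar_product M \<omega> h ?e f = qhat L q f"
      unfolding f scalar_product_combination qhat_combination[OF x q] sum_distrib_left
      using v_nonzero by (intro sum.cong refl) simp
  qed
next
  fix e assume e: "e \<in> hol_sections M L \<and> (\<forall>f\<in>hol_sections M L. scalar_product M \<omega> h e f = qhat L q f)"
  then obtain c where c: "e = combination c" using hol_sections_iff by blast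
  have "c k = cnj (qhat L q (s k)) / of_real v" if k: "k \<le> N" for k
  proof -
    let ?\<delta> = "\<lambda>j. if j = k then 1 else 0 :: complex"
    have pick: "(\<Sum>j\<le>N. F j * ?\<delta> j) = F k" "(\<Sum>j\<le>N. ?\<delta> j * F j) = F k" for F
      using k by (simp_all add: if_distrib[of "\<lambda>x. _ * x"] if_distrib[of "\<lambda>x. x * _"] cong: if_cong)
    have "combination ?\<delta> \<in> hol_sections M L" using hol_sections_iff by blast
    then have "scalar_product M \<omega> h e (combination ?\<delta>) = qhat L q (combination ?\<delta>)" using e by blast
    then have "of_real v * cnj (c k) = qhat L q (s k)"
      unfolding c scalar_product_combination qhat_combination[OF x q] pick .
    then have "cnj (qhat L q (s k)) = of_real v * c k" by (metis complex_cnj_cnj complex_cnj_complex_of_real complex_cnj_mult)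
    then show ?thesis using v_nonzero by simp
  qed
  then show "e = combination (\<lambda>j. cnj (qhat L q (s j)) / of_real v)"
    unfolding c by (intro restrict_ext lincomb_cong)
qed

text \<open>The factor 1 / v occurs in both coherent vectors and the scalar product contributes one
  v, so a single 1 / v remains. The factor belonging to x is conjugated twice, the one belonging to
  y once.\<close>

lemma coherent_product_eq:
  assumes "x \<in> mpoints M" "t x \<in> fibre L x" "t x \<in> nonzero L"
    and "y \<in> mpoints M" "t y \<in> fibre L y" "t y \<in> nonzero L"
  shows "coherent_product M \<omega> L h t x y = (\<Sum>j\<le>N. qhat L (t x) (s j) * cnj (qhat L (t y) (s j))) / of_real v"
  unfolding coherent_product_def coherent_vector_eq[OF assms(1-3)] coherent_vector_eq[OF assms(4-6)]
    scalar_product_combination sum_distrib_left sum_divide_distrib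
  using v_nonzero by (intro sum.cong refl) simp

end

section \<open>Sections over a quantizable manifold and over projective space\<close>

text \<open>Differentiability at z_j involves values nearby; equality on \<open>D\<close> carries
  over because the slice of the open set \<open>D\<close> through z is open.\<close>

lemma holomorphic_Cn_cong:
  assumes f: "holomorphic_Cn n D f" and D: "openin (Cn n) D" and eq: "\<And>z. z \<in> D \<Longrightarrow> f z = g z"
  shows "holomorphic_Cn n D g"
  unfolding holomorphic_Cn_def
proof (intro conjI ballI allI impI)
  have DD: "D \<subseteq> extensional {..<n}" using openin_subset[OF D] by simp
  show "continuous_map (subtopology (Cn n) D) euclidean g"
    using f eq by (auto simp: holomorphic_Cn_def intro: continuous_map_eq)
  fix z j assume z: "z \<in> D" and j: "j < n"
  have zext: "z \<in> extensional {..<n}" using z DD by auto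
  have "continuous_map euclidean (Cn n) (\<lambda>u. z(j := u))"
  proof (rule continuous_map_into_Cn)
    fix i show "continuous_map euclidean euclidean (\<lambda>u. (z(j := u)) i)" by (cases "i = j") auto
  qed (use zext j in \<open>auto simp: extensional_def\<close>)
  from openin_continuous_map_preimage[OF this D]
  have op: "open {u. z(j := u) \<in> D}" by simp
  obtain d where "((\<lambda>u. f (z(j := u))) has_field_derivative d) (at (z j))"
    using f z j by (auto simp: holomorphic_Cn_def field_differentiable_def)
  then have "((\<lambda>u. g (z(j := u))) has_field_derivative d) (at (z j))"
    by (rule has_field_derivative_transform_within_open[OF _ op]) (use z eq in auto)
  then show "(\<lambda>u. g (z(j := u))) field_differentiable at (z j)" by (auto simp: field_differentiable_def)
qed

section \<open>Linear combinations of holomorphic sections\<close>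

lemma holomorphic_Cn_sum:
  assumes "\<And>i. i \<in> I \<Longrightarrow> holomorphic_Cn n D (f i)"
  shows "holomorphic_Cn n D (\<lambda>z. \<Sum>i\<in>I. c i * f i z)"
  unfolding holomorphic_Cn_def
proof (intro conjI ballI allI impI)
  show "continuous_map (subtopology (Cn n) D) euclidean (\<lambda>z. \<Sum>i\<in>I. c i * f i z)"
  proof (cases "finite I")
    case True
    then show ?thesis using assms
      by (intro continuous_map_sum continuous_map_mult_normed) (auto simp: holomorphic_Cn_def)
  qed auto
  fix z j assume "z \<in> D" "j < n"
  then show "(\<lambda>u. \<Sum>i\<in>I. c i * f i (z(j := u))) field_differentiable at (z j)"
    using assms by (intro field_differentiable_sum field_differentiable_mult field_differentiable_const) (auto simp: holomorphic_Cn_def)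
qed

lemma openin_chart_image:
  assumes M: "complex_manifold M" and c: "c \<in> atlas M" and W: "openin (mtop M) W"
  shows "openin (Cn (mdim M)) (snd c ` (fst c \<inter> W))"
proof -
  have hm: "homeomorphic_map (subtopology (mtop M) (fst c)) (subtopology (Cn (mdim M)) (snd c ` fst c)) (snd c)"
    and op: "openin (mtop M) (fst c)" "openin (Cn (mdim M)) (snd c ` fst c)"
    using M c by (auto simp: complex_manifold_def)
  have "openin (subtopology (mtop M) (fst c)) (fst c \<inter> W)"
    using W by (simp add: openin_subtopology_Int2)
  then have "openin (subtopology (Cn (mdim M)) (snd c ` fst c)) (snd c ` (fst c \<inter> W))"
    using homeomorphic_imp_open_map[OF hm] by (simp add: open_map_def)
  then show ?thesis using op(2) by (simp add: openin_open_subtopology)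
qed

lemma chart_inv_chart:
  assumes "complex_manifold M" "c \<in> atlas M" "x \<in> fst c"
  shows "chart_inv c (snd c x) = x"
proof -
  have op: "openin (mtop M) (fst c)" and
    hm: "homeomorphic_map (subtopology (mtop M) (fst c)) (subtopology (Cn (mdim M)) (snd c ` fst c)) (snd c)"
    using assms(1,2) by (auto simp: complex_manifold_def)
  have "topspace (subtopology (mtop M) (fst c)) = fst c"
    using openin_subset[OF op] by auto
  then have "inj_on (snd c) (fst c)" using homeomorphic_imp_injective_map[OF hm] by simp
  then show ?thesis using assms(3) by (simp add: chart_inv_def)
qed

lemma holomorphic_line_bundle_coordinate:
  assumes "holomorphic_line_bundle M L" "\<tau> \<in> triv L" "x \<in> fst \<tau>"
  shows "fibre_coordinate L x (snd \<tau>)"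
  using assms unfolding holomorphic_line_bundle_def fibre_coordinate_def by blast

text \<open>One half of the locale assumption \<open>hol_sections_iff\<close>:
  \<open>section_basis\<close> makes every section a combination, and conversely every combination
  is holomorphic, because its local components are combinations of holomorphic functions.\<close>

lemma hol_sections_lincomb:
  assumes M: "complex_manifold M" and L: "holomorphic_line_bundle M L"
    and s: "\<And>j. j \<le> N \<Longrightarrow> s j \<in> hol_sections M L"
  shows "(\<lambda>x\<in>mpoints M. lincomb L c s N x) \<in> hol_sections M L"
proof -
  let ?f = "\<lambda>x\<in>mpoints M. lincomb L c s N x"
  have sf: "s j x \<in> fibre L x" if "j \<le> N" "x \<in> mpoints M" for j x
    using s[OF that(1)] that(2) by (simp add: hol_sections_def)
  have tx: "fst \<tau> \<subseteq> mpoints M" "openin (mtop M) (fst \<tau>)" if "\<tau> \<in> triv L" for \<tau>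
    using L that unfolding holomorphic_line_bundle_def by auto
  have "?f x \<in> fibre L x" if x: "x \<in> mpoints M" for x
  proof -
    obtain \<tau> where "\<tau> \<in> triv L" "x \<in> fst \<tau>" using L x unfolding holomorphic_line_bundle_def by blast
    then show ?thesis
      using fibre_coordinate_lincomb[where m = N and s = s, OF holomorphic_line_bundle_coordinate[OF L]] sf x by simp
  qed
  moreover have "holomorphic_Cn (mdim M) (snd ch ` (fst ch \<inter> fst \<tau>)) (\<lambda>z. snd \<tau> (?f (chart_inv ch z)))"
    if \<tau>: "\<tau> \<in> triv L" and ch: "ch \<in> atlas M" for \<tau> ch
  proof (rule holomorphic_Cn_cong)
    show "holomorphic_Cn (mdim M) (snd ch ` (fst ch \<inter> fst \<tau>)) (\<lambda>z. \<Sum>j\<le>N. c j * snd \<tau> (s j (chart_inv ch z)))"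
      by (rule holomorphic_Cn_sum) (use s \<tau> ch in \<open>auto simp: hol_sections_def holomorphic_fun_def\<close>)
    show "openin (Cn (mdim M)) (snd ch ` (fst ch \<inter> fst \<tau>))"
      by (rule openin_chart_image[OF M ch tx(2)[OF \<tau>]])
    fix z assume "z \<in> snd ch ` (fst ch \<inter> fst \<tau>)"
    then obtain x where x: "x \<in> fst ch" "x \<in> fst \<tau>" "z = snd ch x" by auto
    then have "chart_inv ch z = x" using chart_inv_chart[OF M ch] by simp
    then show "(\<Sum>j\<le>N. c j * snd \<tau> (s j (chart_inv ch z))) = snd \<tau> (?f (chart_inv ch z))"
      using fibre_coordinate_lincomb[where m = N and s = s, OF holomorphic_line_bundle_coordinate[OF L \<tau> x(2)]] sf x tx(1)[OF \<tau>]
      by (simp add: subset_iff)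
  qed
  ultimately show ?thesis unfolding hol_sections_def holomorphic_fun_def by auto
qed

section \<open>Integrability of products of sections\<close>

lemma continuous_map_locally:
  assumes cover: "\<And>x. x \<in> topspace X \<Longrightarrow> \<exists>W. openin X W \<and> x \<in> W \<and> continuous_map (subtopology X W) Y f"
  shows "continuous_map X Y f"
  unfolding continuous_map_def
proof (intro conjI allI impI funcsetI)
  fix x assume x: "x \<in> topspace X"
  then obtain W where W: "openin X W" "x \<in> W" "continuous_map (subtopology X W) Y f" using cover by blast
  then show "f x \<in> topspace Y" using x by (auto simp: continuous_map_def Pi_iff)
next
  fix U assume U: "openin Y U"
  show "openin X {x \<in> topspace X. f x \<in> U}"
  proof (subst openin_subopen, intro ballI)
    fix x assume x: "x \<in> {x \<in> topspace X. f x \<in> U}"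
    then obtain W where W: "openin X W" "x \<in> W" "continuous_map (subtopology X W) Y f" using cover by blast
    have "openin (subtopology X W) {y \<in> topspace (subtopology X W). f y \<in> U}"
      by (rule openin_continuous_map_preimage[OF W(3) U])
    then have "openin X {y \<in> topspace (subtopology X W). f y \<in> U}"
      using W(1) by (simp add: openin_open_subtopology)
    then show "\<exists>T. openin X T \<and> x \<in> T \<and> T \<subseteq> {x \<in> topspace X. f x \<in> U}"
      using x W(2) by (intro exI[of _ "{y \<in> topspace (subtopology X W). f y \<in> U}"]) auto
  qed
qed

lemma hermitian_metric_sesquilinear:
  "hermitian_metric M L h \<Longrightarrow> x \<in> mpoints M \<Longrightarrow> sesquilinear_on_fibre L h x"
  unfolding hermitian_metric_def sesquilinear_on_fibre_def by blast

lemma frame_fibre: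
  assumes "fibre_coordinate L x (snd \<tau>)"
  shows "frame L \<tau> x \<in> fibre L x" "snd \<tau> (frame L \<tau> x) = 1"
proof -
  have "1 \<in> snd \<tau> ` fibre L x" using assms by (simp add: fibre_coordinate_def bij_betw_def)
  then show "frame L \<tau> x \<in> fibre L x" "snd \<tau> (frame L \<tau> x) = 1"
    unfolding frame_def by (rule inv_into_into, rule f_inv_into_f)
qed

text \<open>In a frame e the function is conj(f) g h(e,e), with f and g the holomorphic components
  of the sections. Continuity of h(e,e) is the case \<open>k = 0\<close> of smoothness.\<close>

lemma continuous_map_metric_sections:
  assumes M: "complex_manifold M" and L: "holomorphic_line_bundle M L" and h: "hermitian_metric M L h"
    and f: "f \<in> hol_sections M L" and g: "g \<in> hol_sections M L"
  shows "continuous_map (mtop M) euclidean (\<lambda>x. h (f x) (g x))"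
proof (rule continuous_map_locally)
  fix x assume x: "x \<in> mpoints M"
  obtain \<tau> where \<tau>: "\<tau> \<in> triv L" "x \<in> fst \<tau>" using L x unfolding holomorphic_line_bundle_def by blast
  obtain c where c: "c \<in> atlas M" "x \<in> fst c" using M x unfolding complex_manifold_def by blast
  have o\<tau>: "openin (mtop M) (fst \<tau>)" using L \<tau> unfolding holomorphic_line_bundle_def by blast
  have oc: "openin (mtop M) (fst c)"
    and hm: "homeomorphic_map (subtopology (mtop M) (fst c)) (subtopology (Cn (mdim M)) (snd c ` fst c)) (snd c)"
    using M c unfolding complex_manifold_def by auto
  define W where "W = fst c \<inter> fst \<tau>"
  define G where "G z = cnj (snd \<tau> (f (chart_inv c z))) * snd \<tau> (g (chart_inv c z)) *
      h (frame L \<tau> (chart_inv c z)) (frame L \<tau> (chart_inv c z))" for z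
  have W: "openin (mtop M) W" unfolding W_def using oc o\<tau> by (rule openin_Int)
  have fc: "continuous_map (subtopology (Cn (mdim M)) (snd c ` W)) euclidean (\<lambda>z. snd \<tau> (k (chart_inv c z)))"
    if "k \<in> hol_sections M L" for k
    using that \<tau> c unfolding hol_sections_def holomorphic_fun_def holomorphic_Cn_def W_def by blast
  have "Ck_on (mdim M) (snd c ` W) 0 (\<lambda>z. h (frame L \<tau> (chart_inv c z)) (frame L \<tau> (chart_inv c z)))"
    using h \<tau> c unfolding hermitian_metric_def smooth_Cn_def W_def by blast
  then have "continuous_map (subtopology (Cn (mdim M)) (snd c ` W)) euclidean
      (\<lambda>z. h (frame L \<tau> (chart_inv c z)) (frame L \<tau> (chart_inv c z)))" by simp
  then have G: "continuous_map (subtopology (Cn (mdim M)) (snd c ` W)) euclidean G"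
    unfolding G_def[abs_def] by (intro continuous_map_mult_normed continuous_map_cnj fc f g)
  have "continuous_map (subtopology (mtop M) (fst c)) (Cn (mdim M)) (snd c)"
    using homeomorphic_imp_continuous_map[OF hm] by (simp add: continuous_map_in_subtopology)
  then have "continuous_map (subtopology (subtopology (mtop M) (fst c)) W) (Cn (mdim M)) (snd c)"
    by (rule continuous_map_from_subtopology)
  moreover have "subtopology (subtopology (mtop M) (fst c)) W = subtopology (mtop M) W"
    by (simp add: subtopology_subtopology W_def Int_assoc[symmetric])
  ultimately have sc: "continuous_map (subtopology (mtop M) W) (subtopology (Cn (mdim M)) (snd c ` W)) (snd c)"
    by (auto simp: continuous_map_in_subtopology)
  have "continuous_map (subtopology (mtop M) W) euclidean (G \<circ> snd c)"
    by (rule continuous_map_compose[OF sc G])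
  then have "continuous_map (subtopology (mtop M) W) euclidean (\<lambda>x. h (f x) (g x))"
  proof (rule continuous_map_eq)
    fix y assume "y \<in> topspace (subtopology (mtop M) W)"
    then have y: "y \<in> mpoints M" "y \<in> fst c" "y \<in> fst \<tau>" by (auto simp: W_def)
    have fib: "f y \<in> fibre L y" "g y \<in> fibre L y" using f g y by (auto simp: hol_sections_def)
    note \<theta> = holomorphic_line_bundle_coordinate[OF L \<tau>(1) y(3)]
    show "(G \<circ> snd c) y = h (f y) (g y)"
      using sesquilinear_on_fibre_eq[OF hermitian_metric_sesquilinear[OF h y(1)] \<theta> fib frame_fibre[OF \<theta>]]
      by (simp add: G_def chart_inv_chart[OF M c(1) y(2)])
  qed
  then show "\<exists>W. openin (mtop M) W \<and> x \<in> W \<and> continuous_map (subtopology (mtop M) W) euclidean (\<lambda>x. h (f x) (g x))"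
    using W c \<tau> by (auto simp: W_def)
qed

lemma measurable_liouville:
  fixes f :: "'a \<Rightarrow> complex"
  assumes "continuous_map (mtop M) euclidean f"
  shows "f \<in> borel_measurable (liouville_measure M \<omega>)"
proof (rule borel_measurableI)
  fix U :: "complex set" assume "open U"
  then have "openin (mtop M) {x \<in> mpoints M. f x \<in> U}"
    using openin_continuous_map_preimage[OF assms, of U] by simp
  then have "{x \<in> mpoints M. f x \<in> U} \<in> sets (liouville_measure M \<omega>)"
    unfolding sets_liouville_measure by (intro sigma_sets.Basic) simp
  also have "{x \<in> mpoints M. f x \<in> U} = f -` U \<inter> space (liouville_measure M \<omega>)"
    by (auto simp: space_liouville_measure)
  finally show "f -` U \<inter> space (liouville_measure M \<omega>) \<in> sets (liouville_measure M \<omega>)" .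
qed

text \<open>The integral of a function that is not integrable is 0, so nonzero norms force h(f,f)
  and h(g,g) to be integrable. On a one-dimensional fibre these two dominate h(f,g).\<close>

lemma integrable_metric_sections:
  assumes M: "complex_manifold M" and L: "holomorphic_line_bundle M L" and h: "hermitian_metric M L h"
    and f: "f \<in> hol_sections M L" and g: "g \<in> hol_sections M L"
    and nz: "scalar_product M \<omega> h f f \<noteq> 0" "scalar_product M \<omega> h g g \<noteq> 0"
  shows "integrable (liouville_measure M \<omega>) (\<lambda>x. h (f x) (g x))"
proof (rule Bochner_Integration.integrable_bound)
  have i: "integrable (liouville_measure M \<omega>) (\<lambda>x. h (f x) (f x))" "integrable (liouville_measure M \<omega>) (\<lambda>x. h (g x) (g x))"
    using nz not_integrable_integral_eq unfolding scalar_product_def by blast+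
  show "integrable (liouville_measure M \<omega>) (\<lambda>x. cmod (h (f x) (f x)) + cmod (h (g x) (g x)))"
    by (intro Bochner_Integration.integrable_add integrable_norm i)
  show "(\<lambda>x. h (f x) (g x)) \<in> borel_measurable (liouville_measure M \<omega>)"
    by (rule measurable_liouville[OF continuous_map_metric_sections[OF M L h f g]])
  show "AE x in liouville_measure M \<omega>. cmod (h (f x) (g x)) \<le> norm (cmod (h (f x) (f x)) + cmod (h (g x) (g x)))"
  proof (rule AE_I2)
    fix x assume "x \<in> space (liouville_measure M \<omega>)"
    then have x: "x \<in> mpoints M" by (simp add: space_liouville_measure)
    obtain \<tau> where \<tau>: "\<tau> \<in> triv L" "x \<in> fst \<tau>" using L x unfolding holomorphic_line_bundle_def by blast
    note \<theta> = holomorphic_line_bundle_coordinate[OF L \<tau>]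
    have fib: "f x \<in> fibre L x" "g x \<in> fibre L x" using f g x by (auto simp: hol_sections_def)
    note eq = sesquilinear_on_fibre_eq[OF hermitian_metric_sesquilinear[OF h x] \<theta> _ _ frame_fibre[OF \<theta>]]
    define a b e where "a = cmod (snd \<tau> (f x))" and "b = cmod (snd \<tau> (g x))" and "e = cmod (h (frame L \<tau> x) (frame L \<tau> x))"
    have "0 \<le> a * b" by (simp add: a_def b_def)
    then have "a * b \<le> a * a + b * b"
      using sum_squares_bound[of a b] unfolding power2_eq_square by linarith
    then have "a * b * e \<le> (a * a + b * b) * e" by (intro mult_right_mono) (auto simp: e_def)
    moreover have "cmod (h (f x) (g x)) = a * b * e" "cmod (h (f x) (f x)) = a * a * e" "cmod (h (g x) (g x)) = b * b * e"
      unfolding eq[OF fib(1) fib(2)] eq[OF fib(1) fib(1)] eq[OF fib(2) fib(2)] by (simp_all add: norm_mult a_def b_def e_def)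
    ultimately show "cmod (h (f x) (g x)) \<le> norm (cmod (h (f x) (f x)) + cmod (h (g x) (g x)))"
      by (simp add: distrib_right e_def)
  qed
qed

lemma orthogonal_sections_orthonormal:
  assumes M: "complex_manifold M" and q: "quantum_line_bundle M \<omega> L h" and s: "orthonormal_section_basis M \<omega> L h N s"
  shows "orthogonal_sections M \<omega> L h N s 1"
proof -
  have L: "holomorphic_line_bundle M L" and h: "hermitian_metric M L h"
    using q by (auto simp: quantum_line_bundle_def)
  have sh: "s j \<in> hol_sections M L" if "j \<le> N" for j
    using s that by (auto simp: orthonormal_section_basis_def section_basis_def)
  have sp: "scalar_product M \<omega> h (s j) (s k) = (if j = k then 1 else 0)" if "j \<le> N" "k \<le> N" for j k
    using s that by (auto simp: orthonormal_section_basis_def)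
  show ?thesis
  proof unfold_locales
    show "\<exists>\<theta>. fibre_coordinate L x \<theta>" if x: "x \<in> mpoints M" for x
    proof -
      obtain \<tau> where "\<tau> \<in> triv L" "x \<in> fst \<tau>" using L x unfolding holomorphic_line_bundle_def by blast
      then show ?thesis using holomorphic_line_bundle_coordinate[OF L] by blast
    qed
    show "sesquilinear_on_fibre L h x" if "x \<in> mpoints M" for x
      by (rule hermitian_metric_sesquilinear[OF h that])
    show "s j x \<in> fibre L x" if "j \<le> N" "x \<in> mpoints M" for j x
      using sh[OF that(1)] that(2) by (simp add: hol_sections_def)
    show "f \<in> hol_sections M L \<longleftrightarrow> (\<exists>c. f = (\<lambda>x\<in>mpoints M. lincomb L c s N x))" for f
    proof
      assume "f \<in> hol_sections M L"
      then have "\<exists>!c. c \<in> extensional {..N} \<and> f = (\<lambda>x\<in>mpoints M. lincomb L c s N x)"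
        using s unfolding orthonormal_section_basis_def section_basis_def by blast
      then show "\<exists>c. f = (\<lambda>x\<in>mpoints M. lincomb L c s N x)" by blast
    next
      assume "\<exists>c. f = (\<lambda>x\<in>mpoints M. lincomb L c s N x)"
      then obtain c where f: "f = (\<lambda>x\<in>mpoints M. lincomb L c s N x)" by blast
      show "f \<in> hol_sections M L" unfolding f by (rule hol_sections_lincomb[OF M L sh])
    qed
    show "integrable (liouville_measure M \<omega>) (\<lambda>x. h (s j x) (s k x))" if "j \<le> N" "k \<le> N" for j k
      by (rule integrable_metric_sections[OF M L h sh[OF that(1)] sh[OF that(2)]]) (use sp that in auto)
  qed (use sp in auto)
qed

text \<open>A functional on a line is determined by its value at the nonzero vector v, and every
  value occurs.\<close>

lemma fibre_coordinate_hyperplane_bundle: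
  assumes v: "v \<in> hvectors N"
  shows "fibre_coordinate (hyperplane_bundle N) (line N v) (\<lambda>p. snd p v)"
proof -
  let ?H = "hyperplane_bundle N" and ?l = "line N v"
  have vl: "v \<in> ?l" by (rule mem_line_self[OF hvectorsD[OF v]])
  have lP: "?l \<in> line N ` hvectors N" using v by simp
  have val: "snd p (hscale N a v) = a * snd p v" if "p \<in> fibre ?H ?l" for p a
    using that vl by (auto simp: fibre_hyperplane_bundle)
  have inj: "inj_on (\<lambda>p. snd p v) (fibre ?H ?l)"
  proof (rule inj_onI)
    fix p q assume p: "p \<in> fibre ?H ?l" and q: "q \<in> fibre ?H ?l" and eq: "snd p v = snd q v"
    have "snd p = snd q"
    proof (rule extensionalityI[of _ ?l])
      fix z assume "z \<in> ?l"
      then obtain a where "z = hscale N a v" by (auto simp: line_def)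
      then show "snd p z = snd q z" using val[OF p] val[OF q] eq by simp
    qed (use p q in \<open>auto simp: fibre_hyperplane_bundle\<close>)
    then show "p = q" using p q by (simp add: fibre_hyperplane_bundle prod_eq_iff)
  qed
  have surj: "(\<lambda>p. snd p v) ` fibre ?H ?l = UNIV"
  proof (intro equalityI subsetI UNIV_I)
    fix a :: complex
    obtain k where k: "k \<le> N" "v k \<noteq> 0" using v by (auto simp: hvectors_def)
    \<comment> \<open>These are the coefficients of the linear form (a / v_k) Z_k, whose value at v
      is a.\<close>
    define c where "c j = (if j = k then a / v k else 0)" for j
    have "(\<Sum>j\<le>N. c j * v j) = (\<Sum>j\<le>N. if j = k then a else 0)"
      by (intro sum.cong) (use k in \<open>auto simp: c_def\<close>)
    then have "a = snd (?l, \<lambda>z\<in>?l. \<Sum>j\<le>N. c j * z j) v" using vl k by simp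
    then show "a \<in> (\<lambda>p. snd p v) ` fibre ?H ?l" using linear_form_fibre[OF lP, of c] by (rule image_eqI)
  qed
  have cl: "hadd N z w \<in> ?l" "hscale N a z \<in> ?l" if "z \<in> ?l" "w \<in> ?l" for z w a
    using line_closed[OF that] by auto
  show ?thesis
    unfolding fibre_coordinate_def
  proof (intro conjI ballI allI)
    show "bij_betw (\<lambda>p. snd p v) (fibre ?H ?l) UNIV" using inj surj by (simp add: bij_betw_def)
    fix p q assume p: "p \<in> fibre ?H ?l" and q: "q \<in> fibre ?H ?l"
    have "fadd ?H p q = (?l, \<lambda>z\<in>?l. snd p z + snd q z)"
      using p q by (cases p; cases q) (simp add: fibre_hyperplane_bundle, simp add: hyperplane_bundle_def)
    then show "fadd ?H p q \<in> fibre ?H ?l" "snd (fadd ?H p q) v = snd p v + snd q v"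
      using p q vl by (auto simp: fibre_hyperplane_bundle cl algebra_simps)
  next
    fix a q assume q: "q \<in> fibre ?H ?l"
    have "fscale ?H a q = (?l, \<lambda>z\<in>?l. a * snd q z)"
      using q by (cases q) (simp add: fibre_hyperplane_bundle, simp add: hyperplane_bundle_def)
    then show "fscale ?H a q \<in> fibre ?H ?l" "snd (fscale ?H a q) v = a * snd q v"
      using q vl by (auto simp: fibre_hyperplane_bundle cl algebra_simps)
  qed
qed

lemma hyperplane_metric_sesquilinear:
  assumes v: "v \<in> hvectors N"
  shows "sesquilinear_on_fibre (hyperplane_bundle N) (hyperplane_metric N) (line N v)"
  unfolding sesquilinear_on_fibre_def
proof (intro ballI conjI allI)
  let ?H = "hyperplane_bundle N" and ?l = "line N v"
  define z where "z = (SOME z. z \<in> ?l \<inter> hvectors N)"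
  have "v \<in> ?l \<inter> hvectors N" using v mem_line_self[OF hvectorsD[OF v]] by simp
  then have z: "z \<in> ?l" unfolding z_def using someI[of "\<lambda>w. w \<in> line N v \<inter> hvectors N"] by blast
  have eq: "hyperplane_metric N p q = cnj (snd p z) * snd q z / of_real (\<Sum>i\<le>N. (cmod (z i))\<^sup>2)"
    if "p \<in> fibre ?H ?l" for p q
    using that unfolding hyperplane_metric_def z_def by (simp add: fibre_hyperplane_bundle Let_def)
  fix p q assume p: "p \<in> fibre ?H ?l" and q: "q \<in> fibre ?H ?l"
  show "hyperplane_metric N q p = cnj (hyperplane_metric N p q)"
    unfolding eq[OF p] eq[OF q] by (simp add: mult.commute)
  fix a
  have "snd (fscale ?H a q) z = a * snd q z"
    using q z by (cases q) (simp add: fibre_hyperplane_bundle, simp add: hyperplane_bundle_def)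
  then show "hyperplane_metric N p (fscale ?H a q) = a * hyperplane_metric N p q"
    unfolding eq[OF p] by simp
qed

lemma orthogonal_sections_projective_space:
  "orthogonal_sections (projective_space N) (fubini_study N) (hyperplane_bundle N) (hyperplane_metric N) N (coord_section N)
    (vol (projective_space N) (fubini_study N) / (real N + 1))"
proof
  show "\<exists>\<theta>. fibre_coordinate (hyperplane_bundle N) x \<theta>" if "x \<in> mpoints (projective_space N)" for x
    using that fibre_coordinate_hyperplane_bundle by auto
  show "sesquilinear_on_fibre (hyperplane_bundle N) (hyperplane_metric N) x" if "x \<in> mpoints (projective_space N)" for x
    using that hyperplane_metric_sesquilinear by auto
  show "coord_section N j x \<in> fibre (hyperplane_bundle N) x" if "j \<le> N" "x \<in> mpoints (projective_space N)" for j x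
  proof -
    have "(\<Sum>i\<le>N. (if i = j then 1 else 0) * z i) = z j" for z :: "nat \<Rightarrow> complex"
      using that(1) by (simp add: if_distrib[of "\<lambda>x. x * _"] cong: if_cong)
    then show ?thesis using that linear_form_fibre[of x N "\<lambda>i. if i = j then 1 else 0"] by (simp add: coord_section_def)
  qed
  show "f \<in> hol_sections (projective_space N) (hyperplane_bundle N) \<longleftrightarrow>
    (\<exists>c. f = (\<lambda>x\<in>mpoints (projective_space N). lincomb (hyperplane_bundle N) c (coord_section N) N x))" for f
    unfolding mpoints_projective_space by (rule hol_section_hyperplane_bundle_iff)
  show "scalar_product (projective_space N) (fubini_study N) (hyperplane_metric N) (coord_section N j) (coord_section N k) =
      (if j = k then complex_of_real (vol (projective_space N) (fubini_study N) / (real N + 1)) else 0)" if "j \<le> N" "k \<le> N" for j k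
    unfolding scalar_product_def by (rule coord_sections_orthogonal(2)[OF that])
  show "vol (projective_space N) (fubini_study N) / (real N + 1) \<noteq> 0" using vol_pos[of N] by simp
qed (rule coord_sections_orthogonal(1))

section \<open>Transport along the isomorphism between the pullback bundle and L\<close>

lemma fibre_pullback_bundle:
  "(w, q) \<in> fibre (pullback_bundle M f H) u \<longleftrightarrow> w = u \<and> u \<in> mpoints M \<and> q \<in> fibre H (f u)"
  unfolding fibre_def[of "pullback_bundle M f H"] by (auto simp: pullback_bundle_def)

theorem theorem4p5:
  fixes M :: "'a cmanifold" and \<omega> :: "'a form11"
    and L :: "('a, 'l) line_bundle" and h :: "'l \<Rightarrow> 'l \<Rightarrow> complex"
    and N :: nat and s :: "nat \<Rightarrow> 'a \<Rightarrow> 'l"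
    and i :: "'a \<Rightarrow> (nat \<Rightarrow> complex) set"
    and \<Phi> :: "'a \<times> hyp \<Rightarrow> 'l"
    and t :: "(nat \<Rightarrow> complex) set \<Rightarrow> hyp"
    and V :: "(nat \<Rightarrow> complex) set set"
    and x y :: 'a
  assumes "complex_manifold M" and "compact_space (mtop M)" and "connected_space (mtop M)"
    and "kaehler_form M \<omega>"
    and "quantum_line_bundle M \<omega> L h" and "very_ample M L"
    and "orthonormal_section_basis M \<omega> L h N s"
    and "i = projective_map L N s"
    and "line_bundle_iso M (pullback_bundle M i (hyperplane_bundle N)) L \<Phi>"
    and "\<And>j u. j \<le> N \<Longrightarrow> u \<in> mpoints M \<Longrightarrow> \<Phi> (pullback_section M i (coord_section N j) u) = s j u"
    and "t \<in> hol_sections (projective_space N) (hyperplane_bundle N)"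
    and "\<exists>z\<in>mpoints (projective_space N). t z \<in> nonzero (hyperplane_bundle N)"
    and "V = {z \<in> mpoints (projective_space N). t z \<in> nonzero (hyperplane_bundle N)}"
    and "x \<in> mpoints M" and "y \<in> mpoints M" and "i x \<in> V" and "i y \<in> V"
  shows "coherent_product M \<omega> L h (\<lambda>u. \<Phi> (pullback_section M i t u)) x y =
    complex_of_real (vol (projective_space N) (fubini_study N) / (real N + 1)) *
    coherent_product (projective_space N) (fubini_study N) (hyperplane_bundle N) (hyperplane_metric N)
      t (i x) (i y)"
proof -
  let ?H = "hyperplane_bundle N" and ?P = "projective_space N"
  let ?K = "pullback_bundle M i ?H" and ?\<sigma> = "\<lambda>u. \<Phi> (pullback_section M i t u)"
  define v where "v = vol ?P (fubini_study N) / (real N + 1)"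
  interpret P: orthogonal_sections ?P "fubini_study N" ?H "hyperplane_metric N" N "coord_section N" v
    unfolding v_def by (rule orthogonal_sections_projective_space)
  interpret M: orthogonal_sections M \<omega> L h N s 1
    by (rule orthogonal_sections_orthonormal[OF assms(1,5,7)])
  have t: "i u \<in> mpoints ?P" "t (i u) \<in> fibre ?H (i u)" "t (i u) \<in> nonzero ?H" if "i u \<in> V" for u
    using that assms(11) unfolding assms(13) hol_sections_def by auto
  have key: "?\<sigma> u \<in> fibre L u \<and> ?\<sigma> u \<in> nonzero L \<and>
      (\<forall>j\<le>N. qhat L (?\<sigma> u) (s j) = qhat ?H (t (i u)) (coord_section N j))"
    if u: "u \<in> mpoints M" and iu: "i u \<in> V" for u
  proof -
    have fibK: "(w, q) \<in> fibre ?K u \<longleftrightarrow> w = u \<and> q \<in> fibre ?H (i u)" for w q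
      using u by (simp add: fibre_pullback_bundle)
    have scaleK: "fscale ?K a (u, q) = (u, fscale ?H a q)" for a q by (simp add: pullback_bundle_def)
    have bij: "bij_betw \<Phi> (fibre ?K u) (fibre L u)"
      and \<Phi>_scale: "\<And>a q. q \<in> fibre ?K u \<Longrightarrow> \<Phi> (fscale ?K a q) = fscale L a (\<Phi> q)"
      using assms(9) u unfolding line_bundle_iso_def by blast+
    obtain \<theta> where \<theta>: "fibre_coordinate ?H (i u) \<theta>" using P.fibre_coordinate[OF t(1)[OF iu]] by blast
    obtain \<eta> where \<eta>: "fibre_coordinate L u \<eta>" using M.fibre_coordinate[OF u] by blast
    have \<sigma>: "?\<sigma> u = \<Phi> (u, t (i u))" using u by (simp add: pullback_section_def)
    have tK: "(u, t (i u)) \<in> fibre ?K u" using t(2)[OF iu] by (simp only: fibK simp_thms)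
    have \<sigma>_fib: "?\<sigma> u \<in> fibre L u" unfolding \<sigma> using bij tK by (rule bij_betwE[THEN bspec])
    \<comment> \<open>\<Phi> commutes with scaling by 0 and is injective on the fibre, so a zero of
      the transported section over \<open>u\<close> would be a zero of \<open>t\<close> at
      \<open>i u\<close>.\<close>
    have \<sigma>_nz: "?\<sigma> u \<in> nonzero L"
    proof (rule ccontr)
      assume "\<not> ?thesis"
      then have "fscale L 0 (?\<sigma> u) = ?\<sigma> u" using \<sigma>_fib by (simp add: nonzero_def fibre_def)
      then have "\<Phi> (fscale ?K 0 (u, t (i u))) = \<Phi> (u, t (i u))" unfolding \<sigma> \<Phi>_scale[OF tK] .
      moreover have "fscale ?K 0 (u, t (i u)) \<in> fibre ?K u"
        unfolding scaleK fibK using fibre_coordinateD(3)[OF \<theta> t(2,2)[OF iu]] by simp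
      ultimately have "fscale ?K 0 (u, t (i u)) = (u, t (i u))"
        using bij tK by (meson bij_betw_def inj_onD)
      then show False using t(3)[OF iu] by (simp add: scaleK nonzero_def)
    qed
    have "qhat L (?\<sigma> u) (s j) = qhat ?H (t (i u)) (coord_section N j)" if j: "j \<le> N" for j
    proof (rule qhat_eqI[where f = "s j", OF \<eta> \<sigma>_fib \<sigma>_nz])
      have c: "coord_section N j (i u) = fscale ?H (qhat ?H (t (i u)) (coord_section N j)) (t (i u))"
        by (rule qhat_fibre_coordinate(1)[where f = "coord_section N j", OF \<theta> t(2,3)[OF iu] P.s_fibre[OF j t(1)[OF iu]]])
      have "s j u = \<Phi> (u, coord_section N j (i u))"
        using assms(10)[OF j u] u by (simp add: pullback_section_def)
      also have "\<dots> = \<Phi> (fscale ?K (qhat ?H (t (i u)) (coord_section N j)) (u, t (i u)))"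
        unfolding scaleK using c by simp
      also have "\<dots> = fscale L (qhat ?H (t (i u)) (coord_section N j)) (?\<sigma> u)"
        unfolding \<sigma> by (rule \<Phi>_scale[OF tK])
      finally show "s j u = fscale L (qhat ?H (t (i u)) (coord_section N j)) (?\<sigma> u)" .
    qed
    then show ?thesis using \<sigma>_fib \<sigma>_nz by blast
  qed
  note kx = key[OF assms(14,16)] and ky = key[OF assms(15,17)]
  have "coherent_product M \<omega> L h ?\<sigma> x y = (\<Sum>j\<le>N. qhat L (?\<sigma> x) (s j) * cnj (qhat L (?\<sigma> y) (s j)))"
    using M.coherent_product_eq[of x ?\<sigma> y] kx ky assms(14,15) by simp
  also have "\<dots> = (\<Sum>j\<le>N. qhat ?H (t (i x)) (coord_section N j) * cnj (qhat ?H (t (i y)) (coord_section N j)))"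
    using kx ky by (intro sum.cong refl) simp
  \<comment> \<open>The factor \<open>v\<close> of the claim undoes the 1 / v in the coherent
    product of P^N.\<close>
  also have "\<dots> = of_real v * coherent_product ?P (fubini_study N) ?H (hyperplane_metric N) t (i x) (i y)"
    using P.coherent_product_eq[of "i x" t "i y"] t[OF assms(16)] t[OF assms(17)] P.v_nonzero by simp
  finally show ?thesis unfolding v_def .
qed

end
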